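(* Let $\Omega$ be a set and let $G \leq \mathrm{Sym}(\Omega)$ be an infinite primitive permutation group with a finite point stabilizer $G_\alpha$ (where $\alpha \in \Omega$). Then: (a) $G$ is generated by finitely many elements of finite order, and $G$ possesses a unique (non-trivial) minimal normal subgroup $M$. (b) There exists an infinite, nonabelian, finitely generated simple group $K$ such that $M = K_1 \times \cdots \times K_m$ (internal direct product), where $m \geq 1$ is finite and $K_i \cong K$ for $1 \leq i \leq m$. (c) The stabilizer $G_\alpha$ acts transitively on the set of components $\{K_1, \ldots, K_m\}$ of $M$ by conjugation. (d) $G$ falls into precisely one of the following categories: (1) $M$ is simple and acts regularly on $\Omega$, and $G$ is equal to the split extension $M.G_\beta$ for some $\beta \in \Omega$, with no non-identity element of $G_\beta$ inducing an inner automorphism of $M$; (2) $M$ is simple and acts non-regularly on $\Omega$, with $M$ of finite index in $G$ and $M \leq G \leq \mathrm{Aut}(M)$; (3) $M$ is non-simple. In this case $m > 1$, and $G$ is permutation isomorphic to a subgroup of the wreath product $H \,\mathrm{Wr}_\Delta\, \mathrm{Sym}(\Delta)$ acting via the product action on $\Gamma^m$, where $\Delta = \{1, \ldots, m\}$, $\Gamma$ is some infinite set and $H \leq \mathrm{Sym}(\Gamma)$ is an infinite primitive group with a finite point stabilizer. Here $K$ is the unique minimal normal subgroup of $H$. Moreover, if $M$ is regular then $H$ is of type (1), and if $M$ is non-regular then $H$ is of type (2).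
   Context: $\mathrm{Sym}(\Omega)$ is the full symmetric group of $\Omega$; actions are written on the right as $\alpha^g$, and $K^g := g^{-1}Kg$. A transitive permutation group $G$ on $\Omega$ is primitive if the only $G$-invariant partitions of $\Omega$ are $\{\{\alpha\} : \alpha \in \Omega\}$ and $\{\Omega\}$. $G_\alpha$ is the stabilizer of $\alpha$ in $G$. A minimal normal subgroup of a non-trivial group $G$ is a non-trivial normal subgroup of $G$ that does not properly contain any other non-trivial normal subgroup of $G$. A group acts regularly if it acts transitively with trivial point stabilizers. "$G$ is equal to the split extension $M.G_\beta$" means $M \unlhd G$, $G = MG_\beta$ and $M \cap G_\beta = \langle 1 \rangle$. An element $g \in G$ induces an automorphism of $M$ via $x \mapsto g^{-1}xg$. "$M \leq G \leq \mathrm{Aut}(M)$" means that the conjugation action of $G$ on $M$ is faithful, so that $G$ is identified with a subgroup of $\mathrm{Aut}(M)$ in which $M$ is identified with the group of inner automorphisms of $M$. Two permutation groups $G \leq \mathrm{Sym}(\Omega)$ and $G' \leq \mathrm{Sym}(\Omega')$ are permutation isomorphic if there exist a group isomorphism $\phi : G \to G'$ and a bijection $\theta : \Omega \to \Omega'$ with $\theta(\omega^g) = \theta(\omega)^{\phi(g)}$ for all $\omega \in \Omega$, $g \in G$. For $H \leq \mathrm{Sym}(\Gamma)$ and $\Delta = \{1,\ldots,m\}$, the wreath product $H \,\mathrm{Wr}_\Delta\, \mathrm{Sym}(\Delta)$ is the semidirect product of the base group $H^m$ by $\mathrm{Sym}(\Delta)$, with $\mathrm{Sym}(\Delta)$ permuting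 the $m$ coordinates. In its product action on $\Gamma^m$, the base group acts coordinatewise, $(\delta_1, \ldots, \delta_m)^{(h_1, \ldots, h_m)} = (\delta_1^{h_1}, \ldots, \delta_m^{h_m})$, and $\sigma \in \mathrm{Sym}(\Delta)$ permutes coordinates, so that the $i^\sigma$-th coordinate of $\underline{\delta}^\sigma$ is the $i$-th coordinate of $\underline{\delta}$. "$K$ is the unique minimal normal subgroup of $H$" is meant up to isomorphism (the unique minimal normal subgroup of $H$ is an isomorphic copy of $K$). "$H$ is of type (1)" (respectively "(2)") means that the conditions in category (1) (respectively (2)) hold with $G$, $\Omega$ and $M$ replaced by $H$, $\Gamma$ and the unique minimal normal subgroup of $H$. *)

theory Defs
  imports "HOL-Algebra.Algebra" "HOL-Library.Disjoint_Sets"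
begin

text \<open>
  A permutation group on \<open>\<Omega>\<close> is a subgroup of \<^const>\<open>BijGroup\<close> \<open>\<Omega>\<close>, given by its underlying set
  of permutations. Products in \<^const>\<open>BijGroup\<close> are compositions of functions, so permutations act
  from the left: \<open>x \<otimes> y\<close> applies \<open>y\<close> first. A word in the right-action convention denotes the
  same permutation as the reversed word here; in particular the conjugate written
  \<open>g\<^sup>-\<^sup>1 x g\<close> for right actions is \<open>g \<otimes> x \<otimes> inv g\<close>.
\<close>

abbreviation perm_grp :: "'a set \<Rightarrow> ('a \<Rightarrow> 'a) set \<Rightarrow> ('a \<Rightarrow> 'a) monoid"
  where "perm_grp \<Omega> G \<equiv> (BijGroup \<Omega>)\<lparr>carrier := G\<rparr>"

abbreviation point_stabilizer :: "'a set \<Rightarrow> ('a \<Rightarrow> 'a) set \<Rightarrow> 'a \<Rightarrow> ('a \<Rightarrow> 'a) set"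
  where "point_stabilizer \<Omega> G \<alpha> \<equiv> stabilizer (perm_grp \<Omega> G) (\<lambda>g. g) \<alpha>"

definition transitive_on :: "'a set \<Rightarrow> ('a \<Rightarrow> 'a) set \<Rightarrow> bool"
  where "transitive_on \<Omega> G \<longleftrightarrow> transitive_action (perm_grp \<Omega> G) \<Omega> (\<lambda>g. g)"

definition primitive_on :: "'a set \<Rightarrow> ('a \<Rightarrow> 'a) set \<Rightarrow> bool"
  where "primitive_on \<Omega> G \<longleftrightarrow>
    transitive_on \<Omega> G \<and>
    (\<forall>P. partition_on \<Omega> P \<and> (\<forall>g\<in>G. \<forall>B\<in>P. g ` B \<in> P) \<longrightarrow>
         P = {{\<omega>} | \<omega>. \<omega> \<in> \<Omega>} \<or> P = {\<Omega>})"

definition regular_on :: "'a set \<Rightarrow> ('a \<Rightarrow> 'a) set \<Rightarrow> bool"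
  where "regular_on \<Omega> G \<longleftrightarrow>
    transitive_on \<Omega> G \<and> (\<forall>\<omega>\<in>\<Omega>. point_stabilizer \<Omega> G \<omega> = {\<one>\<^bsub>BijGroup \<Omega>\<^esub>})"

definition permutation_isomorphic ::
    "'a set \<Rightarrow> ('a \<Rightarrow> 'a) set \<Rightarrow> 'b set \<Rightarrow> ('b \<Rightarrow> 'b) set \<Rightarrow> bool"
  where "permutation_isomorphic \<Omega> G \<Omega>' G' \<longleftrightarrow>
    (\<exists>\<phi> \<in> iso (perm_grp \<Omega> G) (perm_grp \<Omega>' G'). \<exists>\<theta>. bij_betw \<theta> \<Omega> \<Omega>' \<and>
       (\<forall>\<omega>\<in>\<Omega>. \<forall>g\<in>G. \<theta> (g \<omega>) = \<phi> g (\<theta> \<omega>)))"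

definition finitely_generated :: "('a, 'b) monoid_scheme \<Rightarrow> bool"
  where "finitely_generated G \<longleftrightarrow>
    (\<exists>S. finite S \<and> S \<subseteq> carrier G \<and> generate G S = carrier G)"

definition generated_by_finitely_many_torsion :: "('a, 'b) monoid_scheme \<Rightarrow> bool"
  where "generated_by_finitely_many_torsion G \<longleftrightarrow>
    (\<exists>S. finite S \<and> S \<subseteq> carrier G \<and> (\<forall>s\<in>S. group.ord G s \<noteq> 0) \<and>
         generate G S = carrier G)"
  \<comment> \<open>\<^const>\<open>group.ord\<close> is \<open>0\<close> exactly on elements of infinite order.\<close>

definition simple_grp :: "('a, 'b) monoid_scheme \<Rightarrow> bool"
  where "simple_grp G \<longleftrightarrow>
    group G \<and> carrier G \<noteq> {\<one>\<^bsub>G\<^esub>} \<and>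
    (\<forall>N. N \<lhd> G \<longrightarrow> N = {\<one>\<^bsub>G\<^esub>} \<or> N = carrier G)"
  \<comment> \<open>The library locale \<^locale>\<open>simple_group\<close> requires \<open>order G > 1\<close> with
      \<open>order G = card (carrier G)\<close>, and so excludes all infinite groups.\<close>

definition minimal_normal :: "'a set \<Rightarrow> ('a, 'b) monoid_scheme \<Rightarrow> bool"
  where "minimal_normal M G \<longleftrightarrow>
    M \<lhd> G \<and> M \<noteq> {\<one>\<^bsub>G\<^esub>} \<and>
    (\<forall>N. N \<lhd> G \<and> N \<noteq> {\<one>\<^bsub>G\<^esub>} \<longrightarrow> \<not> N \<subset> M)"

definition unique_minimal_normal :: "'a set \<Rightarrow> ('a, 'b) monoid_scheme \<Rightarrow> bool"
  where "unique_minimal_normal M G \<longleftrightarrow>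
    minimal_normal M G \<and> (\<forall>N. minimal_normal N G \<longrightarrow> N = M)"

definition internal_direct_product ::
    "('a, 'b) monoid_scheme \<Rightarrow> 'i set \<Rightarrow> ('i \<Rightarrow> 'a set) \<Rightarrow> bool"
  where "internal_direct_product M I K \<longleftrightarrow>
    (\<forall>i\<in>I. K i \<lhd> M) \<and>
    generate M (\<Union>i\<in>I. K i) = carrier M \<and>
    (\<forall>i\<in>I. K i \<inter> generate M (\<Union>j\<in>I - {i}. K j) = {\<one>\<^bsub>M\<^esub>})"

definition conj_on :: "('a, 'b) monoid_scheme \<Rightarrow> 'a set \<Rightarrow> 'a \<Rightarrow> 'a \<Rightarrow> 'a"
  where "conj_on G M g = (\<lambda>x\<in>M. g \<otimes>\<^bsub>G\<^esub> x \<otimes>\<^bsub>G\<^esub> inv\<^bsub>G\<^esub> g)"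

definition conj_on_sets :: "('a, 'b) monoid_scheme \<Rightarrow> 'a set set \<Rightarrow> 'a \<Rightarrow> 'a set \<Rightarrow> 'a set"
  where "conj_on_sets G C g = (\<lambda>A\<in>C. g <#\<^bsub>G\<^esub> A #>\<^bsub>G\<^esub> (inv\<^bsub>G\<^esub> g))"

text \<open>
  The wreath product of \<open>H\<close> by the full symmetric group on \<open>\<Delta>\<close>: the semidirect product in which
  \<open>\<sigma>\<close> moves the \<open>i\<close>-th coordinate of an element of the base group to position \<open>\<sigma> i\<close>. The pair
  \<open>(h, \<sigma>)\<close> stands for the permutation that applies \<open>\<sigma>\<close> first and then \<open>h\<close>.
\<close>

definition wreath_Sym ::
    "('b, 'c) monoid_scheme \<Rightarrow> 'i set \<Rightarrow> (('i \<Rightarrow> 'b) \<times> ('i \<Rightarrow> 'i)) monoid"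
  where "wreath_Sym H \<Delta> =
    \<lparr>carrier = carrier (product_group \<Delta> (\<lambda>_. H)) \<times> carrier (BijGroup \<Delta>),
     monoid.mult = (\<lambda>(h, \<sigma>) (k, \<tau>).
       (h \<otimes>\<^bsub>product_group \<Delta> (\<lambda>_. H)\<^esub> (\<lambda>i\<in>\<Delta>. k ((inv\<^bsub>BijGroup \<Delta>\<^esub> \<sigma>) i)),
        \<sigma> \<otimes>\<^bsub>BijGroup \<Delta>\<^esub> \<tau>)),
     one = (\<one>\<^bsub>product_group \<Delta> (\<lambda>_. H)\<^esub>, \<one>\<^bsub>BijGroup \<Delta>\<^esub>)\<rparr>"

definition product_action ::
    "'b set \<Rightarrow> 'i set \<Rightarrow> ('i \<Rightarrow> 'b \<Rightarrow> 'b) \<times> ('i \<Rightarrow> 'i) \<Rightarrow> ('i \<Rightarrow> 'b) \<Rightarrow> 'i \<Rightarrow> 'b"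
  where "product_action \<Gamma> \<Delta> = (\<lambda>(h, \<sigma>). \<lambda>\<delta> \<in> \<Delta> \<rightarrow>\<^sub>E \<Gamma>. \<lambda>i\<in>\<Delta>.
    h i (\<delta> ((inv\<^bsub>BijGroup \<Delta>\<^esub> \<sigma>) i)))"

definition type_1 :: "'a set \<Rightarrow> ('a \<Rightarrow> 'a) set \<Rightarrow> ('a \<Rightarrow> 'a) set \<Rightarrow> bool"
  where "type_1 \<Omega> G M \<longleftrightarrow>
    simple_grp (perm_grp \<Omega> M) \<and> regular_on \<Omega> M \<and>
    (\<exists>\<beta>\<in>\<Omega>. M \<lhd> perm_grp \<Omega> G \<and>
       G = M <#>\<^bsub>perm_grp \<Omega> G\<^esub> point_stabilizer \<Omega> G \<beta> \<and>
       M \<inter> point_stabilizer \<Omega> G \<beta> = {\<one>\<^bsub>BijGroup \<Omega>\<^esub>} \<and>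
       (\<forall>g \<in> point_stabilizer \<Omega> G \<beta> - {\<one>\<^bsub>BijGroup \<Omega>\<^esub>}. \<forall>x\<in>M.
          conj_on (perm_grp \<Omega> G) M g \<noteq> conj_on (perm_grp \<Omega> G) M x))"

text \<open>
  In the next definition \<open>M \<le> G \<le> Aut(M)\<close> is faithfulness of the conjugation action of \<open>G\<close> on \<open>M\<close>;
  the image of \<open>M\<close> is then by construction the group of inner automorphisms.
\<close>

definition type_2 :: "'a set \<Rightarrow> ('a \<Rightarrow> 'a) set \<Rightarrow> ('a \<Rightarrow> 'a) set \<Rightarrow> bool"
  where "type_2 \<Omega> G M \<longleftrightarrow>
    simple_grp (perm_grp \<Omega> M) \<and> \<not> regular_on \<Omega> M \<and>
    finite (rcosets\<^bsub>perm_grp \<Omega> G\<^esub> M) \<and>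
    faithful_action (perm_grp \<Omega> G) M (conj_on (perm_grp \<Omega> G) M)"

text \<open>
  Any \<open>\<Gamma>\<close> as below embeds in \<open>\<Gamma>\<^sup>m\<close>, hence in \<open>\<Omega>\<close>, so taking \<open>\<Gamma>\<close> in the type of \<open>\<Omega>\<close> is no
  restriction up to permutation isomorphism.
\<close>

definition type_3 ::
    "'a set \<Rightarrow> ('a \<Rightarrow> 'a) set \<Rightarrow> ('a \<Rightarrow> 'a) set \<Rightarrow> ('a \<Rightarrow> 'a) monoid \<Rightarrow> nat \<Rightarrow> bool"
  where "type_3 \<Omega> G M K m \<longleftrightarrow>
    \<not> simple_grp (perm_grp \<Omega> M) \<and> m > 1 \<and>
    (\<exists>(\<Gamma>::'a set) H.
       infinite \<Gamma> \<and> subgroup H (BijGroup \<Gamma>) \<and> infinite H \<and> primitive_on \<Gamma> H \<and>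
       (\<exists>\<gamma>\<in>\<Gamma>. finite (point_stabilizer \<Gamma> H \<gamma>)) \<and>
       (\<exists>W. subgroup W (wreath_Sym (perm_grp \<Gamma> H) {1..m}) \<and>
            permutation_isomorphic \<Omega> G ({1..m} \<rightarrow>\<^sub>E \<Gamma>) (product_action \<Gamma> {1..m} ` W)) \<and>
       (\<exists>N. unique_minimal_normal N (perm_grp \<Gamma> H) \<and> perm_grp \<Gamma> N \<cong> K \<and>
            (regular_on \<Omega> M \<longrightarrow> type_1 \<Gamma> H N) \<and>
            (\<not> regular_on \<Omega> M \<longrightarrow> type_2 \<Gamma> H N)))"

end

theory Submission
  imports Defs
begin

text \<open>
  Let \<open>A\<close> be the stabilizer of \<open>\<alpha>\<close>. Primitivity says that \<open>A\<close> is a maximal, core-free subgroup of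
  \<open>G\<close>, and it is finite. So every non-trivial normal subgroup \<open>N\<close> satisfies \<open>N A = G\<close> and has index at
  most \<open>card A\<close>; as \<open>G\<close> is infinite, two of them never intersect trivially, and there is a
  smallest one, \<open>M\<close>. It is finitely generated, no proper normal
  subgroup of \<open>M\<close> has finite index in \<open>M\<close>, and therefore \<open>M\<close> is non-abelian with trivial
  centralizer in \<open>G\<close>. A non-trivial normal subgroup \<open>L\<close> of \<open>M\<close> having as many \<open>A\<close>-conjugates with
  trivial intersection with \<open>L\<close> as possible is minimal normal in \<open>M\<close>, and \<open>M\<close> is the direct product
  of the distinct \<open>A\<close>-conjugates of \<open>L\<close>, which are simple.

  For the product action let \<open>Z\<close> be the product of the conjugates of \<open>L\<close> other than \<open>L\<close>. Maximality
  of \<open>A\<close> forces the projection of \<open>A \<inter> M\<close> to \<open>L\<close> to lie in \<open>A\<close>, and so the \<open>L\<close>-orbit \<open>\<Gamma>\<close> of \<open>\<alpha>\<close>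
  meets every \<open>Z\<close>-orbit in exactly one point. The normalizer of \<open>L\<close> permutes the \<open>Z\<close>-orbits and
  thereby acts on \<open>\<Gamma>\<close>; \<open>H\<close> is the resulting permutation group. If \<open>t\<^sub>i \<in> A\<close> conjugates \<open>L\<close> to the
  \<open>i\<close>-th component, the map sending \<open>\<omega>\<close> to the family of the representatives of the \<open>Z\<close>-orbits of
  \<open>t\<^sub>i\<^sup>-\<^sup>1 \<omega>\<close> is an equivariant surjection \<open>\<Omega> \<rightarrow> \<Gamma>\<^sup>m\<close>. Pulling invariant equivalence relations back
  along it, primitivity of \<open>G\<close> yields both its injectivity and the primitivity of \<open>H\<close>.
\<close>

section \<open>Conjugation in a group\<close>

context group
begin

lemma mult_inv_cancel: "\<lbrakk>x \<in> carrier G; y \<in> carrier G\<rbrakk> \<Longrightarrow> x \<otimes> (inv x \<otimes> y) = y"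
  by (simp flip: m_assoc)

lemma inv_mult_cancel: "\<lbrakk>x \<in> carrier G; y \<in> carrier G\<rbrakk> \<Longrightarrow> inv x \<otimes> (x \<otimes> y) = y"
  by (simp flip: m_assoc)

lemmas word_simps = m_assoc inv_mult_group mult_inv_cancel inv_mult_cancel

definition conjugate :: "'a \<Rightarrow> 'a \<Rightarrow> 'a"
  where "conjugate g x = g \<otimes> x \<otimes> inv g"

lemma conjugate_closed [simp, intro]:
  "\<lbrakk>g \<in> carrier G; x \<in> carrier G\<rbrakk> \<Longrightarrow> conjugate g x \<in> carrier G"
  by (simp add: conjugate_def)

lemma conjugate_mult:
  "\<lbrakk>g \<in> carrier G; x \<in> carrier G; y \<in> carrier G\<rbrakk>
    \<Longrightarrow> conjugate g (x \<otimes> y) = conjugate g x \<otimes> conjugate g y"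
  by (simp add: conjugate_def word_simps)

lemma conjugate_inv:
  "\<lbrakk>g \<in> carrier G; x \<in> carrier G\<rbrakk> \<Longrightarrow> conjugate g (inv x) = inv (conjugate g x)"
  by (simp add: conjugate_def word_simps)

lemma conjugate_one [simp]: "g \<in> carrier G \<Longrightarrow> conjugate g \<one> = \<one>"
  by (simp add: conjugate_def)

lemma one_conjugate [simp]: "x \<in> carrier G \<Longrightarrow> conjugate \<one> x = x"
  by (simp add: conjugate_def)

lemma conjugate_conjugate:
  "\<lbrakk>g \<in> carrier G; h \<in> carrier G; x \<in> carrier G\<rbrakk>
    \<Longrightarrow> conjugate g (conjugate h x) = conjugate (g \<otimes> h) x"
  by (simp add: conjugate_def word_simps)

lemma conjugate_inv_cancel [simp]:
  "\<lbrakk>g \<in> carrier G; x \<in> carrier G\<rbrakk> \<Longrightarrow> conjugate (inv g) (conjugate g x) = x"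
  "\<lbrakk>g \<in> carrier G; x \<in> carrier G\<rbrakk> \<Longrightarrow> conjugate g (conjugate (inv g) x) = x"
  by (simp_all add: conjugate_conjugate)

lemma conjugate_eq_iff:
  "\<lbrakk>g \<in> carrier G; x \<in> carrier G; y \<in> carrier G\<rbrakk> \<Longrightarrow> conjugate g x = conjugate g y \<longleftrightarrow> x = y"
  using conjugate_inv_cancel(1)[of g x] conjugate_inv_cancel(1)[of g y] by metis

lemma conjugate_commute:
  "\<lbrakk>g \<in> carrier G; x \<in> carrier G; g \<otimes> x = x \<otimes> g\<rbrakk> \<Longrightarrow> conjugate g x = x"
  by (simp add: conjugate_def word_simps)

lemma conjugate_eq_self_iff:
  "\<lbrakk>g \<in> carrier G; x \<in> carrier G\<rbrakk> \<Longrightarrow> conjugate g x = x \<longleftrightarrow> g \<otimes> x = x \<otimes> g"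
  by (simp add: conjugate_def inv_solve_right')

lemma inj_on_conjugate: "\<lbrakk>g \<in> carrier G; H \<subseteq> carrier G\<rbrakk> \<Longrightarrow> inj_on (conjugate g) H"
  by (rule inj_onI) (meson conjugate_eq_iff subsetD)

lemma conjugate_image_image:
  assumes "g \<in> carrier G" "h \<in> carrier G" "H \<subseteq> carrier G"
  shows "conjugate g ` conjugate h ` H = conjugate (g \<otimes> h) ` H"
  unfolding image_image using assms by (intro image_cong) (auto simp: conjugate_conjugate)

lemma one_conjugate_image:
  assumes "H \<subseteq> carrier G"
  shows "conjugate \<one> ` H = H"
proof -
  have "conjugate \<one> ` H = (\<lambda>x. x) ` H"
    using assms by (intro image_cong) auto
  then show ?thesis by simp
qed

lemma conjugate_image_cancel:
  assumes "g \<in> carrier G" "H \<subseteq> carrier G"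
  shows "conjugate (inv g) ` conjugate g ` H = H" "conjugate g ` conjugate (inv g) ` H = H"
  using assms by (simp_all add: conjugate_image_image one_conjugate_image)

lemma mem_conjugate_image_iff:
  assumes "g \<in> carrier G" "H \<subseteq> carrier G" "x \<in> carrier G"
  shows "x \<in> conjugate g ` H \<longleftrightarrow> conjugate (inv g) x \<in> H"
proof
  assume "x \<in> conjugate g ` H"
  then show "conjugate (inv g) x \<in> H" using assms by auto
next
  assume "conjugate (inv g) x \<in> H"
  then have "conjugate g (conjugate (inv g) x) \<in> conjugate g ` H" by (rule imageI)
  then show "x \<in> conjugate g ` H" using assms by simp
qed

lemma conjugate_image_eq_coset:
  assumes "H \<subseteq> carrier G"
  shows "g <# H #> inv g = conjugate g ` H"
  unfolding l_coset_def r_coset_def conjugate_def by auto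

lemma subgroup_conjugate_image:
  assumes "subgroup H G" "g \<in> carrier G"
  shows "subgroup (conjugate g ` H) G"
proof -
  interpret H: subgroup H G by fact
  show ?thesis
  proof (rule subgroupI)
    show "conjugate g ` H \<subseteq> carrier G"
      using assms by auto
    show "conjugate g ` H \<noteq> {}"
      using H.one_closed by blast
    show "inv a \<in> conjugate g ` H" if "a \<in> conjugate g ` H" for a
      using that assms by (auto simp flip: conjugate_inv)
    show "a \<otimes> b \<in> conjugate g ` H" if "a \<in> conjugate g ` H" "b \<in> conjugate g ` H" for a b
      using that assms by (auto simp flip: conjugate_mult)
  qed
qed

lemma conjugate_generate:
  assumes "g \<in> carrier G" "S \<subseteq> carrier G" "x \<in> generate G S"
  shows "conjugate g x \<in> generate G (conjugate g ` S)"
  using assms(3)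
proof induction
  case one
  then show ?case using assms by (simp add: generate.one)
next
  case (incl h)
  then show ?case by (simp add: generate.incl)
next
  case (inv h)
  then have "conjugate g (inv h) = inv (conjugate g h)"
    using assms by (intro conjugate_inv) auto
  then show ?case using inv by (simp add: generate.inv)
next
  case (eng h1 h2)
  then show ?case
    using assms generate_in_carrier[OF assms(2)] by (simp add: conjugate_mult generate.eng)
qed

text \<open>Subgroups and inverses formed in \<open>M\<close> agree with those of \<open>G\<close>.
  Normality in the restricted group can therefore be handled inside \<open>G\<close>, through
  conjugation by elements of \<open>M\<close>.\<close>

lemma normal_restrict_iff:
  assumes "subgroup M G"
  shows "N \<lhd> G\<lparr>carrier := M\<rparr> \<longleftrightarrow>
    subgroup N G \<and> N \<subseteq> M \<and> (\<forall>x\<in>M. \<forall>n\<in>N. conjugate x n \<in> N)"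
proof -
  interpret M: group "G\<lparr>carrier := M\<rparr>" by (rule subgroup_imp_group) fact
  have "subgroup N (G\<lparr>carrier := M\<rparr>) \<longleftrightarrow> subgroup N G \<and> N \<subseteq> M"
    using assms incl_subgroup[of M N] subgroup_incl[of N M] subgroup.subset[of N "G\<lparr>carrier := M\<rparr>"]
    by auto
  moreover have "inv\<^bsub>G\<lparr>carrier := M\<rparr>\<^esub> x = inv x" if "x \<in> M" for x
    using that assms by (simp add: m_inv_consistent)
  ultimately show ?thesis
    by (auto simp: M.normal_inv_iff conjugate_def)
qed

lemma normal_iff_conjugate:
  "N \<lhd> G \<longleftrightarrow> subgroup N G \<and> (\<forall>x\<in>carrier G. \<forall>n\<in>N. conjugate x n \<in> N)"
  by (auto simp: normal_inv_iff conjugate_def)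

lemma generate_commute:
  assumes "x \<in> carrier G" "S \<subseteq> carrier G" "\<And>s. s \<in> S \<Longrightarrow> x \<otimes> s = s \<otimes> x" "y \<in> generate G S"
  shows "x \<otimes> y = y \<otimes> x"
  using assms(4)
proof induction
  case one
  then show ?case using assms by simp
next
  case (incl h)
  then show ?case using assms by simp
next
  case (inv h)
  then have h: "h \<in> carrier G" "x \<otimes> h = h \<otimes> x" using assms by auto
  have "inv h \<otimes> x = inv h \<otimes> (x \<otimes> h) \<otimes> inv h"
    using assms h(1) by (simp add: word_simps)
  also have "\<dots> = x \<otimes> inv h"
    unfolding h(2) using assms h(1) by (simp add: word_simps)
  finally show ?case by simp
next
  case (eng h1 h2)
  then have "h1 \<in> carrier G" "h2 \<in> carrier G"
    using generate_in_carrier[OF assms(2)] by auto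
  then show ?case
    using assms(1) eng.IH m_assoc[of x h1 h2] m_assoc[of h1 x h2] m_assoc[of h1 h2 x] by simp
qed

end

section \<open>Finite maximal core-free subgroups\<close>

context group
begin

text \<open>If two elements \<open>x\<close>, \<open>y\<close> of \<open>H\<close> have the same
  representative in \<open>B\<close>, then \<open>x \<otimes> inv y\<close> lies in
  \<open>H \<inter> N\<close>. So choosing representatives is injective, and \<open>H\<close> is no
  larger than \<open>B\<close>.\<close>

lemma finite_if_finite_cosets:
  assumes "subgroup H G" "subgroup N G" "finite B" "B \<subseteq> carrier G"
    and "\<And>h. h \<in> H \<Longrightarrow> \<exists>n\<in>N. \<exists>b\<in>B. h = n \<otimes> b" and "H \<inter> N = {\<one>}"
  shows "finite H"
proof -
  interpret H: subgroup H G by fact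
  interpret N: subgroup N G by fact
  obtain n b where nb: "\<And>h. h \<in> H \<Longrightarrow> n h \<in> N \<and> b h \<in> B \<and> h = n h \<otimes> b h"
    using assms(5) by metis
  have "inj_on b H"
  proof (rule inj_onI)
    fix x y assume xy: "x \<in> H" "y \<in> H" "b x = b y"
    have c: "n x \<in> carrier G" "n y \<in> carrier G" "b y \<in> carrier G"
      using nb[OF xy(1)] nb[OF xy(2)] assms(4) by auto
    have "x \<otimes> inv y = (n x \<otimes> b y) \<otimes> inv (n y \<otimes> b y)"
      using nb[OF xy(1)] nb[OF xy(2)] xy(3) by simp
    also have "\<dots> = n x \<otimes> inv (n y)"
      using c by (simp add: word_simps)
    finally have "x \<otimes> inv y \<in> N"
      using nb[OF xy(1)] nb[OF xy(2)] by simp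
    then have "x \<otimes> inv y \<in> H \<inter> N"
      using xy by simp
    then show "x = y"
      using assms(6) xy by (simp add: inv_solve_right')
  qed
  moreover have "b ` H \<subseteq> B" using nb by auto
  ultimately show ?thesis
    using assms(3) finite_imageD finite_subset by blast
qed

lemma subgroup_set_mult:
  assumes "subgroup H G" "subgroup B G" "\<And>b h. \<lbrakk>b \<in> B; h \<in> H\<rbrakk> \<Longrightarrow> conjugate b h \<in> H"
  shows "subgroup (H <#> B) G"
proof -
  interpret H: subgroup H G by fact
  interpret B: subgroup B G by fact
  have prod: "h \<otimes> b \<in> H <#> B" if "h \<in> H" "b \<in> B" for h b
    using that by (auto simp: set_mult_def)
  show ?thesis
  proof (rule subgroupI)
    show "H <#> B \<subseteq> carrier G"
      by (auto simp: set_mult_def)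
    show "H <#> B \<noteq> {}"
      using prod[OF H.one_closed B.one_closed] by blast
  next
    fix x assume "x \<in> H <#> B"
    then obtain h b where x: "h \<in> H" "b \<in> B" "x = h \<otimes> b"
      by (auto simp: set_mult_def)
    then have "inv x = conjugate (inv b) (inv h) \<otimes> inv b"
      by (simp add: conjugate_def word_simps)
    then show "inv x \<in> H <#> B"
      using x assms(3) by (simp add: prod)
  next
    fix x y assume "x \<in> H <#> B" "y \<in> H <#> B"
    then obtain h b k c where *: "h \<in> H" "b \<in> B" "x = h \<otimes> b" "k \<in> H" "c \<in> B" "y = k \<otimes> c"
      by (auto simp: set_mult_def)
    then have "x \<otimes> y = (h \<otimes> conjugate b k) \<otimes> (b \<otimes> c)"
      by (simp add: conjugate_def word_simps)
    then show "x \<otimes> y \<in> H <#> B"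
      using * assms(3) by (simp add: prod)
  qed
qed

end

text \<open>For a permutation group \<open>A\<close> will be a point stabilizer: maximality then
  comes from primitivity, and core-freeness from transitivity together with faithfulness. The
  abstract setting is applied to \<open>G\<close> and later to \<open>H\<close>.\<close>

locale finite_maximal_subgroup = group +
  fixes A
  assumes A_subgroup: "subgroup A G"
    and A_finite: "finite A"
    and infinite_carrier: "infinite (carrier G)"
    and A_maximal: "\<And>H. \<lbrakk>subgroup H G; A \<subseteq> H\<rbrakk> \<Longrightarrow> H = A \<or> H = carrier G"
    and A_core_free: "\<And>N. \<lbrakk>N \<lhd> G; N \<subseteq> A\<rbrakk> \<Longrightarrow> N = {\<one>}"
begin

lemma A_carrier [simp]: "a \<in> A \<Longrightarrow> a \<in> carrier G"
  using A_subgroup subgroup.mem_carrier by metis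

lemma one_A [simp]: "\<one> \<in> A" and inv_A [simp]: "a \<in> A \<Longrightarrow> inv a \<in> A"
  and mult_A [simp]: "\<lbrakk>a \<in> A; b \<in> A\<rbrakk> \<Longrightarrow> a \<otimes> b \<in> A"
  using A_subgroup by (simp_all add: subgroup.one_closed subgroup.m_inv_closed subgroup.m_closed)

text \<open>As \<open>A\<close> normalizes \<open>H\<close>, the product \<open>H <#> A\<close> is a
  subgroup; it contains \<open>A\<close> properly, so maximality makes it all of \<open>G\<close>.
  The form for \<open>A\<close>-invariant subgroups is chosen because it is also applied to a
  generated subgroup of \<open>M\<close> and to a product of projections.\<close>

lemma invariant_times_A:
  assumes "subgroup H G" "\<And>a h. \<lbrakk>a \<in> A; h \<in> H\<rbrakk> \<Longrightarrow> conjugate a h \<in> H" "\<not> H \<subseteq> A" "g \<in> carrier G"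
  shows "\<exists>h\<in>H. \<exists>a\<in>A. g = h \<otimes> a"
proof -
  have sub: "subgroup (H <#> A) G"
    using assms(1) A_subgroup assms(2) by (rule subgroup_set_mult)
  have prod: "h \<otimes> a \<in> H <#> A" if "h \<in> H" "a \<in> A" for h a
    using that by (auto simp: set_mult_def)
  have "A \<subseteq> H <#> A" "H \<subseteq> H <#> A"
    using prod[of \<one>] prod[of _ \<one>] subgroup.one_closed[OF assms(1)]
      subgroup.mem_carrier[OF assms(1)] by auto
  then have "H <#> A = carrier G"
    using A_maximal[OF sub] assms(3) by blast
  with assms(4) have "g \<in> H <#> A" by simp
  then show ?thesis
    by (auto simp: set_mult_def)
qed

lemma normal_times_A:
  assumes "N \<lhd> G" "N \<noteq> {\<one>}" "g \<in> carrier G"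
  shows "\<exists>n\<in>N. \<exists>a\<in>A. g = n \<otimes> a"
  using assms A_core_free[of N] by (intro invariant_times_A) (auto simp: normal_iff_conjugate)

text \<open>The finite group \<open>A\<close> contains representatives of all cosets of
  \<open>N\<close>, so a subgroup meeting \<open>N\<close> trivially would be finite.\<close>

lemma subgroup_meets_normal:
  assumes "subgroup H G" "N \<lhd> G" "N \<noteq> {\<one>}" "infinite H"
  shows "H \<inter> N \<noteq> {\<one>}"
proof
  assume "H \<inter> N = {\<one>}"
  then have "finite H"
    using finite_if_finite_cosets[OF assms(1) normal_imp_subgroup[OF assms(2)] A_finite _
        normal_times_A[OF assms(2,3) subgroup.mem_carrier[OF assms(1)]]] A_subgroup[THEN subgroup.subset]
    by blast
  with assms(4) show False by simp
qed

lemma normal_infinite: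
  assumes "N \<lhd> G" "N \<noteq> {\<one>}"
  shows "infinite N"
proof
  assume "finite N"
  then have "finite ((\<lambda>(n, a). n \<otimes> a) ` (N \<times> A))"
    using A_finite by simp
  moreover have "carrier G \<subseteq> (\<lambda>(n, a). n \<otimes> a) ` (N \<times> A)"
  proof
    fix g assume "g \<in> carrier G"
    then obtain n a where "n \<in> N" "a \<in> A" "g = n \<otimes> a"
      using normal_times_A[OF assms] by blast
    then show "g \<in> (\<lambda>(n, a). n \<otimes> a) ` (N \<times> A)"
      by (intro image_eqI[of _ _ "(n, a)"]) auto
  qed
  ultimately have "finite (carrier G)"
    by (rule rev_finite_subset)
  with infinite_carrier show False by simp
qed

text \<open>If \<open>x = n \<otimes> a\<close> lies in \<open>N'\<close>, then \<open>a\<close>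
  lies in \<open>A \<inter> N'\<close> and hence in \<open>N\<close>. Nested non-trivial normal
  subgroups are thus told apart by their traces on the finite group \<open>A\<close>.\<close>

lemma normal_eq_if_same_trace:
  assumes "N \<lhd> G" "N \<noteq> {\<one>}" "N' \<lhd> G" "N \<subseteq> N'" "A \<inter> N' \<subseteq> N"
  shows "N = N'"
proof -
  interpret N: normal N G by fact
  interpret N': normal N' G by fact
  have "x \<in> N" if x: "x \<in> N'" for x
  proof -
    obtain n a where na: "n \<in> N" "a \<in> A" "x = n \<otimes> a"
      using normal_times_A[OF assms(1,2) N'.mem_carrier[OF x]] by blast
    from na have a: "a = inv n \<otimes> x" by (simp add: word_simps)
    have "inv n \<otimes> x \<in> N'"
      using x subsetD[OF assms(4) na(1)] by simp
    then have "a \<in> A \<inter> N'"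
      using na(2) by (simp flip: a)
    then have "a \<in> N" using assms(5) by blast
    then show ?thesis using na by simp
  qed
  then show ?thesis using assms(4) by blast
qed

lemma carrier_not_trivial: "carrier G \<noteq> {\<one>}"
  using infinite_carrier by (metis finite.emptyI finite.insertI)

text \<open>A non-trivial normal subgroup with the smallest trace on \<open>A\<close> is minimal,
  since every non-trivial normal subgroup inside it has the same trace. It is infinite, so it meets
  any other minimal normal subgroup non-trivially, and minimality of both identifies them with the
  intersection.\<close>

lemma ex_unique_minimal_normal: "\<exists>M. unique_minimal_normal M G"
proof -
  define P where "P N \<longleftrightarrow> N \<lhd> G \<and> N \<noteq> {\<one>}" for N
  have "P (carrier G)"
    unfolding P_def using normal_self carrier_not_trivial by blast
  then obtain M where M: "P M" and least: "\<And>N. P N \<Longrightarrow> card (A \<inter> M) \<le> card (A \<inter> N)"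
    using ex_has_least_nat[of P _ "\<lambda>N. card (A \<inter> N)"] by blast
  have min: "M = N" if "P N" "N \<subseteq> M" for N
  proof -
    have "A \<inter> N = A \<inter> M"
      using that least[OF that(1)] A_finite by (intro card_seteq) auto
    then show ?thesis
      using normal_eq_if_same_trace[of N M] that M unfolding P_def by blast
  qed
  then have mM: "minimal_normal M G"
    using M unfolding minimal_normal_def P_def by blast
  have "N = M" if "minimal_normal N G" for N
  proof -
    have N: "N \<lhd> G" "N \<noteq> {\<one>}" "\<And>K. P K \<Longrightarrow> \<not> K \<subset> N"
      using that unfolding minimal_normal_def P_def by auto
    have "M \<inter> N \<noteq> {\<one>}"
      using subgroup_meets_normal[of M N] normal_infinite M N normal_imp_subgroup
      unfolding P_def by blast
    then have "P (M \<inter> N)"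
      using M N(1) unfolding P_def by (simp add: normal_subgroup_intersect)
    then show ?thesis using min[of "M \<inter> N"] N(3)[of "M \<inter> N"] by blast
  qed
  with mM show ?thesis unfolding unique_minimal_normal_def by blast
qed

text \<open>A non-trivial core-free \<open>A\<close> is not normal, so some conjugate of it is not
  contained in \<open>A\<close>. By maximality \<open>A\<close> and this conjugate generate
  \<open>G\<close>, and both are finite groups.\<close>

lemma finitely_generated_by_torsion:
  assumes "A \<noteq> {\<one>}"
  shows "generated_by_finitely_many_torsion G"
proof -
  have "\<not> A \<lhd> G" using assms A_core_free by blast
  then obtain g a where g: "g \<in> carrier G" "a \<in> A" "conjugate g a \<notin> A"
    using A_subgroup by (auto simp: normal_iff_conjugate)
  let ?S = "A \<union> conjugate g ` A"
  have S: "?S \<subseteq> carrier G" "finite ?S"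
    using g A_finite by auto
  have "generate G ?S = A \<or> generate G ?S = carrier G"
    using generate_is_subgroup[OF S(1)] by (intro A_maximal) (auto intro: generate.incl)
  moreover have "conjugate g a \<in> generate G ?S"
    using g by (intro generate.incl) auto
  ultimately have gen: "generate G ?S = carrier G"
    using g by auto
  have fin: "ord x \<noteq> 0" if "subgroup H G" "finite H" "x \<in> H" for H x
  proof -
    have "x \<in> carrier G" using that(1,3) by (rule subgroup.mem_carrier)
    moreover have "generate G {x} \<subseteq> H"
      using that by (intro generate_subgroup_incl) auto
    ultimately show ?thesis
      using that(2) finite_cyclic_subgroup_order[of x]
      by (simp add: carrier_subgroup_generated finite_subset)
  qed
  have "ord s \<noteq> 0" if "s \<in> ?S" for s
    using that fin[OF A_subgroup A_finite]
      fin[OF subgroup_conjugate_image[OF A_subgroup g(1)] finite_imageI[OF A_finite]] by auto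
  then show ?thesis
    unfolding generated_by_finitely_many_torsion_def using S gen by blast
qed

end

section \<open>The smallest non-trivial normal subgroup\<close>

locale unique_minimal_normal_subgroup = finite_maximal_subgroup +
  fixes M
  assumes M_unique: "unique_minimal_normal M G"
begin

lemma M_normal: "M \<lhd> G" and M_nontrivial: "M \<noteq> {\<one>}"
  using M_unique by (simp_all add: unique_minimal_normal_def minimal_normal_def)

lemma M_subgroup: "subgroup M G"
  using M_normal by (rule normal_imp_subgroup)

sublocale M: normal M G by (rule M_normal)

lemma M_conjugate: "\<lbrakk>g \<in> carrier G; x \<in> M\<rbrakk> \<Longrightarrow> conjugate g x \<in> M"
  using M_normal by (auto simp: normal_iff_conjugate)

lemma M_infinite: "infinite M"
  using M_normal M_nontrivial by (rule normal_infinite)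

lemma M_times_A: "g \<in> carrier G \<Longrightarrow> \<exists>m\<in>M. \<exists>a\<in>A. g = m \<otimes> a"
  using M_normal M_nontrivial by (rule normal_times_A)

lemma M_least:
  assumes "N \<lhd> G" "N \<noteq> {\<one>}"
  shows "M \<subseteq> N"
proof -
  have "M \<inter> N \<noteq> {\<one>}"
    using M_subgroup assms M_infinite by (rule subgroup_meets_normal)
  then show ?thesis
    using M_unique normal_subgroup_intersect[OF M_normal assms(1)]
    unfolding unique_minimal_normal_def minimal_normal_def by blast
qed

text \<open>The \<open>A\<close>-conjugates of one element of \<open>M\<close> outside
  \<open>A\<close>, together with \<open>A \<inter> M\<close>, generate an
  \<open>A\<close>-invariant subgroup not contained in \<open>A\<close>, whose product with
  \<open>A\<close> is therefore \<open>G\<close>. For an element of \<open>M\<close> the factor from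
  \<open>A\<close> lies in \<open>A \<inter> M\<close>, which is among the generators.\<close>

lemma M_finitely_generated:
  obtains S where "finite S" "S \<subseteq> M" "generate G S = M"
proof -
  obtain g where g: "g \<in> M" "g \<notin> A"
    using M_infinite A_finite by (meson finite_subset subsetI)
  let ?S = "(\<lambda>a. conjugate a g) ` A \<union> (A \<inter> M)"
  have S: "?S \<subseteq> M" "finite ?S" "?S \<subseteq> carrier G"
    using g A_finite M_conjugate M.subset by auto
  have sub: "subgroup (generate G ?S) G" "generate G ?S \<subseteq> M"
    using generate_is_subgroup[OF S(3)] generate_subgroup_incl[OF S(1) M_subgroup] by auto
  have Sinv: "conjugate a ` ?S \<subseteq> ?S" if "a \<in> A" for a
    using that g M_conjugate M.subset
    by (auto simp: conjugate_conjugate) (auto simp: conjugate_def)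
  have inv: "conjugate a h \<in> generate G ?S" if "a \<in> A" "h \<in> generate G ?S" for a h
    using conjugate_generate[OF _ S(3) that(2), of a] mono_generate[OF Sinv[OF that(1)]] that(1)
    by auto
  have "conjugate \<one> g \<in> ?S" by (intro UnI1 imageI) simp
  then have "g \<in> generate G ?S"
    using g by (intro generate.incl) simp
  then have "\<not> generate G ?S \<subseteq> A"
    using g by blast
  note times = invariant_times_A[OF sub(1) inv this]
  have "x \<in> generate G ?S" if x: "x \<in> M" for x
  proof -
    obtain h a where ha: "h \<in> generate G ?S" "a \<in> A" "x = h \<otimes> a"
      using times[OF _ _ M.mem_carrier[OF x]] by blast
    then have "h \<in> M" using sub(2) by blast
    then have a: "a = inv h \<otimes> x" using ha by (simp add: word_simps)
    have "inv h \<otimes> x \<in> M" using x \<open>h \<in> M\<close> by simp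
    then have "a \<in> ?S" using ha(2) by (simp flip: a)
    then show ?thesis using ha by (auto intro: generate.eng generate.incl)
  qed
  then show thesis
    using that[OF S(2,1)] sub(2) by blast
qed

text \<open>Finite index is expressed by a finite set \<open>F\<close> of coset representatives. The
  intersection \<open>Y\<close> of the \<open>A\<close>-conjugates of \<open>D\<close> is normal in
  \<open>G\<close>; if it were trivial, \<open>M\<close> would embed in the finite set of functions
  from \<open>A\<close> to \<open>F\<close>. So \<open>Y\<close> contains \<open>M\<close>.\<close>

lemma M_no_finite_index:
  assumes "D \<lhd> G\<lparr>carrier := M\<rparr>" "finite F" "F \<subseteq> carrier G"
    and "\<And>x. x \<in> M \<Longrightarrow> \<exists>y\<in>D. \<exists>f\<in>F. x = y \<otimes> f"
  shows "D = M"
proof -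
  have D: "subgroup D G" "D \<subseteq> M" "\<And>x y. \<lbrakk>x \<in> M; y \<in> D\<rbrakk> \<Longrightarrow> conjugate x y \<in> D"
    using assms(1) unfolding normal_restrict_iff[OF M_subgroup] by auto
  interpret D: subgroup D G by (rule D)
  define Y where "Y = {y \<in> carrier G. \<forall>a\<in>A. conjugate a y \<in> D}"
  have subY: "subgroup Y G"
    unfolding Y_def by (rule subgroupI) (auto simp: conjugate_mult conjugate_inv intro: exI[of _ \<one>])
  have Y: "Y \<lhd> G"
    unfolding normal_iff_conjugate
  proof (intro conjI ballI subY)
    fix g y assume g: "g \<in> carrier G" and y: "y \<in> Y"
    have "conjugate a (conjugate g y) \<in> D" if a: "a \<in> A" for a
    proof -
      \<comment> \<open>Since \<open>G = M A\<close>, conjugation by \<open>g\<close> moves the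
        condition at \<open>a\<close> to one at some \<open>b \<in> A\<close>, up to conjugation by
        an element of \<open>M\<close>, which preserves \<open>D\<close>.\<close>
      obtain m b where mb: "m \<in> M" "b \<in> A" "a \<otimes> g = m \<otimes> b"
        using M_times_A[OF m_closed[OF A_carrier[OF a] g]] by blast
      have "y \<in> carrier G" using y by (simp add: Y_def)
      then have "conjugate a (conjugate g y) = conjugate m (conjugate b y)"
        using a g mb by (simp add: conjugate_conjugate)
      then show ?thesis using D(3) mb y by (simp add: Y_def)
    qed
    then show "conjugate g y \<in> Y" using g y by (simp add: Y_def)
  qed
  have "Y \<noteq> {\<one>}"
  proof
    assume Y1: "Y = {\<one>}"
    \<comment> \<open>The value \<open>f x a\<close> will represent the coset of \<open>D\<close>
      that contains the \<open>a\<close>-conjugate of \<open>x\<close>. Two elements with the same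
      representatives for all \<open>a\<close> differ by an element of \<open>Y\<close>.\<close>
    have "\<exists>f. f \<in> F \<and> (\<exists>z\<in>D. conjugate a x = z \<otimes> f)" if "x \<in> M" "a \<in> A" for x a
      using assms(4)[OF M_conjugate[OF A_carrier[OF that(2)] that(1)]] by blast
    then obtain f where f: "\<And>x a. \<lbrakk>x \<in> M; a \<in> A\<rbrakk> \<Longrightarrow> f x a \<in> F"
      "\<And>x a. \<lbrakk>x \<in> M; a \<in> A\<rbrakk> \<Longrightarrow> \<exists>z\<in>D. conjugate a x = z \<otimes> f x a"
      by metis
    have "inj_on (\<lambda>x. restrict (f x) A) M"
    proof (rule inj_onI)
      fix x y assume xy: "x \<in> M" "y \<in> M" and eq: "restrict (f x) A = restrict (f y) A"
      have "conjugate a (x \<otimes> inv y) \<in> D" if a: "a \<in> A" for a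
      proof -
        have fe: "f x a = f y a" using fun_cong[OF eq, of a] a by simp
        obtain z z' where z: "z \<in> D" "z' \<in> D" "conjugate a x = z \<otimes> f x a" "conjugate a y = z' \<otimes> f x a"
          using f(2)[OF xy(1) a] f(2)[OF xy(2) a] fe by auto
        have "f x a \<in> carrier G" using f(1)[OF xy(1) a] assms(3) by blast
        then have "conjugate a (x \<otimes> inv y) = z \<otimes> inv z'"
          using z a xy by (simp add: conjugate_mult conjugate_inv word_simps)
        then show ?thesis using z by simp
      qed
      then have "x \<otimes> inv y \<in> Y" using xy by (simp add: Y_def)
      then show "x = y" using xy by (simp add: Y1 inv_solve_right')
    qed
    moreover have "(\<lambda>x. restrict (f x) A) ` M \<subseteq> A \<rightarrow>\<^sub>E F"
      using f(1) by auto
    moreover have "finite (A \<rightarrow>\<^sub>E F)"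
      using A_finite assms(2) by (rule finite_PiE)
    ultimately have "finite M"
      using finite_imageD finite_subset by metis
    then show False using M_infinite by simp
  qed
  then have "M \<subseteq> Y" by (rule M_least[OF Y])
  have "x \<in> D" if "x \<in> M" for x
  proof -
    have "conjugate \<one> x \<in> D" using that \<open>M \<subseteq> Y\<close> one_A unfolding Y_def by blast
    then show ?thesis using that by simp
  qed
  then show ?thesis using D(2) by blast
qed

text \<open>If \<open>M\<close> is abelian and \<open>H\<close> is generated by all but one member of a smallest generating set,
  then \<open>M / H\<close> is cyclic and non-trivial, so it has a proper subgroup of finite index.\<close>

lemma M_not_abelian:
  assumes comm: "\<And>x y. \<lbrakk>x \<in> M; y \<in> M\<rbrakk> \<Longrightarrow> x \<otimes> y = y \<otimes> x"
  shows False
proof -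
  define P where "P S \<longleftrightarrow> finite S \<and> S \<subseteq> M \<and> generate G S = M" for S
  obtain S0 where "P S0" using M_finitely_generated unfolding P_def by metis
  then obtain S where S: "P S" and least: "\<And>T. P T \<Longrightarrow> card S \<le> card T"
    using ex_has_least_nat[of P S0 card] by blast
  have "S \<noteq> {}"
    using S M_nontrivial generate_empty unfolding P_def by auto
  then obtain x where x: "x \<in> S" by blast
  then have xM: "x \<in> M" using S unfolding P_def by blast
  have sM: "S - {x} \<subseteq> M" using S unfolding P_def by blast
  define H where "H = generate G (S - {x})"
  have H: "subgroup H G" "H \<subseteq> M"
    unfolding H_def using generate_is_subgroup[of "S - {x}"] generate_subgroup_incl[OF sM M_subgroup]
      sM M.subset by auto
  interpret H: subgroup H G by (rule H)
  have "card (S - {x}) < card S"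
    using S x unfolding P_def by (intro psubset_card_mono) auto
  then have "H \<noteq> M"
    using least[of "S - {x}"] S sM unfolding P_def H_def by auto
  have subU: "subgroup (H <#> generate G {y}) G" "H <#> generate G {y} \<subseteq> M" if y: "y \<in> M" for y
  proof -
    have gy: "subgroup (generate G {y}) G" "generate G {y} \<subseteq> M"
      using y generate_is_subgroup[of "{y}"] generate_subgroup_incl[of "{y}" M] M_subgroup by auto
    have cj: "conjugate b h = h" if "b \<in> generate G {y}" "h \<in> H" for b h
    proof -
      have "b \<in> M" "h \<in> M" using that gy H by auto
      then show ?thesis using comm[of b h] by (intro conjugate_commute) auto
    qed
    then show "subgroup (H <#> generate G {y}) G"
      by (intro subgroup_set_mult[OF H(1) gy(1)]) simp
    show "H <#> generate G {y} \<subseteq> M"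
      using gy(2) H(2) by (auto simp: set_mult_def)
  qed
  have U: "\<exists>h\<in>H. \<exists>i::int. m = h \<otimes> y [^] i" if "m \<in> H <#> generate G {y}" "y \<in> M" for m y
    using that by (auto simp: set_mult_def generate_pow)
  have UI: "h \<otimes> y [^] i \<in> H <#> generate G {y}" if "h \<in> H" "y \<in> M" for h y and i :: int
    using that by (auto simp: set_mult_def generate_pow)
  have "S \<subseteq> H <#> generate G {x}"
  proof
    fix s assume s: "s \<in> S"
    show "s \<in> H <#> generate G {x}"
    proof (cases "s = x")
      case True
      then show ?thesis using UI[of \<one> x 1] xM by (simp add: int_pow_1)
    next
      case False
      then have "s \<in> H" using s unfolding H_def by (intro generate.incl) simp
      then show ?thesis using UI[of s x 0] xM by simp
    qed
  qed
  then have genx: "M \<subseteq> H <#> generate G {x}"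
    using S generate_subgroup_incl[OF _ subU(1)[OF xM]] unfolding P_def by blast
  \<comment> \<open>The powers of \<open>x\<close> with exponents from \<open>0\<close> to
    \<open>d - 1\<close> represent all cosets of this subgroup in \<open>M\<close>. It has finite
    index, so it cannot be proper.\<close>
  have full: "H <#> generate G {x [^] d} = M" if d: "d > 0" for d :: int
  proof (rule M_no_finite_index)
    have xd: "x [^] d \<in> M" using xM M_subgroup by (simp add: subgroup_int_pow_closed)
    have "conjugate m n = n" if "m \<in> M" "n \<in> M" for m n
      using that comm[of m n] by (intro conjugate_commute) auto
    then show "H <#> generate G {x [^] d} \<lhd> G\<lparr>carrier := M\<rparr>"
      unfolding normal_restrict_iff[OF M_subgroup] using subU[OF xd] by (metis subsetD)
    show "finite ((\<lambda>i. x [^] i) ` {0..<d})" by simp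
    show "(\<lambda>i. x [^] i) ` {0..<d} \<subseteq> carrier G" using xM by auto
    fix m assume "m \<in> M"
    then have "m \<in> H <#> generate G {x}" using genx by blast
    then obtain h and k :: int where h: "h \<in> H" "m = h \<otimes> x [^] k"
      using U xM by blast
    have "x [^] k = (x [^] d) [^] (k div d) \<otimes> x [^] (k mod d)"
      using xM by (simp add: int_pow_pow flip: int_pow_mult)
    then have "m = (h \<otimes> (x [^] d) [^] (k div d)) \<otimes> x [^] (k mod d)"
      using h xM by (simp add: m_assoc)
    moreover have "k mod d \<in> {0..<d}" using d by simp
    ultimately show "\<exists>y\<in>H <#> generate G {x [^] d}. \<exists>f\<in>(\<lambda>i. x [^] i) ` {0..<d}. m = y \<otimes> f"
      using UI[OF h(1) xd] by blast
  qed
  \<comment> \<open>Taking \<open>d = 2\<close> writes \<open>x\<close> as an element of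
    \<open>H\<close> times an even power of \<open>x\<close>. Cancelling leaves an odd, hence
    non-zero, exponent \<open>1 - 2 * j\<close> whose power of \<open>x\<close> lies in
    \<open>H\<close>.\<close>
  have "x \<in> H <#> generate G {x [^] (2::int)}" using full[of 2] xM by simp
  then obtain h and j :: int where h: "h \<in> H" "x = h \<otimes> (x [^] (2::int)) [^] j"
    using U M_subgroup subgroup_int_pow_closed xM by blast
  have "x \<otimes> inv (x [^] (2 * j)) = h \<otimes> x [^] (2 * j) \<otimes> inv (x [^] (2 * j))"
    using h xM by (simp add: int_pow_pow)
  then have "h = x [^] (1 - 2 * j)"
    using h xM by (simp add: int_pow_diff m_assoc int_pow_1)
  then have "x [^] (1 - 2 * j) \<in> H" using h by simp
  define d where "d = \<bar>1 - 2 * j\<bar>"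
  have "d > 0" unfolding d_def by presburger
  have "x [^] d \<in> H"
  proof (cases "1 - 2 * j \<ge> 0")
    case False
    then have "x [^] d = inv (x [^] (1 - 2 * j))"
      using xM by (simp add: d_def flip: int_pow_neg)
    then show ?thesis using \<open>x [^] (1 - 2 * j) \<in> H\<close> by simp
  qed (use \<open>x [^] (1 - 2 * j) \<in> H\<close> in \<open>simp add: d_def\<close>)
  \<comment> \<open>For this \<open>d\<close> the product collapses to \<open>H\<close>, although it
    has to be all of \<open>M\<close>.\<close>
  then have "generate G {x [^] d} \<subseteq> H"
    using H(1) by (intro generate_subgroup_incl) auto
  then have "H <#> generate G {x [^] d} \<subseteq> H"
    by (auto simp: set_mult_def)
  then show False using full[OF \<open>d > 0\<close>] \<open>H \<noteq> M\<close> H(2) by blast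
qed

text \<open>The centralizer of \<open>M\<close> is normal in \<open>G\<close>. If it were
  non-trivial it would contain \<open>M\<close>, and \<open>M\<close> would be abelian.\<close>

lemma M_centralizer:
  assumes "g \<in> carrier G" "\<And>x. x \<in> M \<Longrightarrow> g \<otimes> x = x \<otimes> g"
  shows "g = \<one>"
proof (rule ccontr)
  assume "g \<noteq> \<one>"
  define C where "C = {g \<in> carrier G. \<forall>x\<in>M. conjugate g x = x}"
  have fix_inv: "conjugate (inv a) x = x" if "a \<in> carrier G" "x \<in> M" "conjugate a x = x" for a x
    using conjugate_inv_cancel(1)[of a x] that by simp
  have "subgroup C G"
    unfolding C_def by (rule subgroupI) (auto simp: fix_inv simp flip: conjugate_conjugate intro: exI[of _ \<one>])
  moreover have "conjugate h c \<in> C" if h: "h \<in> carrier G" and c: "c \<in> C" for h c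
  proof -
    have cc: "c \<in> carrier G" using c by (simp add: C_def)
    have "conjugate (conjugate h c) x = x" if x: "x \<in> M" for x
    proof -
      have "conjugate (inv h) x \<in> M" using h x by (simp add: M_conjugate)
      then have "conjugate c (conjugate (inv h) x) = conjugate (inv h) x"
        using c by (simp add: C_def)
      moreover have "conjugate (conjugate h c) x = conjugate h (conjugate c (conjugate (inv h) x))"
        using h cc x by (simp add: conjugate_def word_simps)
      ultimately show ?thesis using h x by simp
    qed
    then show ?thesis using h cc by (simp add: C_def)
  qed
  ultimately have "C \<lhd> G" by (simp add: normal_iff_conjugate)
  moreover have "C \<noteq> {\<one>}"
    using assms \<open>g \<noteq> \<one>\<close> unfolding C_def by (auto simp: conjugate_commute)
  ultimately have "M \<subseteq> C" by (rule M_least)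
  then have "x \<otimes> y = y \<otimes> x" if "x \<in> M" "y \<in> M" for x y
    using that conjugate_eq_self_iff[of x y] unfolding C_def by auto
  then show False by (rule M_not_abelian)
qed

end

section \<open>Normal subgroups of \<open>M\<close> and their conjugates\<close>

context unique_minimal_normal_subgroup
begin

lemma A_times_M:
  assumes "g \<in> carrier G"
  shows "\<exists>a\<in>A. \<exists>m\<in>M. g = a \<otimes> m"
proof -
  obtain m a where ma: "m \<in> M" "a \<in> A" "inv g = m \<otimes> a"
    using M_times_A[OF inv_closed[OF assms]] by blast
  then have "g = inv (m \<otimes> a)" using assms by (metis inv_inv)
  then have "g = inv a \<otimes> inv m" using ma by (simp add: inv_mult_group)
  moreover have "inv a \<in> A" "inv m \<in> M" using ma by simp_all
  ultimately show ?thesis by blast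
qed

lemma normal_in_M_iff:
  "N \<lhd> G\<lparr>carrier := M\<rparr> \<longleftrightarrow>
    subgroup N G \<and> N \<subseteq> M \<and> (\<forall>x\<in>M. \<forall>n\<in>N. conjugate x n \<in> N)"
  by (rule normal_restrict_iff) (rule M_subgroup)

lemma normal_in_M_commute:
  assumes "N \<lhd> G\<lparr>carrier := M\<rparr>" "N' \<lhd> G\<lparr>carrier := M\<rparr>" "N \<inter> N' \<subseteq> {\<one>}" "x \<in> N" "y \<in> N'"
  shows "x \<otimes> y = y \<otimes> x"
  using group.normal_imp_commuting[OF subgroup_imp_group[OF M_subgroup] assms(1,2) _ assms(4,5)] assms(3)
  by simp

lemma normal_in_M_conjugate_eq:
  assumes "N \<lhd> G\<lparr>carrier := M\<rparr>" "m \<in> M"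
  shows "conjugate m ` N = N"
proof
  have N: "N \<subseteq> carrier G" "\<And>x n. \<lbrakk>x \<in> M; n \<in> N\<rbrakk> \<Longrightarrow> conjugate x n \<in> N"
    using assms(1) M.subset unfolding normal_in_M_iff by auto
  show "conjugate m ` N \<subseteq> N" using N(2) assms(2) by auto
  have "conjugate (inv m) ` N \<subseteq> N" using N(2) assms(2) by auto
  then have "conjugate m ` conjugate (inv m) ` N \<subseteq> conjugate m ` N" by (rule image_mono)
  then show "N \<subseteq> conjugate m ` N"
    using N(1) assms(2) by (simp add: conjugate_image_cancel)
qed

lemma conjugate_image_normal_in_M:
  assumes "N \<lhd> G\<lparr>carrier := M\<rparr>" "g \<in> carrier G"
  shows "conjugate g ` N \<lhd> G\<lparr>carrier := M\<rparr>"
proof -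
  have N: "subgroup N G" "N \<subseteq> M" "\<And>x n. \<lbrakk>x \<in> M; n \<in> N\<rbrakk> \<Longrightarrow> conjugate x n \<in> N"
    using assms(1) unfolding normal_in_M_iff by auto
  have "conjugate x (conjugate g n) \<in> conjugate g ` N" if x: "x \<in> M" and n: "n \<in> N" for x n
  proof -
    have nc: "n \<in> carrier G" "x \<in> carrier G" using n x N(2) by auto
    have "conjugate (inv g) x \<in> M" using x assms(2) by (simp add: M_conjugate)
    then have "conjugate (conjugate (inv g) x) n \<in> N" using N(3) n by blast
    moreover have "conjugate x (conjugate g n) = conjugate g (conjugate (conjugate (inv g) x) n)"
      using nc assms(2) by (simp add: conjugate_def word_simps)
    ultimately show ?thesis by blast
  qed
  then show ?thesis
    using N assms(2) M_conjugate unfolding normal_in_M_iff by (auto intro: subgroup_conjugate_image)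
qed

lemma conjugate_image_trivial_iff:
  assumes "N \<subseteq> carrier G" "g \<in> carrier G"
  shows "conjugate g ` N = {\<one>} \<longleftrightarrow> N = {\<one>}"
  using conjugate_image_cancel(1)[OF assms(2,1)] assms(2) by auto

text \<open>Since \<open>G = A M\<close> and \<open>M\<close> normalizes \<open>N\<close>, the union
  of the \<open>A\<close>-conjugates of \<open>N\<close> is closed under conjugation by
  \<open>G\<close>. It generates a non-trivial normal subgroup of \<open>G\<close> inside
  \<open>M\<close>.\<close>

lemma M_generated_by_conjugates:
  assumes N: "N \<lhd> G\<lparr>carrier := M\<rparr>" "N \<noteq> {\<one>}"
  shows "generate G (\<Union>a\<in>A. conjugate a ` N) = M"
proof -
  let ?S = "\<Union>a\<in>A. conjugate a ` N"
  have N': "subgroup N G" "N \<subseteq> M" "\<And>x n. \<lbrakk>x \<in> M; n \<in> N\<rbrakk> \<Longrightarrow> conjugate x n \<in> N"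
    using N(1) unfolding normal_in_M_iff by auto
  have Nc: "n \<in> carrier G" if "n \<in> N" for n using N'(2) that by auto
  have SM: "?S \<subseteq> M"
    using N'(2) M_conjugate by auto
  then have Sc: "?S \<subseteq> carrier G" using M.subset by blast
  have "conjugate g s \<in> ?S" if s: "s \<in> ?S" and g: "g \<in> carrier G" for g s
  proof -
    obtain a n where an: "a \<in> A" "n \<in> N" "s = conjugate a n" using s by blast
    obtain b m where bm: "b \<in> A" "m \<in> M" "g \<otimes> a = b \<otimes> m"
      using A_times_M[OF m_closed[OF g A_carrier[OF an(1)]]] by blast
    have "conjugate g s = conjugate b (conjugate m n)"
      using an bm g Nc by (simp add: conjugate_conjugate)
    moreover have "conjugate m n \<in> N" using N'(3) bm an by blast
    ultimately show ?thesis using bm(1) by blast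
  qed
  then have "generate G ?S \<lhd> G"
    by (intro normal_generateI[OF Sc]) (simp add: conjugate_def)
  moreover have "N \<subseteq> generate G ?S"
  proof
    fix n assume "n \<in> N"
    then have "conjugate \<one> n \<in> ?S" using one_A by blast
    then show "n \<in> generate G ?S"
      using Nc[OF \<open>n \<in> N\<close>] by (intro generate.incl) simp
  qed
  then have "generate G ?S \<noteq> {\<one>}"
    using N(2) subgroup.one_closed[OF N'(1)] by blast
  ultimately have "M \<subseteq> generate G ?S" by (rule M_least)
  then show ?thesis
    using generate_subgroup_incl[OF SM M_subgroup] by blast
qed

text \<open>Minimality comes from an extremal choice: \<open>L\<close> maximizes the number of
  elements of \<open>A\<close> that send it to a conjugate meeting it trivially. For
  \<open>N\<close> inside \<open>L\<close>, the group \<open>M\<close> is generated by conjugates of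
  a part \<open>R B\<close> of \<open>N\<close>, some inside \<open>N\<close> and the others
  centralizing \<open>L\<close>. Each element of \<open>L\<close> is then an element of
  \<open>N\<close> times one that centralizes \<open>M\<close>.\<close>

lemma ex_minimal_normal_in_M:
  obtains L where "minimal_normal L (G\<lparr>carrier := M\<rparr>)"
proof -
  define P where "P N \<longleftrightarrow> N \<lhd> G\<lparr>carrier := M\<rparr> \<and> N \<noteq> {\<one>}" for N
  define D where "D N = {a \<in> A. N \<inter> conjugate a ` N = {\<one>}}" for N
  have "P M"
    unfolding P_def normal_in_M_iff using M_subgroup M_nontrivial by (simp add: M_conjugate)
  moreover have "card (D N) \<le> card A" for N
    using A_finite unfolding D_def by (intro card_mono) auto
  ultimately have "\<exists>L. P L \<and> (\<forall>N. P N \<longrightarrow> card (D N) \<le> card (D L))"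
    by (intro ex_has_greatest_nat[of P M _ "Suc (card A)"]) (auto simp: less_Suc_eq_le)
  then obtain L where L: "P L" and greatest: "\<And>N. P N \<Longrightarrow> card (D N) \<le> card (D L)"
    by blast
  have PD: "subgroup N G" "N \<subseteq> M" "N \<subseteq> carrier G" "\<And>x n. \<lbrakk>x \<in> M; n \<in> N\<rbrakk> \<Longrightarrow> conjugate x n \<in> N"
    if "P N" for N
    using that M.subset unfolding P_def normal_in_M_iff by auto
  have one: "\<one> \<in> conjugate a ` N" if "P N" "a \<in> A" for N a
    using subgroup.one_closed[OF subgroup_conjugate_image[OF PD(1)[OF that(1)] A_carrier[OF that(2)]]] .
  \<comment> \<open>Shrinking the subgroup can only enlarge \<open>D\<close>, and \<open>D L\<close>
    already has the largest size.\<close>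
  have DN: "D N = D L" if N: "P N" "N \<subseteq> L" for N
  proof -
    have "D L \<subseteq> D N"
      using N(2) one[OF N(1)] subgroup.one_closed[OF PD(1)[OF N(1)]] unfolding D_def by blast
    moreover have "finite (D N)" unfolding D_def using A_finite by simp
    ultimately show ?thesis
      using card_seteq[of "D N" "D L"] greatest[OF N(1)] by simp
  qed
  have "N = L" if N: "P N" "N \<subseteq> L" for N
  proof -
    define R where "R F = {x \<in> N. \<forall>b\<in>F. x \<in> conjugate b ` N}" for F
    have nR: "R F \<lhd> G\<lparr>carrier := M\<rparr>" if "F \<subseteq> A" for F
    proof -
      have "conjugate b ` N \<lhd> G\<lparr>carrier := M\<rparr>" if "b \<in> F" for b
        using conjugate_image_normal_in_M[of N b] \<open>F \<subseteq> A\<close> that N(1) unfolding P_def by auto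
      then have *: "subgroup (conjugate b ` N) G" "\<And>x n. \<lbrakk>x \<in> M; n \<in> conjugate b ` N\<rbrakk> \<Longrightarrow> conjugate x n \<in> conjugate b ` N"
        if "b \<in> F" for b
        using that unfolding normal_in_M_iff by auto
      have "subgroup (R F) G"
      proof (rule subgroupI)
        show "R F \<subseteq> carrier G" using PD(3)[OF N(1)] unfolding R_def by blast
        have "\<one> \<in> R F" unfolding R_def
          using subgroup.one_closed[OF PD(1)[OF N(1)]] subgroup.one_closed[OF *(1)] by simp
        then show "R F \<noteq> {}" by blast
        show "inv x \<in> R F" if "x \<in> R F" for x
          using that subgroup.m_inv_closed[OF PD(1)[OF N(1)]] subgroup.m_inv_closed[OF *(1)]
          unfolding R_def by simp
        show "x \<otimes> y \<in> R F" if "x \<in> R F" "y \<in> R F" for x y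
          using that subgroup.m_closed[OF PD(1)[OF N(1)]] subgroup.m_closed[OF *(1)]
          unfolding R_def by simp
      qed
      moreover have "conjugate x n \<in> R F" if "x \<in> M" "n \<in> R F" for x n
        using that *(2) PD(4)[OF N(1)] unfolding R_def by blast
      moreover have "R F \<subseteq> M" using PD(2)[OF N(1)] unfolding R_def by blast
      ultimately show ?thesis unfolding normal_in_M_iff by blast
    qed
    \<comment> \<open>Adding some \<open>b\<close> outside \<open>D L\<close> keeps the intersection
      non-trivial: \<open>D (R F)\<close> equals \<open>D L\<close>, so \<open>R F\<close> meets its
      own \<open>b\<close>-conjugate non-trivially, and this intersection lies in
      \<open>R (insert b F)\<close>.\<close>
    have R: "R F \<noteq> {\<one>}" if "finite F" "F \<subseteq> A - D L" for F
      using that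
    proof (induction F)
      case empty
      then show ?case using N(1) unfolding R_def P_def by simp
    next
      case (insert b F)
      have PR: "P (R F)" using insert nR[of F] unfolding P_def by blast
      have "D (R F) = D L" using PR N(2) by (intro DN) (auto simp: R_def)
      then have "R F \<inter> conjugate b ` R F \<noteq> {\<one>}"
        using insert.prems unfolding D_def by blast
      moreover have "\<one> \<in> R F \<inter> conjugate b ` R F"
        using one[OF PR] subgroup.one_closed[OF PD(1)[OF PR]] insert.prems by blast
      moreover have "R F \<inter> conjugate b ` R F \<subseteq> R (insert b F)"
        unfolding R_def by blast
      ultimately show ?case by blast
    qed
    define B where "B = A - D L"
    have "finite B" unfolding B_def using A_finite by blast
    then have PN0: "P (R B)" using R[of B] nR[of B] unfolding P_def B_def by blast
    \<comment> \<open>The conjugates generating \<open>M\<close> are split: those by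
      \<open>B\<close> fall into \<open>N\<close>, those by \<open>D L\<close> commute with
      \<open>L\<close>.\<close>
    define T1 where "T1 = (\<Union>b\<in>B. conjugate b ` R B)"
    define T2 where "T2 = (\<Union>d\<in>D L. conjugate d ` R B)"
    have "(\<Union>a\<in>A. conjugate a ` R B) = T1 \<union> T2"
      unfolding T1_def T2_def B_def D_def by blast
    then have gen: "generate G (T1 \<union> T2) = M"
      using M_generated_by_conjugates[of "R B"] PN0 unfolding P_def by simp
    \<comment> \<open>Conjugating by \<open>b\<close> carries the intersection of \<open>L\<close>
      with its \<open>inv b\<close>-conjugate to that of \<open>L\<close> with its
      \<open>b\<close>-conjugate, so both are trivial or neither is. Closure of \<open>B\<close>
      under inverses is what puts \<open>T1\<close> inside \<open>N\<close>.\<close>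
    have invB: "inv b \<in> B" if b: "b \<in> B" for b
    proof -
      have bA: "b \<in> A" using b unfolding B_def by blast
      have "inv b \<notin> D L"
      proof
        assume "inv b \<in> D L"
        then have "L \<inter> conjugate (inv b) ` L = {\<one>}" unfolding D_def by blast
        then have "conjugate b ` (L \<inter> conjugate (inv b) ` L) = {\<one>}"
          using bA by simp
        moreover have "conjugate b ` (L \<inter> conjugate (inv b) ` L) = conjugate b ` L \<inter> conjugate b ` conjugate (inv b) ` L"
          using inj_on_conjugate[of b "carrier G"] PD(3)[OF L] bA
          by (intro inj_on_image_Int[of _ "carrier G"]) auto
        ultimately have "b \<in> D L"
          using bA PD(3)[OF L] unfolding D_def by (auto simp: conjugate_image_cancel)
        then show False using b unfolding B_def by blast
      qed
      then show ?thesis using bA unfolding B_def by simp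
    qed
    have T1: "T1 \<subseteq> N"
    proof -
      have "conjugate b x \<in> N" if b: "b \<in> B" and x: "x \<in> R B" for b x
      proof -
        have "x \<in> conjugate (inv b) ` N" using invB[OF b] x unfolding R_def by blast
        then show ?thesis
          using b PD(3)[OF N(1)] mem_conjugate_image_iff[of "inv b" N x] unfolding B_def
          by auto
      qed
      then show ?thesis unfolding T1_def by blast
    qed
    have T2comm: "l \<otimes> t = t \<otimes> l" if l: "l \<in> L" and t: "t \<in> T2" for l t
    proof -
      obtain d where d: "d \<in> D L" "t \<in> conjugate d ` R B" using t unfolding T2_def by blast
      then have dL: "t \<in> conjugate d ` L" "d \<in> A" "L \<inter> conjugate d ` L \<subseteq> {\<one>}"
        using N(2) unfolding R_def D_def by auto
      have "L \<lhd> G\<lparr>carrier := M\<rparr>" using L unfolding P_def by blast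
      then show ?thesis
        using normal_in_M_commute[OF _ conjugate_image_normal_in_M dL(3) l dL(1)] dL(2) by simp
    qed
    have T2M: "T2 \<subseteq> M"
      using gen generate.incl[of _ "T1 \<union> T2" G] by blast
    then have T2c: "T2 \<subseteq> carrier G" using M.subset by blast
    have g2: "subgroup (generate G T2) G" "generate G T2 \<subseteq> M"
      using generate_is_subgroup[OF T2c] generate_subgroup_incl[OF T2M M_subgroup] by auto
    have prod: "subgroup (N <#> generate G T2) G"
      using PD(4)[OF N(1)] g2 by (intro subgroup_set_mult[OF PD(1)[OF N(1)]]) auto
    have prodI: "n \<otimes> y \<in> N <#> generate G T2" if "n \<in> N" "y \<in> generate G T2" for n y
      using that by (auto simp: set_mult_def)
    have "t \<in> N <#> generate G T2" if "t \<in> T1 \<union> T2" for t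
    proof (cases "t \<in> T1")
      case True
      then have "t \<in> N" "t \<in> carrier G" using T1 PD(3)[OF N(1)] by blast+
      then show ?thesis
        using prodI[OF _ generate.one, of t] by simp
    next
      case False
      then show ?thesis
        using that prodI[of \<one> t] subsetD[OF T2c, of t] generate.incl[of t T2 G]
          subgroup.one_closed[OF PD(1)[OF N(1)]] by simp
    qed
    then have Mprod: "M \<subseteq> N <#> generate G T2"
      using generate_subgroup_incl[OF _ prod, of "T1 \<union> T2"] gen by blast
    have "x \<in> N" if x: "x \<in> L" for x
    proof -
      have "x \<in> N <#> generate G T2" using Mprod x PD(2)[OF L] by blast
      then obtain n y where ny: "n \<in> N" "y \<in> generate G T2" "x = n \<otimes> y"
        by (auto simp: set_mult_def)
      have c: "n \<in> carrier G" "y \<in> carrier G" "n \<in> L"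
        using ny PD(3)[OF N(1)] N(2) generate_in_carrier[OF T2c] by auto
      have y: "y = inv n \<otimes> x" using ny(3) c by (simp add: word_simps)
      have yL: "y \<in> L"
        unfolding y using subgroup.m_closed[OF PD(1)[OF L]] subgroup.m_inv_closed[OF PD(1)[OF L]] c x by blast
      \<comment> \<open>As an element of \<open>L\<close>, \<open>y\<close> commutes with
        \<open>T2\<close>; as an element generated by \<open>T2\<close>, it commutes with
        \<open>T1\<close>, which is contained in \<open>L\<close>.\<close>
      have "y \<otimes> t = t \<otimes> y" if "t \<in> T1 \<union> T2" for t
      proof (cases "t \<in> T2")
        case True
        then show ?thesis using T2comm yL by blast
      next
        case False
        then have "t \<in> L" using T1 N(2) that by blast
        then have "t \<otimes> y = y \<otimes> t"
          using generate_commute[OF _ T2c T2comm ny(2)] PD(3)[OF L] by blast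
        then show ?thesis by simp
      qed
      moreover have "T1 \<union> T2 \<subseteq> carrier G" using T1 T2c PD(3)[OF N(1)] by blast
      ultimately have "y \<otimes> m = m \<otimes> y" if "m \<in> M" for m
        using generate_commute[of y "T1 \<union> T2" m] gen c(2) that by blast
      then have "y = \<one>" by (rule M_centralizer[OF c(2)])
      then show ?thesis using ny c by simp
    qed
    then show ?thesis using N(2) by blast
  qed
  then have "minimal_normal L (G\<lparr>carrier := M\<rparr>)"
    using L unfolding minimal_normal_def P_def by auto
  then show thesis by (rule that)
qed

end

section \<open>The components of the minimal normal subgroup\<close>

locale minimal_component = unique_minimal_normal_subgroup +
  fixes L
  assumes L_minimal: "minimal_normal L (G\<lparr>carrier := M\<rparr>)"
begin

text \<open>A set rather than a family over \<open>A\<close>, so that a conjugate produced by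
  several elements of \<open>A\<close> occurs only once.\<close>

definition comps :: "'a set set"
  where "comps = (\<lambda>a. conjugate a ` L) ` A"

text \<open>For a component \<open>C\<close> this turns out to be its direct complement in
  \<open>M\<close>.\<close>

definition others :: "'a set \<Rightarrow> 'a set"
  where "others C = generate G (\<Union>(comps - {C}))"

lemma L_normal: "L \<lhd> G\<lparr>carrier := M\<rparr>" and L_nontrivial: "L \<noteq> {\<one>}"
  using L_minimal by (simp_all add: minimal_normal_def)

lemma L_eqI: "\<lbrakk>N \<lhd> G\<lparr>carrier := M\<rparr>; N \<noteq> {\<one>}; N \<subseteq> L\<rbrakk> \<Longrightarrow> N = L"
  using L_minimal by (auto simp: minimal_normal_def)

lemma L_subgroup: "subgroup L G" and L_M: "L \<subseteq> M"
  using L_normal by (auto simp: normal_in_M_iff)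

lemma L_carrier: "L \<subseteq> carrier G"
  using L_M M.subset by blast

lemma L_comps: "L \<in> comps"
proof -
  have "conjugate \<one> ` L \<in> comps" unfolding comps_def by (intro imageI) simp
  then show ?thesis by (simp add: one_conjugate_image L_carrier)
qed

lemma comps_finite: "finite comps"
  unfolding comps_def using A_finite by simp

lemma compsE:
  assumes "C \<in> comps"
  obtains a where "a \<in> A" "C = conjugate a ` L"
  using assms unfolding comps_def by blast

lemma comps_normal: "C \<in> comps \<Longrightarrow> C \<lhd> G\<lparr>carrier := M\<rparr>"
  by (erule compsE) (simp add: conjugate_image_normal_in_M L_normal)

lemma comps_subgroup: "C \<in> comps \<Longrightarrow> subgroup C G" and comps_M: "C \<in> comps \<Longrightarrow> C \<subseteq> M"
  using comps_normal by (auto simp: normal_in_M_iff)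

lemma comps_carrier: "C \<in> comps \<Longrightarrow> C \<subseteq> carrier G"
  using comps_M M.subset by blast

text \<open>Writing \<open>g \<otimes> a = b \<otimes> m\<close> with \<open>b \<in> A\<close> and
  \<open>m \<in> M\<close> reduces conjugation by \<open>g\<close> to conjugation by
  \<open>b\<close>, because \<open>M\<close> normalizes \<open>L\<close>.\<close>

lemma comps_conjugate:
  assumes "g \<in> carrier G" "C \<in> comps"
  shows "conjugate g ` C \<in> comps"
proof -
  obtain a where a: "a \<in> A" "C = conjugate a ` L" using assms(2) by (rule compsE)
  obtain b m where bm: "b \<in> A" "m \<in> M" "g \<otimes> a = b \<otimes> m"
    using A_times_M[OF m_closed[OF assms(1) A_carrier[OF a(1)]]] by blast
  have "conjugate g ` C = conjugate b ` conjugate m ` L"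
    using a bm assms(1) L_carrier by (simp add: conjugate_image_image)
  also have "\<dots> = conjugate b ` L"
    using normal_in_M_conjugate_eq[OF L_normal bm(2)] by simp
  finally show ?thesis using bm(1) unfolding comps_def by blast
qed

lemma comps_conjugate_M: "\<lbrakk>m \<in> M; C \<in> comps\<rbrakk> \<Longrightarrow> conjugate m ` C = C"
  using comps_normal normal_in_M_conjugate_eq by blast

text \<open>Conjugating back to \<open>L\<close> transfers minimality in \<open>M\<close> from
  \<open>L\<close> to every component.\<close>

lemma comps_eqI:
  assumes "N \<lhd> G\<lparr>carrier := M\<rparr>" "N \<noteq> {\<one>}" "C \<in> comps" "N \<subseteq> C"
  shows "N = C"
proof -
  obtain a where a: "a \<in> A" "C = conjugate a ` L" using assms(3) by (rule compsE)
  have Nc: "N \<subseteq> carrier G" using assms(3,4) comps_carrier by blast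
  have "conjugate (inv a) ` N \<subseteq> conjugate (inv a) ` C"
    using assms(4) by (rule image_mono)
  then have "conjugate (inv a) ` N \<subseteq> L"
    using a L_carrier by (simp add: conjugate_image_cancel)
  then have "conjugate (inv a) ` N = L"
    using a assms Nc
    by (intro L_eqI) (simp_all add: conjugate_image_normal_in_M conjugate_image_trivial_iff)
  then have "conjugate a ` L = conjugate a ` conjugate (inv a) ` N" by simp
  then show ?thesis using a Nc by (simp add: conjugate_image_cancel)
qed

lemma comps_inter:
  assumes "C \<in> comps" "C' \<in> comps" "C \<noteq> C'"
  shows "C \<inter> C' = {\<one>}"
proof (rule ccontr)
  assume ne: "C \<inter> C' \<noteq> {\<one>}"
  have "C \<inter> C' \<lhd> G\<lparr>carrier := M\<rparr>"
    using comps_normal[OF assms(1)] comps_normal[OF assms(2)] M_subgroup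
    by (intro group.normal_subgroup_intersect subgroup_imp_group)
  then have "C \<inter> C' = C" "C \<inter> C' = C'"
    using ne assms by (intro comps_eqI; blast)+
  then show False using assms(3) by blast
qed

lemma comps_commute:
  assumes "C \<in> comps" "C' \<in> comps" "C \<noteq> C'" "x \<in> C" "y \<in> C'"
  shows "x \<otimes> y = y \<otimes> x"
  using normal_in_M_commute[OF comps_normal comps_normal _ assms(4,5)] comps_inter assms by blast

lemma comps_generate: "generate G (\<Union>comps) = M"
  using M_generated_by_conjugates[OF L_normal L_nontrivial] unfolding comps_def by simp

lemma Union_comps: "\<Union>(comps - {C}) \<subseteq> M" "\<Union>(comps - {C}) \<subseteq> carrier G"
  using comps_M comps_carrier by blast+

lemma others_subgroup: "subgroup (others C) G"
  unfolding others_def using Union_comps(2) by (rule generate_is_subgroup)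

lemma others_M: "others C \<subseteq> M"
  unfolding others_def using Union_comps(1) M_subgroup by (rule generate_subgroup_incl)

lemma others_carrier: "others C \<subseteq> carrier G"
  using others_M M.subset by blast

lemma comps_others: "\<lbrakk>C' \<in> comps; C' \<noteq> C\<rbrakk> \<Longrightarrow> C' \<subseteq> others C"
  unfolding others_def using generate.incl[of _ "\<Union>(comps - {C})" G] by blast

lemma others_commute:
  assumes "C \<in> comps" "x \<in> C" "z \<in> others C"
  shows "x \<otimes> z = z \<otimes> x"
proof (rule generate_commute[OF _ Union_comps(2)])
  show "x \<in> carrier G" using assms comps_carrier by blast
  show "z \<in> generate G (\<Union>(comps - {C}))" using assms(3) unfolding others_def .
  show "x \<otimes> s = s \<otimes> x" if "s \<in> \<Union>(comps - {C})" for s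
    using that comps_commute[OF assms(1) _ _ assms(2)] by blast
qed

lemma comps_centralizer:
  assumes "x \<in> carrier G" "\<And>C y. \<lbrakk>C \<in> comps; y \<in> C\<rbrakk> \<Longrightarrow> x \<otimes> y = y \<otimes> x"
  shows "x = \<one>"
proof (rule M_centralizer[OF assms(1)])
  fix m assume "m \<in> M"
  then have "m \<in> generate G (\<Union>comps)" by (simp add: comps_generate)
  moreover have "\<Union>comps \<subseteq> carrier G" using comps_carrier by blast
  ultimately show "x \<otimes> m = m \<otimes> x"
    using generate_commute[OF assms(1)] assms(2) by blast
qed

text \<open>A common element commutes with \<open>C\<close>, because \<open>others C\<close> does,
  and with every other component, because \<open>C\<close> does. It therefore centralizes
  \<open>M\<close>.\<close>

lemma others_inter:
  assumes "C \<in> comps"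
  shows "C \<inter> others C = {\<one>}"
proof -
  have "x = \<one>" if x: "x \<in> C" "x \<in> others C" for x
  proof (rule comps_centralizer)
    show "x \<in> carrier G" using x others_carrier by blast
    show "x \<otimes> y = y \<otimes> x" if "C' \<in> comps" "y \<in> C'" for C' y
      using that x others_commute[OF assms, of y x] comps_commute[OF assms that(1)] by fastforce
  qed
  then show ?thesis
    using subgroup.one_closed[OF comps_subgroup[OF assms]] subgroup.one_closed[OF others_subgroup] by blast
qed

text \<open>An element of \<open>others C\<close> commutes with \<open>C\<close>, so
  \<open>x\<close> centralizes all components. In terms of coordinates, an element of
  \<open>M\<close> with only trivial coordinates is the identity.\<close>

lemma Inter_others:
  assumes "x \<in> carrier G" "\<And>C. C \<in> comps \<Longrightarrow> x \<in> others C"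
  shows "x = \<one>"
  using assms(1)
proof (rule comps_centralizer)
  fix C y assume "C \<in> comps" "y \<in> C"
  then show "x \<otimes> y = y \<otimes> x" using others_commute[of C y x] assms(2) by simp
qed

lemma others_conjugate:
  assumes "g \<in> carrier G" "C \<in> comps" "z \<in> others C"
  shows "conjugate g z \<in> others (conjugate g ` C)"
proof -
  have "conjugate g z \<in> generate G (conjugate g ` \<Union>(comps - {C}))"
    using assms unfolding others_def by (intro conjugate_generate) (auto simp: Union_comps)
  moreover have "conjugate g ` \<Union>(comps - {C}) \<subseteq> \<Union>(comps - {conjugate g ` C})"
  proof
    fix x assume "x \<in> conjugate g ` \<Union>(comps - {C})"
    then obtain C' y where C': "C' \<in> comps" "C' \<noteq> C" "y \<in> C'" "x = conjugate g y" by blast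
    have "conjugate g ` C' \<noteq> conjugate g ` C"
      using conjugate_image_cancel(1)[OF assms(1) comps_carrier[OF C'(1)]]
        conjugate_image_cancel(1)[OF assms(1) comps_carrier[OF assms(2)]] C'(2) by metis
    then show "x \<in> \<Union>(comps - {conjugate g ` C})"
      using C' comps_conjugate[OF assms(1)] by blast
  qed
  ultimately show ?thesis
    unfolding others_def using mono_generate by blast
qed

lemma others_normal_in_M:
  assumes "C \<in> comps"
  shows "others C \<lhd> G\<lparr>carrier := M\<rparr>"
  unfolding normal_in_M_iff
proof (intro conjI ballI others_subgroup others_M)
  fix x n assume x: "x \<in> M" and n: "n \<in> others C"
  show "conjugate x n \<in> others C"
    using others_conjugate[OF M.mem_carrier[OF x] assms n] comps_conjugate_M[OF x assms] by simp
qed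

lemma comps_times_others:
  assumes "C \<in> comps" "m \<in> M"
  shows "\<exists>c\<in>C. \<exists>z\<in>others C. m = c \<otimes> z"
proof -
  have C: "subgroup C G" "\<And>x n. \<lbrakk>x \<in> M; n \<in> C\<rbrakk> \<Longrightarrow> conjugate x n \<in> C"
    using comps_normal[OF assms(1)] unfolding normal_in_M_iff by auto
  have sub: "subgroup (C <#> others C) G"
    using C others_M[of C] by (intro subgroup_set_mult others_subgroup) auto
  have prod: "c \<otimes> z \<in> C <#> others C" if "c \<in> C" "z \<in> others C" for c z
    using that by (auto simp: set_mult_def)
  have "\<Union>comps \<subseteq> C <#> others C"
  proof
    fix x assume "x \<in> \<Union>comps"
    then obtain C' where C': "C' \<in> comps" "x \<in> C'" by blast
    then have xc: "x \<in> carrier G" using comps_carrier by blast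
    show "x \<in> C <#> others C"
    proof (cases "C' = C")
      case True
      then show ?thesis
        using prod[of x \<one>] C' xc subgroup.one_closed[OF others_subgroup] by simp
    next
      case False
      then have "x \<in> others C" using comps_others C' by blast
      then show ?thesis
        using prod[of \<one> x] xc subgroup.one_closed[OF C(1)] by simp
    qed
  qed
  then have "M \<subseteq> C <#> others C"
    using generate_subgroup_incl[OF _ sub] comps_generate by blast
  then have "m \<in> C <#> others C" using assms(2) by blast
  then show ?thesis by (auto simp: set_mult_def)
qed

text \<open>\<open>M\<close> is the product of \<open>L\<close> and \<open>others L\<close>, and
  \<open>others L\<close> centralizes \<open>L\<close>. A normal subgroup of \<open>L\<close> is
  therefore already normal in \<open>M\<close>, where \<open>L\<close> is minimal.\<close>

lemma L_simple: "simple_grp (G\<lparr>carrier := L\<rparr>)"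
proof -
  have "N = {\<one>} \<or> N = L" if "N \<lhd> G\<lparr>carrier := L\<rparr>" for N
  proof -
    have N: "subgroup N G" "N \<subseteq> L" "\<And>x n. \<lbrakk>x \<in> L; n \<in> N\<rbrakk> \<Longrightarrow> conjugate x n \<in> N"
      using that unfolding normal_restrict_iff[OF L_subgroup] by auto
    have "conjugate m n \<in> N" if m: "m \<in> M" and n: "n \<in> N" for m n
    proof -
      obtain l z where lz: "l \<in> L" "z \<in> others L" "m = l \<otimes> z"
        using comps_times_others[OF L_comps m] by blast
      have nL: "n \<in> L" using n N(2) by blast
      have c: "l \<in> carrier G" "z \<in> carrier G" "n \<in> carrier G"
        using lz nL L_carrier others_carrier by blast+
      have "conjugate z n = n"
        using others_commute[OF L_comps nL lz(2)] c by (intro conjugate_commute) auto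
      then have "conjugate m n = conjugate l n"
        using lz c by (simp flip: conjugate_conjugate)
      then show ?thesis using N(3) lz(1) n by simp
    qed
    then have "N \<lhd> G\<lparr>carrier := M\<rparr>"
      using N(1,2) L_M unfolding normal_in_M_iff by blast
    then show ?thesis using L_eqI N(2) by blast
  qed
  then show ?thesis
    unfolding simple_grp_def using L_subgroup subgroup_imp_group L_nontrivial by simp
qed

text \<open>Otherwise \<open>others L\<close> would have finite index in \<open>M\<close>, hence
  equal \<open>M\<close>, and would meet \<open>L\<close> in all of \<open>L\<close>.\<close>

lemma L_infinite: "infinite L"
proof
  assume fin: "finite L"
  have "others L = M"
  proof (rule M_no_finite_index[OF others_normal_in_M[OF L_comps] fin L_carrier])
    fix x assume "x \<in> M"
    then obtain l z where lz: "l \<in> L" "z \<in> others L" "x = l \<otimes> z"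
      using comps_times_others[OF L_comps] by blast
    then show "\<exists>y\<in>others L. \<exists>f\<in>L. x = y \<otimes> f"
      using others_commute[OF L_comps lz(1,2)] by metis
  qed
  then show False using others_inter[OF L_comps] L_M L_nontrivial by blast
qed

text \<open>An abelian \<open>L\<close> would commute with itself as well as with the other
  components, so it would be trivial.\<close>

lemma L_not_abelian: "\<not> comm_group (G\<lparr>carrier := L\<rparr>)"
proof
  assume "comm_group (G\<lparr>carrier := L\<rparr>)"
  then interpret L: comm_group "G\<lparr>carrier := L\<rparr>" .
  have "l = \<one>" if l: "l \<in> L" for l
  proof (rule comps_centralizer)
    show "l \<in> carrier G" using l L_carrier by blast
    show "l \<otimes> y = y \<otimes> l" if "C \<in> comps" "y \<in> C" for C y
      using that l L.m_comm[of l y] comps_commute[OF L_comps that(1) _ l that(2)] by (cases "C = L") auto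
  qed
  then show False using L_nontrivial subgroup.one_closed[OF L_subgroup] by blast
qed

text \<open>The projections to \<open>L\<close> of finitely many generators of \<open>M\<close>
  suffice: multiplied by \<open>others L\<close>, the group they generate is all of
  \<open>M\<close>, and for an element of \<open>L\<close> the factor from \<open>others L\<close>
  is trivial.\<close>

lemma L_finitely_generated: "finitely_generated (G\<lparr>carrier := L\<rparr>)"
proof -
  obtain S where S: "finite S" "S \<subseteq> M" "generate G S = M" by (rule M_finitely_generated)
  obtain p q where pq: "\<And>m. m \<in> M \<Longrightarrow> p m \<in> L \<and> q m \<in> others L \<and> m = p m \<otimes> q m"
    using comps_times_others[OF L_comps] by metis
  define T where "T = p ` S"
  have T: "finite T" "T \<subseteq> L" using S pq unfolding T_def by auto
  have Tc: "T \<subseteq> carrier G" using T L_carrier by blast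
  have gT: "subgroup (generate G T) G" "generate G T \<subseteq> L"
    using generate_is_subgroup[OF Tc] generate_subgroup_incl[OF T(2) L_subgroup] by auto
  have cj: "conjugate z t = t" if "z \<in> others L" "t \<in> generate G T" for z t
    using that gT(2) L_carrier others_carrier others_commute[OF L_comps, of t z]
    by (intro conjugate_commute) auto
  have sub: "subgroup (generate G T <#> others L) G"
    using gT(1) others_subgroup by (rule subgroup_set_mult) (simp add: cj)
  have "S \<subseteq> generate G T <#> others L"
  proof
    fix s assume "s \<in> S"
    then have "p s \<in> generate G T" "q s \<in> others L" "s = p s \<otimes> q s"
      using S(2) pq[of s] unfolding T_def by (auto intro: generate.incl)
    then show "s \<in> generate G T <#> others L" unfolding set_mult_def by blast
  qed
  then have M: "M \<subseteq> generate G T <#> others L"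
    using generate_subgroup_incl[OF _ sub] S(3) by blast
  have "l \<in> generate G T" if l: "l \<in> L" for l
  proof -
    obtain t z where tz: "t \<in> generate G T" "z \<in> others L" "l = t \<otimes> z"
      using M l L_M by (auto simp: set_mult_def)
    have c: "t \<in> carrier G" "z \<in> carrier G" "t \<in> L"
      using tz gT(2) L_carrier others_carrier by blast+
    then have z: "z = inv t \<otimes> l" using tz by (simp add: word_simps)
    have "inv t \<otimes> l \<in> L"
      using c l subgroup.m_closed[OF L_subgroup] subgroup.m_inv_closed[OF L_subgroup] by blast
    then have "z \<in> L" by (simp only: z)
    then have "z = \<one>" using tz(2) others_inter[OF L_comps] by blast
    then show ?thesis using tz c by simp
  qed
  then have "generate G T = L" using gT(2) by blast
  then have "generate (G\<lparr>carrier := L\<rparr>) T = L"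
    using generate_consistent[OF T(2) L_subgroup] by simp
  then show ?thesis
    unfolding finitely_generated_def using T by auto
qed

lemma comps_iso:
  assumes "C \<in> comps"
  shows "G\<lparr>carrier := C\<rparr> \<cong> G\<lparr>carrier := L\<rparr>"
proof -
  obtain a where a: "a \<in> A" "C = conjugate a ` L" using assms by (rule compsE)
  have "conjugate a \<in> iso (G\<lparr>carrier := L\<rparr>) (G\<lparr>carrier := C\<rparr>)"
    unfolding iso_def hom_def bij_betw_def
    using a L_carrier inj_on_conjugate[OF A_carrier[OF a(1)] L_carrier]
    by (auto simp: conjugate_mult subset_iff)
  then have "G\<lparr>carrier := L\<rparr> \<cong> G\<lparr>carrier := C\<rparr>" unfolding is_iso_def by blast
  then show ?thesis
    using group.iso_sym subgroup_imp_group[OF L_subgroup] by blast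
qed

lemma comps_direct_product:
  assumes "bij_betw K I comps"
  shows "internal_direct_product (G\<lparr>carrier := M\<rparr>) I K"
proof -
  have K: "K ` I = comps" and inj: "inj_on K I" using assms by (auto simp: bij_betw_def)
  have "(\<Union>j\<in>I - {i}. K j) = \<Union>(comps - {K i})" if "i \<in> I" for i
    using that inj_on_image_set_diff[OF inj, of I "{i}"] K by auto
  moreover have "generate (G\<lparr>carrier := M\<rparr>) (\<Union>(comps - {C})) = others C" for C
    unfolding others_def using Union_comps(1) M_subgroup by (rule generate_consistent)
  moreover have "generate (G\<lparr>carrier := M\<rparr>) (\<Union>i\<in>I. K i) = M"
    using generate_consistent[of "\<Union>comps" M] comps_M M_subgroup comps_generate K by auto
  ultimately show ?thesis
    unfolding internal_direct_product_def
    using imageI[of _ I K, unfolded K] comps_normal others_inter by simp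
qed

lemma not_simple_imp_card_comps:
  assumes "\<not> simple_grp (G\<lparr>carrier := M\<rparr>)"
  shows "card comps > 1"
proof (rule ccontr)
  assume "\<not> card comps > 1"
  then have "\<forall>C\<in>comps. C = L"
    using card_le_Suc0_iff_eq[OF comps_finite] L_comps by auto
  then have "\<Union>comps \<subseteq> L" by blast
  then have "M \<subseteq> L"
    using generate_subgroup_incl[OF _ L_subgroup] comps_generate by blast
  then have "M = L" using L_M by blast
  then show False using assms L_simple by simp
qed

text \<open>The product \<open>Q\<close> of the projections of \<open>A \<inter> M\<close> to the components is normalized by \<open>A\<close>. It
  is not all of \<open>M\<close>, since \<open>L\<close> is infinite and the projection of \<open>A \<inter> M\<close> to it is finite; so
  \<open>Q \<subseteq> A\<close> by maximality of \<open>A\<close>.\<close>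

lemma component_part_in_A:
  assumes "l \<in> L" "z \<in> others L" "l \<otimes> z \<in> A"
  shows "l \<in> A"
proof -
  \<comment> \<open>The condition at \<open>C\<close> says that the \<open>C\<close>-coordinate of
    \<open>x\<close> is also the \<open>C\<close>-coordinate of some element of
    \<open>A \<inter> M\<close>.\<close>
  define Q where "Q = {x \<in> M. \<forall>C\<in>comps. x \<in> others C <#> (A \<inter> M)}"
  have AM: "subgroup (A \<inter> M) G" using A_subgroup M_subgroup by (rule subgroups_Inter_pair)
  have sub: "subgroup (others C <#> (A \<inter> M)) G" if "C \<in> comps" for C
    using others_normal_in_M[OF that] unfolding normal_in_M_iff
    by (intro subgroup_set_mult[OF others_subgroup AM]) auto
  have prod: "z \<otimes> b \<in> others C <#> (A \<inter> M)" if "z \<in> others C" "b \<in> A \<inter> M" for C z b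
    using that by (auto simp: set_mult_def)
  have oneoth: "\<one> \<in> others C" for C using others_subgroup by (rule subgroup.one_closed)
  have AMQ: "b \<in> Q" if "b \<in> A \<inter> M" for b
    using that prod[OF oneoth that] unfolding Q_def by simp
  have Q: "subgroup Q G"
  proof (rule subgroupI)
    show "Q \<subseteq> carrier G" using M.subset unfolding Q_def by blast
    show "Q \<noteq> {}" using AMQ[of \<one>] by auto
    show "inv x \<in> Q" if "x \<in> Q" for x
      using that subgroup.m_inv_closed[OF sub] unfolding Q_def by simp
    show "x \<otimes> y \<in> Q" if "x \<in> Q" "y \<in> Q" for x y
      using that subgroup.m_closed[OF sub] unfolding Q_def by simp
  qed
  have inv: "conjugate a x \<in> Q" if a: "a \<in> A" and x: "x \<in> Q" for a x
  proof -
    have "conjugate a x \<in> others C <#> (A \<inter> M)" if C: "C \<in> comps" for C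
    proof -
      define C' where "C' = conjugate (inv a) ` C"
      have C': "C' \<in> comps" "conjugate a ` C' = C"
        unfolding C'_def using a C by (simp_all add: comps_conjugate conjugate_image_cancel comps_carrier)
      then obtain z b where zb: "z \<in> others C'" "b \<in> A \<inter> M" "x = z \<otimes> b"
        using x unfolding Q_def set_mult_def by blast
      then have "conjugate a x = conjugate a z \<otimes> conjugate a b"
        using a others_carrier[of C'] by (auto intro: conjugate_mult)
      moreover have "conjugate a z \<in> others C"
        using others_conjugate[OF _ C'(1) zb(1), of a] a C'(2) by simp
      moreover have "conjugate a b \<in> A \<inter> M"
        using a zb(2) M_conjugate by (simp add: conjugate_def)
      ultimately show ?thesis using prod by simp
    qed
    moreover have "conjugate a x \<in> M" using x a M_conjugate unfolding Q_def by simp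
    ultimately show ?thesis unfolding Q_def by blast
  qed
  have "Q \<subseteq> A"
  proof (rule ccontr)
    assume notA: "\<not> Q \<subseteq> A"
    have "m \<in> Q" if m: "m \<in> M" for m
    proof -
      obtain q a where qa: "q \<in> Q" "a \<in> A" "m = q \<otimes> a"
        using invariant_times_A[OF Q inv notA M.mem_carrier[OF m]] by blast
      have qM: "q \<in> M" using qa(1) unfolding Q_def by blast
      have a: "a = inv q \<otimes> m" using qa qM by (simp add: word_simps)
      have "inv q \<otimes> m \<in> M" using qM m by simp
      then have "a \<in> A \<inter> M" using qa(2) by (simp flip: a)
      then show ?thesis using AMQ qa subgroup.m_closed[OF Q] by blast
    qed
    then have "\<exists>z\<in>others L. \<exists>b\<in>A \<inter> M. l = z \<otimes> b" if "l \<in> L" for l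
      using that L_M L_comps unfolding Q_def set_mult_def by blast
    then have "finite L"
      using A_finite AM others_inter[OF L_comps]
      by (intro finite_if_finite_cosets[OF L_subgroup others_subgroup[of L], of "A \<inter> M"])
        (auto simp: subgroup.subset)
    then show False using L_infinite by simp
  qed
  \<comment> \<open>At \<open>L\<close> the element \<open>l \<otimes> z\<close> of
    \<open>A \<inter> M\<close> has the same coordinate as \<open>l\<close>; at every other
    component the coordinate of \<open>l\<close> is trivial.\<close>
  moreover have "l \<in> others C <#> (A \<inter> M)" if C: "C \<in> comps" for C
  proof (cases "C = L")
    case True
    have c: "l \<in> carrier G" "z \<in> carrier G" using assms L_carrier others_carrier by auto
    have "l = inv z \<otimes> (z \<otimes> l)" using c by (simp add: word_simps)
    also have "\<dots> = inv z \<otimes> (l \<otimes> z)" using others_commute[OF L_comps assms(1,2)] by simp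
    finally have l: "l = inv z \<otimes> (l \<otimes> z)" .
    have "l \<otimes> z \<in> M" using assms L_M others_M by (intro M.m_closed) auto
    then have "inv z \<otimes> (l \<otimes> z) \<in> others C <#> (A \<inter> M)"
      using assms True subgroup.m_inv_closed[OF others_subgroup] by (intro prod) auto
    then show ?thesis by (simp flip: l)
  next
    case False
    then have "l \<in> others C" using comps_others[OF L_comps] assms(1) by blast
    then show ?thesis
      using prod[of l C \<one>] assms(1) L_carrier by auto
  qed
  then have "l \<in> Q" using assms(1) L_M unfolding Q_def by blast
  ultimately show ?thesis by blast
qed

end

section \<open>Actions from pointwise laws, and actions by conjugation\<close>

lemma group_actionI:
  assumes "group G"
    and closed: "\<And>g x. \<lbrakk>g \<in> carrier G; x \<in> E\<rbrakk> \<Longrightarrow> \<phi> g x \<in> E"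
    and ext: "\<And>g. g \<in> carrier G \<Longrightarrow> \<phi> g \<in> extensional E"
    and one: "\<And>x. x \<in> E \<Longrightarrow> \<phi> \<one>\<^bsub>G\<^esub> x = x"
    and mult: "\<And>g h x. \<lbrakk>g \<in> carrier G; h \<in> carrier G; x \<in> E\<rbrakk> \<Longrightarrow> \<phi> (g \<otimes>\<^bsub>G\<^esub> h) x = \<phi> g (\<phi> h x)"
  shows "group_action G E \<phi>"
proof -
  interpret group G by fact
  have inv: "\<phi> (inv\<^bsub>G\<^esub> g) (\<phi> g x) = x" "\<phi> g (\<phi> (inv\<^bsub>G\<^esub> g) x) = x" if "g \<in> carrier G" "x \<in> E" for g x
    using that mult[of "inv\<^bsub>G\<^esub> g" g x] mult[of g "inv\<^bsub>G\<^esub> g" x] one by simp_all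
  have Bij: "\<phi> g \<in> Bij E" if g: "g \<in> carrier G" for g
  proof -
    have "bij_betw (\<phi> g) E E"
      using g closed inv by (intro bij_betw_byWitness[where f' = "\<phi> (inv\<^bsub>G\<^esub> g)"]) auto
    then show ?thesis using ext[OF g] by (simp add: Bij_def)
  qed
  have "\<phi> (g \<otimes>\<^bsub>G\<^esub> h) = \<phi> g \<otimes>\<^bsub>BijGroup E\<^esub> \<phi> h" if g: "g \<in> carrier G" and h: "h \<in> carrier G" for g h
  proof -
    have "\<phi> (g \<otimes>\<^bsub>G\<^esub> h) = compose E (\<phi> g) (\<phi> h)"
      using ext[of "g \<otimes>\<^bsub>G\<^esub> h"] g h mult by (intro extensionalityI[of _ E]) (auto simp: compose_def)
    then show ?thesis using Bij g h by (simp add: BijGroup_def)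
  qed
  then have "\<phi> \<in> hom G (BijGroup E)"
    using Bij by (auto simp: hom_def BijGroup_def)
  then show ?thesis
    unfolding group_action_def group_hom_def group_hom_axioms_def
    by (simp add: group_BijGroup is_group)
qed

context group
begin

lemma conj_on_action:
  assumes "N \<lhd> G"
  shows "group_action G N (conj_on G N)"
proof (rule group_actionI)
  have N: "n \<in> carrier G" if "n \<in> N" for n
    using that normal_imp_subgroup[OF assms] subgroup.mem_carrier by metis
  have eq: "conj_on G N g n = conjugate g n" if "n \<in> N" for g n
    using that by (simp add: conj_on_def conjugate_def)
  have closed: "conjugate g n \<in> N" if "g \<in> carrier G" "n \<in> N" for g n
    using assms that by (auto simp: normal_iff_conjugate)
  show "conj_on G N g x \<in> N" if "g \<in> carrier G" "x \<in> N" for g x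
    using that by (simp add: eq closed)
  show "conj_on G N g \<in> extensional N" for g
    by (simp add: conj_on_def)
  show "conj_on G N \<one> x = x" if "x \<in> N" for x
    using that N by (simp add: eq)
  show "conj_on G N (g \<otimes> h) x = conj_on G N g (conj_on G N h x)"
    if "g \<in> carrier G" "h \<in> carrier G" "x \<in> N" for g h x
    using that N by (simp add: eq closed conjugate_conjugate)
qed (rule is_group)

lemma conj_on_sets_action:
  assumes "subgroup H G" "\<And>C. C \<in> \<C> \<Longrightarrow> C \<subseteq> carrier G"
    and closed: "\<And>h C. \<lbrakk>h \<in> H; C \<in> \<C>\<rbrakk> \<Longrightarrow> conjugate h ` C \<in> \<C>"
  shows "group_action (G\<lparr>carrier := H\<rparr>) \<C> (conj_on_sets G \<C>)"
proof (rule group_actionI)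
  show "group (G\<lparr>carrier := H\<rparr>)" using assms(1) by (rule subgroup_imp_group)
  have H: "h \<in> carrier G" if "h \<in> H" for h
    using that assms(1) subgroup.mem_carrier by metis
  have eq: "conj_on_sets G \<C> g C = conjugate g ` C" if "C \<in> \<C>" for g C
    using that assms(2) by (simp add: conj_on_sets_def conjugate_image_eq_coset)
  show "conj_on_sets G \<C> g x \<in> \<C>" if "g \<in> carrier (G\<lparr>carrier := H\<rparr>)" "x \<in> \<C>" for g x
    using that by (simp add: eq closed)
  show "conj_on_sets G \<C> g \<in> extensional \<C>" for g
    by (simp add: conj_on_sets_def)
  show "conj_on_sets G \<C> \<one>\<^bsub>G\<lparr>carrier := H\<rparr>\<^esub> x = x" if "x \<in> \<C>" for x
    using that assms(2) by (simp add: eq one_conjugate_image)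
  show "conj_on_sets G \<C> (g \<otimes>\<^bsub>G\<lparr>carrier := H\<rparr>\<^esub> h) x = conj_on_sets G \<C> g (conj_on_sets G \<C> h x)"
    if "g \<in> carrier (G\<lparr>carrier := H\<rparr>)" "h \<in> carrier (G\<lparr>carrier := H\<rparr>)" "x \<in> \<C>" for g h x
    using that H assms(2) by (simp add: eq closed conjugate_image_image)
qed

end

context unique_minimal_normal_subgroup
begin

text \<open>If \<open>A\<close> were trivial, its maximality would leave \<open>G\<close> without
  proper non-trivial subgroups. Then \<open>G\<close> would be cyclic and \<open>M\<close>
  abelian.\<close>

lemma A_nontrivial: "A \<noteq> {\<one>}"
proof
  assume A1: "A = {\<one>}"
  obtain x where x: "x \<in> carrier G" "x \<noteq> \<one>" using carrier_not_trivial one_closed by blast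
  have "generate G {x} = A \<or> generate G {x} = carrier G"
    using x generate_is_subgroup[of "{x}"] generate.one[of G "{x}"] by (intro A_maximal) (auto simp: A1)
  moreover have "x \<in> generate G {x}" by (intro generate.incl) simp
  ultimately have "carrier G = {x [^] k | k. k \<in> (UNIV :: int set)}"
    using x A1 generate_pow[OF x(1)] by auto
  then have pow: "\<exists>k :: int. y = x [^] k" if "y \<in> M" for y
    using M.mem_carrier[OF that] by auto
  have "y \<otimes> z = z \<otimes> y" if y: "y \<in> M" and z: "z \<in> M" for y z
  proof -
    obtain j :: int where j: "y = x [^] j" using pow[OF y] by blast
    obtain k :: int where k: "z = x [^] k" using pow[OF z] by blast
    show ?thesis
      unfolding j k using int_pow_mult[OF x(1), of j k] int_pow_mult[OF x(1), of k j]
      by (simp add: add.commute)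
  qed
  then show False by (rule M_not_abelian)
qed

lemma finite_rcosets_M: "finite (rcosets M)"
proof -
  have "rcosets M \<subseteq> (\<lambda>a. M #> a) ` A"
  proof
    fix D assume "D \<in> rcosets M"
    then obtain g where g: "g \<in> carrier G" "D = M #> g" by (auto simp: RCOSETS_def)
    then obtain m a where ma: "m \<in> M" "a \<in> A" "g = m \<otimes> a" using M_times_A by blast
    then have "M #> g = M #> a"
      using coset_mult_assoc[of M m a] coset_join2[of m M] M_subgroup M.subset by simp
    then show "D \<in> (\<lambda>a. M #> a) ` A" using g ma by blast
  qed
  then show ?thesis using A_finite finite_subset by blast
qed

text \<open>The element \<open>inv h \<otimes> g\<close> centralizes \<open>M\<close>. Besides
  faithfulness, this shows that an element acting on \<open>M\<close> as an inner automorphism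
  belongs to \<open>M\<close>.\<close>

lemma conj_on_M_cancel:
  assumes "g \<in> carrier G" "h \<in> carrier G" "conj_on G M g = conj_on G M h"
  shows "g = h"
proof -
  have "inv h \<otimes> g = \<one>"
  proof (rule M_centralizer)
    fix x assume x: "x \<in> M"
    have "conjugate g x = conjugate h x"
      using fun_cong[OF assms(3), of x] x by (simp add: conj_on_def conjugate_def)
    then have "conjugate (inv h) (conjugate g x) = x" using assms x by simp
    then have "conjugate (inv h \<otimes> g) x = x" using assms x by (simp add: conjugate_conjugate)
    then show "inv h \<otimes> g \<otimes> x = x \<otimes> (inv h \<otimes> g)"
      using assms x by (simp add: conjugate_eq_self_iff)
  qed (use assms in simp)
  then show ?thesis using assms by (metis inv_closed inv_equality inv_inv)
qed

lemma M_faithful_action: "faithful_action G M (conj_on G M)"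
  using conj_on_action[OF M_normal] conj_on_M_cancel
  by (auto simp: faithful_action_def faithful_action_axioms_def inj_on_def)

end

context minimal_component
begin

lemma A_transitive_on_comps:
  "transitive_action (G\<lparr>carrier := A\<rparr>) comps (conj_on_sets G comps)"
proof -
  have act: "group_action (G\<lparr>carrier := A\<rparr>) comps (conj_on_sets G comps)"
    using A_subgroup comps_carrier by (rule conj_on_sets_action) (auto intro: comps_conjugate)
  have "\<exists>g\<in>A. conj_on_sets G comps g C = C'" if C: "C \<in> comps" and C': "C' \<in> comps" for C C'
  proof -
    obtain a where a: "a \<in> A" "C = conjugate a ` L" using C by (rule compsE)
    obtain b where b: "b \<in> A" "C' = conjugate b ` L" using C' by (rule compsE)
    have "conjugate (b \<otimes> inv a) ` C = C'"
      using a b L_carrier by (simp add: conjugate_image_image m_assoc)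
    moreover have "conj_on_sets G comps (b \<otimes> inv a) C = conjugate (b \<otimes> inv a) ` C"
      using C by (simp add: conj_on_sets_def conjugate_image_eq_coset comps_carrier)
    ultimately show ?thesis using a b by (intro bexI[of _ "b \<otimes> inv a"]) simp_all
  qed
  then show ?thesis
    using act by (simp add: transitive_action_def transitive_action_axioms_def)
qed

end

section \<open>Primitive permutation groups with finite stabilizers\<close>

text \<open>The group structure is a separate parameter so that the simplifier does not rewrite the
  operations of \<^term>\<open>perm_grp \<Omega> G\<close> into those of \<^term>\<open>BijGroup \<Omega>\<close>.\<close>

locale permutation_group =
  fixes \<Omega> :: "'a set" and G :: "('a \<Rightarrow> 'a) set" and P (structure)
  assumes P_eq: "P = perm_grp \<Omega> G"
    and G_subgroup: "subgroup G (BijGroup \<Omega>)"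
begin

lemma carrier_P [simp]: "carrier P = G"
  by (simp add: P_eq)

lemma P_restrict: "P\<lparr>carrier := H\<rparr> = perm_grp \<Omega> H"
  by (simp add: P_eq)

lemma one_P: "\<one>\<^bsub>P\<^esub> = \<one>\<^bsub>BijGroup \<Omega>\<^esub>"
  by (simp add: P_eq)

sublocale group P
  unfolding P_eq by (rule group.subgroup_imp_group[OF group_BijGroup G_subgroup])

lemma G_Bij: "g \<in> G \<Longrightarrow> g \<in> Bij \<Omega>"
  using subgroup.mem_carrier[OF G_subgroup] by (simp add: BijGroup_def)

lemma action: "group_action P \<Omega> (\<lambda>g. g)"
  unfolding group_action_def group_hom_def group_hom_axioms_def
  using is_group group_BijGroup G_Bij by (auto simp: hom_def P_eq BijGroup_def)

lemma closed_G [simp]: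
  "\<one> \<in> G" "g \<in> G \<Longrightarrow> inv g \<in> G" "\<lbrakk>g \<in> G; h \<in> G\<rbrakk> \<Longrightarrow> g \<otimes> h \<in> G"
  using one_closed inv_closed m_closed by simp_all

lemma act_closed [simp]: "\<lbrakk>g \<in> G; \<omega> \<in> \<Omega>\<rbrakk> \<Longrightarrow> g \<omega> \<in> \<Omega>"
  using group_action.element_image[OF action] by simp

lemma act_mult: "\<lbrakk>g \<in> G; h \<in> G; \<omega> \<in> \<Omega>\<rbrakk> \<Longrightarrow> (g \<otimes> h) \<omega> = g (h \<omega>)"
  using group_action.composition_rule[OF action] by simp

lemma act_one [simp]: "\<omega> \<in> \<Omega> \<Longrightarrow> \<one> \<omega> = \<omega>"
  using group_action.id_eq_one[OF action] by (metis restrict_apply')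

lemma act_inv [simp]:
  "\<lbrakk>g \<in> G; \<omega> \<in> \<Omega>\<rbrakk> \<Longrightarrow> (inv g) (g \<omega>) = \<omega>"
  "\<lbrakk>g \<in> G; \<omega> \<in> \<Omega>\<rbrakk> \<Longrightarrow> g ((inv g) \<omega>) = \<omega>"
  using act_mult[of "inv g" g \<omega>] act_mult[of g "inv g" \<omega>] by simp_all

lemma act_ext:
  assumes "g \<in> G" "h \<in> G" "\<And>\<omega>. \<omega> \<in> \<Omega> \<Longrightarrow> g \<omega> = h \<omega>"
  shows "g = h"
  using assms G_Bij by (intro extensionalityI[of _ \<Omega>]) (auto simp: Bij_def)

lemma mem_stabilizer [simp]: "g \<in> point_stabilizer \<Omega> H \<omega> \<longleftrightarrow> g \<in> H \<and> g \<omega> = \<omega>"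
  by (simp add: stabilizer_def)

lemma stabilizer_subgroup:
  assumes "\<omega> \<in> \<Omega>"
  shows "subgroup (point_stabilizer \<Omega> G \<omega>) P"
  using group_action.stabilizer_subgroup[OF action assms] by (simp add: P_eq)

lemma subgroup_permutation_group:
  assumes "subgroup H P"
  shows "permutation_group \<Omega> H (perm_grp \<Omega> H)"
proof (rule permutation_group.intro)
  show "subgroup H (BijGroup \<Omega>)"
    using assms group.incl_subgroup[OF group_BijGroup G_subgroup] by (simp add: P_eq)
qed simp

lemma transitive_on_iff:
  "transitive_on \<Omega> G \<longleftrightarrow> (\<forall>x\<in>\<Omega>. \<forall>y\<in>\<Omega>. \<exists>g\<in>G. g x = y)"
  using action unfolding transitive_on_def transitive_action_def transitive_action_axioms_def P_eq
  by auto

text \<open>The relational form of invariant partitions. All conditions are restricted to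
  \<open>\<Omega>\<close>, so relations pulled back along maps that matter only on
  \<open>\<Omega>\<close> qualify.\<close>

definition invariant_equivalence :: "('a \<Rightarrow> 'a \<Rightarrow> bool) \<Rightarrow> bool"
  where "invariant_equivalence R \<longleftrightarrow>
    (\<forall>x\<in>\<Omega>. R x x) \<and> (\<forall>x\<in>\<Omega>. \<forall>y\<in>\<Omega>. R x y \<longrightarrow> R y x) \<and>
    (\<forall>x\<in>\<Omega>. \<forall>y\<in>\<Omega>. \<forall>z\<in>\<Omega>. R x y \<longrightarrow> R y z \<longrightarrow> R x z) \<and>
    (\<forall>g\<in>G. \<forall>x\<in>\<Omega>. \<forall>y\<in>\<Omega>. R x y \<longrightarrow> R (g x) (g y))"

text \<open>The classes of \<open>R\<close> form a partition, and applying the inverse permutation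
  shows that the image of a class is a whole class.\<close>

lemma primitive_onD:
  assumes "primitive_on \<Omega> G" and R: "invariant_equivalence R"
  shows "(\<forall>x\<in>\<Omega>. \<forall>y\<in>\<Omega>. R x y \<longrightarrow> x = y) \<or> (\<forall>x\<in>\<Omega>. \<forall>y\<in>\<Omega>. R x y)"
proof -
  define cls where "cls x = {y \<in> \<Omega>. R x y}" for x
  have refl: "x \<in> cls x" if "x \<in> \<Omega>" for x
    using that R by (simp add: cls_def invariant_equivalence_def)
  have cls_eq: "cls x = cls y" if "x \<in> \<Omega>" "y \<in> \<Omega>" "R x y" for x y
    using that R unfolding cls_def invariant_equivalence_def by blast
  have part: "partition_on \<Omega> (cls ` \<Omega>)"
  proof (rule partition_onI)
    show "\<Union>(cls ` \<Omega>) = \<Omega>" using refl unfolding cls_def by blast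
    show "disjnt p q" if pq: "p \<in> cls ` \<Omega>" "q \<in> cls ` \<Omega>" "p \<noteq> q" for p q
    proof (rule ccontr)
      assume "\<not> disjnt p q"
      then obtain z where z: "z \<in> p" "z \<in> q" by (auto simp: disjnt_def)
      obtain x y where xy: "x \<in> \<Omega>" "p = cls x" "y \<in> \<Omega>" "q = cls y" using pq by blast
      then have "z \<in> \<Omega>" "R x z" "R y z" using z by (simp_all add: cls_def)
      then show False using cls_eq[of x z] cls_eq[of y z] xy pq(3) by simp
    qed
    show "{} \<notin> cls ` \<Omega>" using refl by blast
  qed
  have "g ` B \<in> cls ` \<Omega>" if g: "g \<in> G" and B: "B \<in> cls ` \<Omega>" for g B
  proof -
    obtain x where x: "x \<in> \<Omega>" "B = cls x" using B by blast
    have inv: "R (h u) (h v)" if "h \<in> G" "u \<in> \<Omega>" "v \<in> \<Omega>" "R u v" for h u v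
      using R that unfolding invariant_equivalence_def by blast
    have "g ` B = cls (g x)"
    proof
      show "g ` B \<subseteq> cls (g x)" using inv[OF g x(1)] x g by (auto simp: cls_def)
      show "cls (g x) \<subseteq> g ` B"
      proof
        fix y assume y: "y \<in> cls (g x)"
        then have y': "y \<in> \<Omega>" "R (g x) y" by (simp_all add: cls_def)
        have ig: "inv g \<in> G" using g inv_closed by simp
        have "R ((inv g) (g x)) ((inv g) y)" using inv[OF ig _ y'(1,2)] g x by simp
        then have "(inv g) y \<in> B" using g x y' ig by (simp add: cls_def)
        then show "y \<in> g ` B" using g y' by (intro image_eqI[of _ _ "(inv g) y"]) simp_all
      qed
    qed
    then show ?thesis using g x by simp
  qed
  then have inv: "\<forall>g\<in>G. \<forall>B\<in>cls ` \<Omega>. g ` B \<in> cls ` \<Omega>" by blast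
  have "cls ` \<Omega> = {{\<omega>} | \<omega>. \<omega> \<in> \<Omega>} \<or> cls ` \<Omega> = {\<Omega>}"
    by (rule assms(1)[unfolded primitive_on_def, THEN conjunct2, THEN spec, THEN mp,
          OF conjI[OF part inv]])
  then show ?thesis
  proof
    assume *: "cls ` \<Omega> = {{\<omega>} | \<omega>. \<omega> \<in> \<Omega>}"
    have "x = y" if "x \<in> \<Omega>" "y \<in> \<Omega>" "R x y" for x y
    proof -
      have "cls x \<in> {{\<omega>} | \<omega>. \<omega> \<in> \<Omega>}" using imageI[OF that(1), of cls] by (simp only: *)
      then obtain \<omega> where "cls x = {\<omega>}" by blast
      moreover have "x \<in> cls x" "y \<in> cls x" using refl that by (auto simp: cls_def)
      ultimately show ?thesis by simp
    qed
    then show ?thesis by blast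
  next
    assume "cls ` \<Omega> = {\<Omega>}"
    then have "cls x = \<Omega>" if "x \<in> \<Omega>" for x using that by blast
    then have "R x y" if "x \<in> \<Omega>" "y \<in> \<Omega>" for x y using that unfolding cls_def by blast
    then show ?thesis by blast
  qed
qed

lemma primitive_onI:
  assumes trans: "transitive_on \<Omega> G" and "\<Omega> \<noteq> {}"
    and R: "\<And>R. invariant_equivalence R \<Longrightarrow>
      (\<forall>x\<in>\<Omega>. \<forall>y\<in>\<Omega>. R x y \<longrightarrow> x = y) \<or> (\<forall>x\<in>\<Omega>. \<forall>y\<in>\<Omega>. R x y)"
  shows "primitive_on \<Omega> G"
  unfolding primitive_on_def
proof (intro conjI allI impI trans)
  fix Q assume Q: "partition_on \<Omega> Q \<and> (\<forall>g\<in>G. \<forall>B\<in>Q. g ` B \<in> Q)"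
  have U: "\<Union>Q = \<Omega>" and ne: "{} \<notin> Q" and dj: "\<And>B C. \<lbrakk>B \<in> Q; C \<in> Q; B \<inter> C \<noteq> {}\<rbrakk> \<Longrightarrow> B = C"
    using Q unfolding partition_on_def disjoint_def by auto
  define R where "R x y \<longleftrightarrow> (\<exists>B\<in>Q. x \<in> B \<and> y \<in> B)" for x y
  have "invariant_equivalence R"
    unfolding invariant_equivalence_def
  proof (intro conjI ballI impI)
    show "R x x" if "x \<in> \<Omega>" for x using that U unfolding R_def by blast
    show "R y x" if "R x y" for x y using that unfolding R_def by blast
    show "R x z" if "R x y" "R y z" for x y z using that dj unfolding R_def by blast
    show "R (g x) (g y)" if "g \<in> G" "R x y" for g x y
      using that Q unfolding R_def by blast
  qed
  then consider "\<forall>x\<in>\<Omega>. \<forall>y\<in>\<Omega>. R x y \<longrightarrow> x = y" | "\<forall>x\<in>\<Omega>. \<forall>y\<in>\<Omega>. R x y"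
    using R by blast
  then show "Q = {{\<omega>} | \<omega>. \<omega> \<in> \<Omega>} \<or> Q = {\<Omega>}"
  proof cases
    case 1
    have sing: "B = {x}" if "B \<in> Q" "x \<in> B" for B x
    proof -
      have "y = x" if "y \<in> B" for y
        using 1 that \<open>B \<in> Q\<close> \<open>x \<in> B\<close> U unfolding R_def by blast
      then show ?thesis using that by blast
    qed
    have "{{\<omega>} | \<omega>. \<omega> \<in> \<Omega>} \<subseteq> Q"
    proof
      fix B assume "B \<in> {{\<omega>} | \<omega>. \<omega> \<in> \<Omega>}"
      then obtain \<omega> where "\<omega> \<in> \<Omega>" "B = {\<omega>}" by blast
      then show "B \<in> Q" using U sing by (metis UnionE)
    qed
    moreover have "Q \<subseteq> {{\<omega>} | \<omega>. \<omega> \<in> \<Omega>}"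
    proof
      fix B assume B: "B \<in> Q"
      then obtain x where "x \<in> B" using ne by fastforce
      then show "B \<in> {{\<omega>} | \<omega>. \<omega> \<in> \<Omega>}" using sing[OF B] B U by blast
    qed
    ultimately show ?thesis by blast
  next
    case 2
    have "B = \<Omega>" if B: "B \<in> Q" for B
    proof -
      obtain x where x: "x \<in> B" using B ne by fastforce
      have "y \<in> B" if y: "y \<in> \<Omega>" for y
      proof -
        have "R x y" using 2 x y \<open>B \<in> Q\<close> U by blast
        then show ?thesis using dj \<open>B \<in> Q\<close> x unfolding R_def by blast
      qed
      then show ?thesis using that U by blast
    qed
    moreover have "Q \<noteq> {}" using U \<open>\<Omega> \<noteq> {}\<close> by blast
    ultimately have "Q = {\<Omega>}" by blast
    then show ?thesis ..
  qed
qed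

end

section \<open>From primitivity to a maximal core-free stabilizer\<close>

locale primitive_finite_stabilizer = permutation_group +
  fixes \<alpha>
  assumes infinite_G: "infinite G"
    and primitive: "primitive_on \<Omega> G"
    and base [simp]: "\<alpha> \<in> \<Omega>"
    and finite_stabilizer: "finite (point_stabilizer \<Omega> G \<alpha>)"
begin

lemma transitive: "\<lbrakk>x \<in> \<Omega>; y \<in> \<Omega>\<rbrakk> \<Longrightarrow> \<exists>g\<in>G. g x = y"
  using primitive transitive_on_iff unfolding primitive_on_def by blast

text \<open>For a subgroup \<open>H\<close> containing the stabilizer, the translates of the
  \<open>H\<close>-orbit of \<open>\<alpha>\<close> are blocks. If they are points, \<open>H\<close>
  is the stabilizer; if there is only one block, \<open>H\<close> is \<open>G\<close>. A normal
  subgroup that fixes \<open>\<alpha>\<close> fixes every point by transitivity.\<close>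

sublocale finite_maximal_subgroup P "point_stabilizer \<Omega> G \<alpha>"
proof (rule finite_maximal_subgroup.intro[OF is_group], rule finite_maximal_subgroup_axioms.intro)
  let ?A = "point_stabilizer \<Omega> G \<alpha>"
  show "subgroup ?A P" by (rule stabilizer_subgroup) simp
  show "finite ?A" by (rule finite_stabilizer)
  show "infinite (carrier P)" using infinite_G by simp
  show "H = ?A \<or> H = carrier P" if H: "subgroup H P" and AH: "?A \<subseteq> H" for H
  proof -
    interpret H: subgroup H P by (rule H)
    have HG: "h \<in> G" if "h \<in> H" for h using H.mem_carrier[OF that] by simp
    \<comment> \<open>Both points lie in the translate by \<open>g\<close> of the
      \<open>H\<close>-orbit of \<open>\<alpha>\<close>, where \<open>g\<close> is chosen to send
      \<open>\<alpha>\<close> to \<open>x\<close>.\<close>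
    define R where "R x y \<longleftrightarrow> (\<exists>g\<in>G. \<exists>h\<in>H. x = g \<alpha> \<and> y = g (h \<alpha>))" for x y
    \<comment> \<open>As \<open>H\<close> contains the stabilizer, elements \<open>g\<close> and
      \<open>g'\<close> in this position belong to the same left coset of \<open>H\<close>.
      Transitivity of \<open>R\<close> rests on this.\<close>
    have key: "inv g \<otimes> g' \<in> H" if "g \<in> G" "g' \<in> G" "h \<in> H" "g (h \<alpha>) = g' \<alpha>" for g g' h
    proof -
      have "(inv h \<otimes> (inv g \<otimes> g')) \<alpha> = (inv h) ((inv g) (g' \<alpha>))"
        using that(1-3) HG by (simp add: act_mult)
      also have "\<dots> = \<alpha>" using that(1-3) HG by (simp flip: that(4))
      finally have "inv h \<otimes> (inv g \<otimes> g') \<in> ?A"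
        using that(1-3) HG by simp
      then have "h \<otimes> (inv h \<otimes> (inv g \<otimes> g')) \<in> H" using AH that by blast
      then show ?thesis using that HG by (simp add: word_simps)
    qed
    have "invariant_equivalence R"
      unfolding invariant_equivalence_def
    proof (intro conjI ballI impI)
      show "R x x" if x: "x \<in> \<Omega>" for x
      proof -
        obtain g where "g \<in> G" "g \<alpha> = x" using transitive[OF base x] by blast
        then show ?thesis unfolding R_def by (intro bexI[of _ g] bexI[of _ \<one>]) simp_all
      qed
      show "R y x" if xy: "R x y" for x y
      proof -
        obtain g h where gh: "g \<in> G" "h \<in> H" "x = g \<alpha>" "y = g (h \<alpha>)"
          using xy unfolding R_def by blast
        then have "y = (g \<otimes> h) \<alpha>" "x = (g \<otimes> h) ((inv h) \<alpha>)"
          using HG inv_closed by (simp_all add: act_mult)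
        moreover have "g \<otimes> h \<in> G" "inv h \<in> H" using gh HG m_closed by simp_all
        ultimately show ?thesis unfolding R_def by blast
      qed
      show "R x z" if xy: "R x y" and yz: "R y z" for x y z
      proof -
        obtain g h where gh: "g \<in> G" "h \<in> H" "x = g \<alpha>" "y = g (h \<alpha>)"
          using xy unfolding R_def by blast
        obtain g' h' where gh': "g' \<in> G" "h' \<in> H" "y = g' \<alpha>" "z = g' (h' \<alpha>)"
          using yz unfolding R_def by blast
        have "inv g \<otimes> g' \<in> H" using key gh gh' by simp
        then have "inv g \<otimes> g' \<otimes> h' \<in> H" using gh' by simp
        moreover have "z = g ((inv g \<otimes> g' \<otimes> h') \<alpha>)"
          using gh gh' HG m_closed inv_closed by (simp add: act_mult)
        ultimately show ?thesis using gh unfolding R_def by blast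
      qed
      show "R (g x) (g y)" if g: "g \<in> G" and xy: "R x y" for g x y
      proof -
        obtain k h where kh: "k \<in> G" "h \<in> H" "x = k \<alpha>" "y = k (h \<alpha>)"
          using xy unfolding R_def by blast
        then have "g x = (g \<otimes> k) \<alpha>" "g y = (g \<otimes> k) (h \<alpha>)"
          using g HG by (simp_all add: act_mult)
        then show ?thesis using g kh m_closed unfolding R_def by fastforce
      qed
    qed
    then consider "\<forall>x\<in>\<Omega>. \<forall>y\<in>\<Omega>. R x y \<longrightarrow> x = y" | "\<forall>x\<in>\<Omega>. \<forall>y\<in>\<Omega>. R x y"
      using primitive_onD[OF primitive] by blast
    then show ?thesis
    proof cases
      case 1
      have "h \<in> ?A" if h: "h \<in> H" for h
      proof -
        have "R \<alpha> (h \<alpha>)"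
          unfolding R_def using h one_closed by (intro bexI[of _ \<one>] bexI[of _ h]) (simp_all add: HG)
        then have "\<alpha> = h \<alpha>" using 1 h HG by simp
        then show ?thesis using h HG by simp
      qed
      then show ?thesis using AH by blast
    next
      case 2
      have "g \<in> H" if g: "g \<in> G" for g
      proof -
        have "R \<alpha> (g \<alpha>)" using 2 g by simp
        then obtain k h where kh: "k \<in> G" "h \<in> H" "\<alpha> = k \<alpha>" "g \<alpha> = k (h \<alpha>)"
          unfolding R_def by blast
        then have "k \<in> H" using AH by (auto simp: subset_iff)
        moreover have "inv k \<otimes> g \<in> H" using key kh g by simp
        ultimately have "k \<otimes> (inv k \<otimes> g) \<in> H" by simp
        then show ?thesis using g kh by (simp add: word_simps)
      qed
      then show ?thesis using HG by auto
    qed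
  qed
  show "N = {\<one>}" if N: "N \<lhd> P" and NA: "N \<subseteq> ?A" for N
  proof -
    have "n = \<one>" if n: "n \<in> N" for n
    proof (rule act_ext)
      show nG: "n \<in> G" using NA n by auto
      show "\<one> \<in> G" using one_closed by simp
      fix \<omega> assume \<omega>: "\<omega> \<in> \<Omega>"
      obtain g where g: "g \<in> G" "g \<alpha> = \<omega>" using transitive[OF base \<omega>] by blast
      have "conjugate (inv g) n \<in> N" using N n g by (simp add: normal_iff_conjugate)
      then have "conjugate (inv g) n \<alpha> = \<alpha>" using NA by auto
      then have "(inv g) (n (g \<alpha>)) = \<alpha>"
        using g nG \<omega> by (simp add: conjugate_def act_mult)
      then have "n \<omega> = g \<alpha>" using act_inv(2)[OF g(1), of "n \<omega>"] g nG \<omega> by simp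
      then show "n \<omega> = \<one> \<omega>" using g \<omega> by simp
    qed
    then show ?thesis using subgroup.one_closed[OF normal_imp_subgroup[OF N]] by blast
  qed
qed

end

section \<open>Transitivity of \<open>M\<close> and the types with simple \<open>M\<close>\<close>

locale primitive_minimal_normal =
  primitive_finite_stabilizer \<Omega> G P \<alpha> + unique_minimal_normal_subgroup P "point_stabilizer \<Omega> G \<alpha>" M
  for \<Omega> :: "'a set" and G and P (structure) and \<alpha> M
begin

lemma M_G: "m \<in> M \<Longrightarrow> m \<in> G"
  using M.mem_carrier by simp

lemma M_transitive:
  assumes "x \<in> \<Omega>" "y \<in> \<Omega>"
  shows "\<exists>m\<in>M. m x = y"
proof -
  have from_base: "\<exists>m\<in>M. m \<alpha> = z" if z: "z \<in> \<Omega>" for z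
  proof -
    obtain g where g: "g \<in> G" "g \<alpha> = z" using transitive[OF base z] by blast
    obtain m a where "m \<in> M" "a \<in> point_stabilizer \<Omega> G \<alpha>" "g = m \<otimes> a"
      using M_times_A[of g] g by auto
    then show ?thesis using g M_G by (auto simp: act_mult)
  qed
  obtain m n where mn: "m \<in> M" "m \<alpha> = x" "n \<in> M" "n \<alpha> = y"
    using from_base assms by metis
  then have G: "m \<in> G" "n \<in> G" using M_G by auto
  then have "(inv m) x = \<alpha>" using act_inv(1)[of m \<alpha>] mn(2) by simp
  then have "(n \<otimes> inv m) x = y"
    using G mn(4) assms(1) by (simp add: act_mult)
  moreover have "n \<otimes> inv m \<in> M" using mn by simp
  ultimately show ?thesis by blast
qed

text \<open>\<open>M\<close> is transitive, so its point stabilizers are conjugate in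
  \<open>M\<close> and a single one decides regularity.\<close>

lemma M_regular_iff: "regular_on \<Omega> M \<longleftrightarrow> point_stabilizer \<Omega> M \<alpha> = {\<one>}"
proof -
  interpret Mp: permutation_group \<Omega> M "perm_grp \<Omega> M"
    using subgroup_permutation_group[OF M_subgroup] .
  have "transitive_on \<Omega> M" unfolding Mp.transitive_on_iff using M_transitive by blast
  moreover have "point_stabilizer \<Omega> M x = {\<one>}"
    if st: "point_stabilizer \<Omega> M \<alpha> = {\<one>}" and x: "x \<in> \<Omega>" for x
  proof -
    obtain m where m: "m \<in> M" "m \<alpha> = x" using M_transitive[OF base x] by blast
    have "k = \<one>" if k: "k \<in> M" "k x = x" for k
    proof -
      have "conjugate (inv m) k \<in> M" using k m M_G by (intro M_conjugate) simp_all
      moreover have "(conjugate (inv m) k) \<alpha> = \<alpha>"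
        using k m x M_G[OF k(1)] M_G[OF m(1)] act_inv(1)[OF M_G[OF m(1)] base]
        by (simp add: conjugate_def act_mult)
      ultimately have "conjugate (inv m) k = \<one>" using st by (auto simp: stabilizer_def)
      then have "conjugate m (conjugate (inv m) k) = \<one>" using M_G[OF m(1)] by simp
      then show ?thesis using M_G[OF m(1)] M_G[OF k(1)] by simp
    qed
    then show ?thesis using x by (auto simp: stabilizer_def)
  qed
  ultimately show ?thesis
    unfolding regular_on_def one_P by auto
qed

text \<open>The point \<open>\<beta>\<close> is \<open>\<alpha>\<close>. Regularity makes
  \<open>M\<close> meet the stabilizer trivially; a stabilizing \<open>g\<close> acting on
  \<open>M\<close> like some \<open>x \<in> M\<close> would equal \<open>x\<close> and so be
  trivial.\<close>

lemma type_1_if_regular: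
  assumes "simple_grp (perm_grp \<Omega> M)" "regular_on \<Omega> M"
  shows "type_1 \<Omega> G M"
proof -
  let ?A = "point_stabilizer \<Omega> G \<alpha>"
  have MA: "M \<inter> ?A = {\<one>}"
    using assms(2) M_G unfolding M_regular_iff by (auto simp: stabilizer_def)
  have "G = M <#>\<^bsub>P\<^esub> ?A"
  proof
    show "G \<subseteq> M <#>\<^bsub>P\<^esub> ?A"
      using M_times_A unfolding set_mult_def by fastforce
    show "M <#>\<^bsub>P\<^esub> ?A \<subseteq> G"
      using M_G m_closed by (auto simp: set_mult_def)
  qed
  moreover have "conj_on P M g \<noteq> conj_on P M x" if "g \<in> ?A - {\<one>}" "x \<in> M" for g x
    using conj_on_M_cancel[of g x] that MA M_G by auto
  ultimately show ?thesis
    unfolding type_1_def using assms M_normal MA base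
    by (fold P_eq one_P) blast
qed

lemma type_2_if_not_regular:
  assumes "simple_grp (perm_grp \<Omega> M)" "\<not> regular_on \<Omega> M"
  shows "type_2 \<Omega> G M"
  unfolding type_2_def using assms finite_rcosets_M M_faithful_action by (fold P_eq) simp

end

section \<open>The action of a component on its orbit\<close>

lemma simple_grp_iso:
  assumes "simple_grp G" "group H" "G \<cong> H"
  shows "simple_grp H"
proof -
  interpret G: group G using assms(1) by (simp add: simple_grp_def)
  interpret H: group H by fact
  obtain \<phi> where \<phi>: "\<phi> \<in> iso H G"
    using G.iso_sym[OF assms(3)] unfolding is_iso_def by blast
  then interpret \<phi>: group_hom H G \<phi>
    by (simp add: group_hom_def group_hom_axioms_def iso_def H.is_group G.is_group)
  have inj: "inj_on \<phi> (carrier H)" and surj: "\<phi> ` carrier H = carrier G"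
    using \<phi> by (auto simp: iso_def bij_betw_def)
  have "N = {\<one>\<^bsub>H\<^esub>} \<or> N = carrier H" if N: "N \<lhd> H" for N
  proof -
    have sub: "N \<subseteq> carrier H" using normal_imp_subgroup[OF N] by (rule subgroup.subset)
    have "\<phi> ` N \<lhd> G"
      using normal.surj_hom_normal_subgroup[OF N \<phi>.group_hom_axioms surj] .
    then have "\<phi> ` N = \<phi> ` {\<one>\<^bsub>H\<^esub>} \<or> \<phi> ` N = \<phi> ` carrier H"
      using assms(1) surj by (auto simp: simple_grp_def)
    then show ?thesis
      using inj_on_image_eq_iff[OF inj sub, of "{\<one>\<^bsub>H\<^esub>}"] inj_on_image_eq_iff[OF inj sub subset_refl]
      by simp
  qed
  moreover have "carrier H \<noteq> {\<one>\<^bsub>H\<^esub>}"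
  proof
    assume "carrier H = {\<one>\<^bsub>H\<^esub>}"
    then have "carrier G = {\<one>\<^bsub>G\<^esub>}" using surj by auto
    then show False using assms(1) by (simp add: simple_grp_def)
  qed
  ultimately show ?thesis unfolding simple_grp_def using H.is_group by blast
qed

locale primitive_component =
  primitive_minimal_normal \<Omega> G P \<alpha> M + minimal_component P "point_stabilizer \<Omega> G \<alpha>" M L
  for \<Omega> :: "'a set" and G and P (structure) and \<alpha> M L
begin

abbreviation "Z \<equiv> others L"

definition "\<Gamma> = (\<lambda>l. l \<alpha>) ` L"

text \<open>\<open>\<Gamma>\<close> is a transversal of the \<open>Z\<close>-orbits, so the description in \<open>proj\<close> is definite on \<open>\<Omega>\<close>.\<close>

definition "proj \<omega> = (THE \<gamma>. \<gamma> \<in> \<Gamma> \<and> (\<exists>z\<in>Z. z \<omega> = \<gamma>))"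

definition "normalizing = {g \<in> G. conjugate g ` L = L}"

text \<open>The action of \<open>n\<close> on the \<open>Z\<close>-orbits, read off on their
  representatives in \<open>\<Gamma>\<close>.\<close>

definition "induced n = (\<lambda>\<gamma>\<in>\<Gamma>. proj (n \<gamma>))"

definition "H = induced ` normalizing"

definition "N = induced ` L"

lemma L_G: "l \<in> L \<Longrightarrow> l \<in> G" and Z_G: "z \<in> Z \<Longrightarrow> z \<in> G"
  using L_carrier others_carrier[of L] by auto

lemma Z_closed: "\<one> \<in> Z" "z \<in> Z \<Longrightarrow> inv z \<in> Z" "\<lbrakk>z \<in> Z; z' \<in> Z\<rbrakk> \<Longrightarrow> z \<otimes> z' \<in> Z"
  using others_subgroup[of L] by (simp_all add: subgroup.one_closed subgroup.m_inv_closed subgroup.m_closed)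

lemma L_closed: "\<one> \<in> L" "l \<in> L \<Longrightarrow> inv l \<in> L" "\<lbrakk>l \<in> L; l' \<in> L\<rbrakk> \<Longrightarrow> l \<otimes> l' \<in> L"
  using L_subgroup by (simp_all add: subgroup.one_closed subgroup.m_inv_closed subgroup.m_closed)

lemma L_Z_commute: "\<lbrakk>l \<in> L; z \<in> Z\<rbrakk> \<Longrightarrow> l \<otimes> z = z \<otimes> l"
  using others_commute[OF L_comps] .

lemma L_Z_act_commute: "\<lbrakk>l \<in> L; z \<in> Z; \<omega> \<in> \<Omega>\<rbrakk> \<Longrightarrow> l (z \<omega>) = z (l \<omega>)"
  using L_Z_commute[of l z] L_G Z_G by (simp flip: act_mult)

lemma \<Gamma>_\<Omega>: "\<gamma> \<in> \<Gamma> \<Longrightarrow> \<gamma> \<in> \<Omega>"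
  unfolding \<Gamma>_def using L_G by auto

lemma base_\<Gamma>: "\<alpha> \<in> \<Gamma>"
  unfolding \<Gamma>_def using L_closed(1) by (intro image_eqI[of _ _ \<one>]) simp_all

lemma L_\<Gamma>: "\<lbrakk>l \<in> L; \<gamma> \<in> \<Gamma>\<rbrakk> \<Longrightarrow> l \<gamma> \<in> \<Gamma>"
proof -
  assume l: "l \<in> L" and "\<gamma> \<in> \<Gamma>"
  then obtain k where k: "k \<in> L" "\<gamma> = k \<alpha>" unfolding \<Gamma>_def by blast
  then have "l \<gamma> = (l \<otimes> k) \<alpha>" using l L_G by (simp add: act_mult)
  then show "l \<gamma> \<in> \<Gamma>" unfolding \<Gamma>_def using l k L_closed(3) by blast
qed

lemma L_transitive_\<Gamma>:
  assumes "\<gamma> \<in> \<Gamma>" "\<delta> \<in> \<Gamma>"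
  shows "\<exists>l\<in>L. l \<gamma> = \<delta>"
proof -
  obtain k where k: "k \<in> L" "\<gamma> = k \<alpha>" using assms(1) unfolding \<Gamma>_def by blast
  obtain j where j: "j \<in> L" "\<delta> = j \<alpha>" using assms(2) unfolding \<Gamma>_def by blast
  have "(j \<otimes> inv k) \<gamma> = \<delta>"
    using k j L_G L_closed by (simp add: act_mult)
  then show ?thesis using k j L_closed by blast
qed

text \<open>If \<open>z\<close> maps \<open>k \<alpha>\<close> to \<open>j \<alpha>\<close>, then
  \<open>(inv j \<otimes> k) \<otimes> z\<close> fixes \<open>\<alpha>\<close>. So does its
  component \<open>inv j \<otimes> k\<close> in \<open>L\<close>, which makes the two points
  equal.\<close>

lemma \<Gamma>_transversal:
  assumes "\<gamma> \<in> \<Gamma>" "\<delta> \<in> \<Gamma>" "z \<in> Z" "z \<gamma> = \<delta>"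
  shows "\<gamma> = \<delta>"
proof -
  obtain k where k: "k \<in> L" "\<gamma> = k \<alpha>" using assms(1) unfolding \<Gamma>_def by blast
  obtain j where j: "j \<in> L" "\<delta> = j \<alpha>" using assms(2) unfolding \<Gamma>_def by blast
  have G: "k \<in> G" "j \<in> G" "z \<in> G" using k j assms(3) L_G Z_G by auto
  have "((inv j \<otimes> k) \<otimes> z) \<alpha> = (inv j) (z (k \<alpha>))"
    using G L_Z_act_commute[OF k(1) assms(3) base] by (simp add: act_mult)
  also have "\<dots> = \<alpha>" using assms(4) k j G by simp
  finally have stab: "(inv j \<otimes> k) \<otimes> z \<in> point_stabilizer \<Omega> G \<alpha>" using G by simp
  have "inv j \<otimes> k \<in> L" using k j L_closed by simp
  from component_part_in_A[OF this assms(3) stab] have "(inv j) \<gamma> = \<alpha>" using G k by (simp add: act_mult)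
  then have "j ((inv j) \<gamma>) = \<delta>" using j by simp
  then show ?thesis using G \<Gamma>_\<Omega>[OF assms(1)] by simp
qed

text \<open>A point has the form \<open>m \<alpha>\<close> with \<open>m = l \<otimes> z\<close> in
  \<open>M\<close>. The factor \<open>z\<close> commutes with \<open>l\<close>, and removing it
  leads to \<open>l \<alpha>\<close>.\<close>

lemma ex_Z_into_\<Gamma>:
  assumes "\<omega> \<in> \<Omega>"
  shows "\<exists>z\<in>Z. z \<omega> \<in> \<Gamma>"
proof -
  obtain m where m: "m \<in> M" "m \<alpha> = \<omega>" using M_transitive[OF base assms] by blast
  obtain l z where lz: "l \<in> L" "z \<in> Z" "m = l \<otimes> z"
    using comps_times_others[OF L_comps m(1)] by blast
  then have G: "l \<in> G" "z \<in> G" using L_G Z_G by auto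
  have "\<omega> = z (l \<alpha>)"
    using m(2) lz(3) G L_Z_act_commute[OF lz(1,2) base] by (simp add: act_mult)
  then have "(inv z) \<omega> = l \<alpha>" using G by simp
  then show ?thesis using lz Z_closed unfolding \<Gamma>_def by (intro bexI[of _ "inv z"]) auto
qed

lemma proj_eqI:
  assumes "\<omega> \<in> \<Omega>" "z \<in> Z" "z \<omega> \<in> \<Gamma>"
  shows "proj \<omega> = z \<omega>"
  unfolding proj_def
proof (rule the_equality)
  show "z \<omega> \<in> \<Gamma> \<and> (\<exists>z'\<in>Z. z' \<omega> = z \<omega>)" using assms by blast
  fix \<gamma> assume "\<gamma> \<in> \<Gamma> \<and> (\<exists>z'\<in>Z. z' \<omega> = \<gamma>)"
  then obtain z' where z': "\<gamma> \<in> \<Gamma>" "z' \<in> Z" "z' \<omega> = \<gamma>" by blast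
  have "(inv z') \<gamma> = \<omega>" using act_inv(1)[of z' \<omega>] z'(2,3) assms(1) Z_G by simp
  then have eq: "(z \<otimes> inv z') \<gamma> = z \<omega>"
    using Z_G[OF z'(2)] Z_G[OF assms(2)] \<Gamma>_\<Omega>[OF z'(1)] by (simp add: act_mult)
  have "z \<otimes> inv z' \<in> Z" using assms(2) z'(2) by (simp add: Z_closed)
  from \<Gamma>_transversal[OF z'(1) assms(3) this eq] show "\<gamma> = z \<omega>" .
qed

lemma proj_cases:
  assumes "\<omega> \<in> \<Omega>"
  obtains z where "z \<in> Z" "proj \<omega> = z \<omega>" "z \<omega> \<in> \<Gamma>"
  using ex_Z_into_\<Gamma>[OF assms] proj_eqI[OF assms] by blast

lemma proj_\<Gamma>: "\<omega> \<in> \<Omega> \<Longrightarrow> proj \<omega> \<in> \<Gamma>"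
  by (metis proj_cases)

lemma proj_id: "\<gamma> \<in> \<Gamma> \<Longrightarrow> proj \<gamma> = \<gamma>"
  using proj_eqI[of \<gamma> \<one>] \<Gamma>_\<Omega> Z_closed by simp

lemma proj_Z:
  assumes "\<omega> \<in> \<Omega>" "z \<in> Z"
  shows "proj (z \<omega>) = proj \<omega>"
proof -
  obtain y where y: "y \<in> Z" "proj \<omega> = y \<omega>" "y \<omega> \<in> \<Gamma>" using assms(1) by (rule proj_cases)
  have "(y \<otimes> inv z) (z \<omega>) = y \<omega>" using y assms Z_G by (simp add: act_mult)
  then show ?thesis
    using proj_eqI[of "z \<omega>" "y \<otimes> inv z"] y assms Z_G Z_closed by simp
qed

lemma proj_L:
  assumes "\<omega> \<in> \<Omega>" "l \<in> L"
  shows "proj (l \<omega>) = l (proj \<omega>)"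
proof -
  obtain z where z: "z \<in> Z" "proj \<omega> = z \<omega>" "z \<omega> \<in> \<Gamma>" using assms(1) by (rule proj_cases)
  have "z (l \<omega>) = l (proj \<omega>)" using z(2) L_Z_act_commute[OF assms(2) z(1) assms(1)] by simp
  moreover have "l (proj \<omega>) \<in> \<Gamma>" using z assms L_\<Gamma> by simp
  ultimately show ?thesis
    using proj_eqI[of "l \<omega>" z] z assms L_G by simp
qed

lemma normalizing_G: "n \<in> normalizing \<Longrightarrow> n \<in> G"
  by (simp add: normalizing_def)

lemma M_normalizing: "m \<in> M \<Longrightarrow> m \<in> normalizing"
  using comps_conjugate_M[OF _ L_comps] M_G by (simp add: normalizing_def)

lemma normalizing_subgroup: "subgroup normalizing P"
proof (rule subgroupI)
  show "normalizing \<subseteq> carrier P" using normalizing_G by auto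
  show "normalizing \<noteq> {}" using M_normalizing M.one_closed by blast
  show "inv a \<in> normalizing" if "a \<in> normalizing" for a
    using that conjugate_image_cancel(1)[of a L] L_carrier by (simp add: normalizing_def)
  show "a \<otimes> b \<in> normalizing" if "a \<in> normalizing" "b \<in> normalizing" for a b
    using that conjugate_image_image[of a b L] L_carrier by (simp add: normalizing_def)
qed

lemma normalizing_Z: "\<lbrakk>n \<in> normalizing; z \<in> Z\<rbrakk> \<Longrightarrow> conjugate n z \<in> Z"
  using others_conjugate[OF _ L_comps, of n z] by (simp add: normalizing_def)

text \<open>An element normalizing \<open>L\<close> also normalizes \<open>Z\<close>, so it permutes
  the \<open>Z\<close>-orbits. Replacing \<open>\<omega>\<close> by the representative of its orbit
  leaves the orbit of the image unchanged.\<close>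

lemma proj_normalizing:
  assumes "\<omega> \<in> \<Omega>" "n \<in> normalizing"
  shows "proj (n (proj \<omega>)) = proj (n \<omega>)"
proof -
  obtain z where z: "z \<in> Z" "proj \<omega> = z \<omega>" "z \<omega> \<in> \<Gamma>" using assms(1) by (rule proj_cases)
  have "n (z \<omega>) = (conjugate n z) (n \<omega>)"
    using assms z Z_G normalizing_G by (simp add: conjugate_def act_mult)
  then show ?thesis
    using z assms normalizing_G proj_Z[of "n \<omega>" "conjugate n z"] normalizing_Z by simp
qed

lemma induced_proj: "\<lbrakk>\<omega> \<in> \<Omega>; n \<in> normalizing\<rbrakk> \<Longrightarrow> induced n (proj \<omega>) = proj (n \<omega>)"
  by (simp add: induced_def proj_\<Gamma> proj_normalizing)

lemma induced_L: "\<lbrakk>l \<in> L; \<gamma> \<in> \<Gamma>\<rbrakk> \<Longrightarrow> induced l \<gamma> = l \<gamma>"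
  by (simp add: induced_def proj_id L_\<Gamma>)

lemma induced_action: "group_action (P\<lparr>carrier := normalizing\<rparr>) \<Gamma> induced"
proof (rule group_actionI)
  show "group (P\<lparr>carrier := normalizing\<rparr>)"
    using normalizing_subgroup by (rule subgroup_imp_group)
  show "induced g x \<in> \<Gamma>" if "g \<in> carrier (P\<lparr>carrier := normalizing\<rparr>)" "x \<in> \<Gamma>" for g x
    using that \<Gamma>_\<Omega> normalizing_G by (simp add: induced_def proj_\<Gamma>)
  show "induced g \<in> extensional \<Gamma>" for g by (simp add: induced_def)
  show "induced \<one>\<^bsub>P\<lparr>carrier := normalizing\<rparr>\<^esub> x = x" if "x \<in> \<Gamma>" for x
    using that \<Gamma>_\<Omega> by (simp add: induced_def proj_id)
  show "induced (g \<otimes>\<^bsub>P\<lparr>carrier := normalizing\<rparr>\<^esub> h) x = induced g (induced h x)"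
    if "g \<in> carrier (P\<lparr>carrier := normalizing\<rparr>)" "h \<in> carrier (P\<lparr>carrier := normalizing\<rparr>)" "x \<in> \<Gamma>" for g h x
    using that \<Gamma>_\<Omega> normalizing_G proj_normalizing[of "h x" g]
    by (simp add: induced_def proj_\<Gamma> act_mult)
qed

section \<open>The permutation group \<open>H\<close> on \<open>\<Gamma>\<close>\<close>

lemma H_permutation_group: "permutation_group \<Gamma> H (perm_grp \<Gamma> H)"
proof (rule permutation_group.intro)
  show "subgroup H (BijGroup \<Gamma>)"
    using group_hom.img_is_subgroup[OF group_action.group_hom[OF induced_action]]
    by (simp add: H_def)
qed simp

sublocale Hp: permutation_group \<Gamma> H "perm_grp \<Gamma> H"
  by (rule H_permutation_group)

lemma induced_mult:
  "\<lbrakk>g \<in> normalizing; h \<in> normalizing\<rbrakk> \<Longrightarrow> induced (g \<otimes> h) = induced g \<otimes>\<^bsub>perm_grp \<Gamma> H\<^esub> induced h"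
  using group_hom.hom_mult[OF group_action.group_hom[OF induced_action], of g h] by simp

lemma induced_H: "n \<in> normalizing \<Longrightarrow> induced n \<in> H"
  by (simp add: H_def)

lemma induced_hom: "group_hom (P\<lparr>carrier := normalizing\<rparr>) (perm_grp \<Gamma> H) induced"
  unfolding group_hom_def group_hom_axioms_def
  using normalizing_subgroup subgroup_imp_group Hp.is_group induced_mult induced_H
  by (auto simp: hom_def)

lemma induced_one: "induced \<one> = \<one>\<^bsub>perm_grp \<Gamma> H\<^esub>"
  using group_hom.hom_one[OF induced_hom] by simp

lemma L_normalizing: "l \<in> L \<Longrightarrow> l \<in> normalizing"
  using L_M M_normalizing by blast

text \<open>Elements of \<open>Z\<close> preserve each \<open>Z\<close>-orbit. This freedom allows a
  stabilizing element of \<open>H\<close> to be lifted to a stabilizing element of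
  \<open>G\<close>.\<close>

lemma induced_Z_mult:
  assumes "z \<in> Z" "n \<in> normalizing"
  shows "induced (z \<otimes> n) = induced n"
  unfolding induced_def
  using assms proj_Z \<Gamma>_\<Omega> Z_G normalizing_G by (intro restrict_ext) (simp add: act_mult)

lemma H_transitive: "transitive_on \<Gamma> H"
  unfolding Hp.transitive_on_iff
proof (intro ballI)
  fix x y assume xy: "x \<in> \<Gamma>" "y \<in> \<Gamma>"
  then obtain l where l: "l \<in> L" "l x = y" using L_transitive_\<Gamma> by blast
  then have "induced l x = y" using induced_L xy by simp
  then show "\<exists>g\<in>H. g x = y" using induced_H[OF L_normalizing[OF l(1)]] by blast
qed

text \<open>The infinite group \<open>L\<close> is covered by products of one representative for
  each point of \<open>\<Gamma>\<close> with the finite stabilizer of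
  \<open>\<alpha>\<close>.\<close>

lemma \<Gamma>_infinite: "infinite \<Gamma>"
proof
  assume fin: "finite \<Gamma>"
  obtain r where r: "\<And>\<gamma>. \<gamma> \<in> \<Gamma> \<Longrightarrow> r \<gamma> \<in> L \<and> r \<gamma> \<alpha> = \<gamma>"
    using L_transitive_\<Gamma>[OF base_\<Gamma>] by metis
  have "L \<subseteq> (\<lambda>(\<gamma>, a). r \<gamma> \<otimes> a) ` (\<Gamma> \<times> point_stabilizer \<Omega> G \<alpha>)"
  proof
    fix l assume l: "l \<in> L"
    let ?r = "r (l \<alpha>)"
    have r': "?r \<in> L" "?r \<alpha> = l \<alpha>" "l \<alpha> \<in> \<Gamma>" using r[of "l \<alpha>"] l by (auto simp: \<Gamma>_def)
    then have G: "?r \<in> G" "l \<in> G" using l L_G by auto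
    have "(inv ?r \<otimes> l) \<alpha> = (inv ?r) (?r \<alpha>)" using G r'(2) by (simp add: act_mult)
    also have "\<dots> = \<alpha>" using G(1) base by (rule act_inv(1))
    finally have "inv ?r \<otimes> l \<in> point_stabilizer \<Omega> G \<alpha>" using G by simp
    moreover have "l = ?r \<otimes> (inv ?r \<otimes> l)" using G by (simp add: mult_inv_cancel)
    ultimately show "l \<in> (\<lambda>(\<gamma>, a). r \<gamma> \<otimes> a) ` (\<Gamma> \<times> point_stabilizer \<Omega> G \<alpha>)"
      using r'(3) by (intro image_eqI[of _ _ "(l \<alpha>, inv ?r \<otimes> l)"]) auto
  qed
  moreover have "finite ((\<lambda>(\<gamma>, a). r \<gamma> \<otimes> a) ` (\<Gamma> \<times> point_stabilizer \<Omega> G \<alpha>))"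
    using fin finite_stabilizer by simp
  ultimately show False using L_infinite finite_subset by metis
qed

lemma H_infinite: "infinite H"
proof
  assume "finite H"
  then have "finite ((\<lambda>h. h \<alpha>) ` H)" by simp
  moreover have "\<Gamma> \<subseteq> (\<lambda>h. h \<alpha>) ` H"
  proof
    fix \<gamma> assume "\<gamma> \<in> \<Gamma>"
    then obtain h where "h \<in> H" "h \<alpha> = \<gamma>"
      using H_transitive base_\<Gamma> unfolding Hp.transitive_on_iff by blast
    then show "\<gamma> \<in> (\<lambda>h. h \<alpha>) ` H" by blast
  qed
  ultimately show False using \<Gamma>_infinite finite_subset by metis
qed

text \<open>If the permutation induced by \<open>n\<close> fixes \<open>\<alpha>\<close>, some
  \<open>z \<in> Z\<close> takes \<open>n \<alpha>\<close> back to \<open>\<alpha>\<close>. Then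
  \<open>z \<otimes> n\<close> fixes \<open>\<alpha>\<close> and induces the same
  permutation.\<close>

lemma H_finite_stabilizer: "finite (point_stabilizer \<Gamma> H \<alpha>)"
proof (rule finite_subset)
  show "finite (induced ` point_stabilizer \<Omega> G \<alpha>)" using finite_stabilizer by simp
  show "point_stabilizer \<Gamma> H \<alpha> \<subseteq> induced ` point_stabilizer \<Omega> G \<alpha>"
  proof
    fix h assume "h \<in> point_stabilizer \<Gamma> H \<alpha>"
    then obtain n where n: "n \<in> normalizing" "h = induced n" "h \<alpha> = \<alpha>"
      by (auto simp: H_def)
    then have nG: "n \<in> G" using normalizing_G by blast
    have "proj (n \<alpha>) = \<alpha>" using n base_\<Gamma> by (simp add: induced_def)
    then obtain z where z: "z \<in> Z" "z (n \<alpha>) = \<alpha>" using nG by (metis proj_cases act_closed base)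
    then have "z \<otimes> n \<in> point_stabilizer \<Omega> G \<alpha>" using nG Z_G by (simp add: act_mult)
    moreover have "induced (z \<otimes> n) = h"
      using induced_Z_mult[OF z(1) n(1)] n(2) by simp
    ultimately show "h \<in> induced ` point_stabilizer \<Omega> G \<alpha>" by blast
  qed
qed

text \<open>The kernel in the simple group \<open>L\<close> is trivial or everything. In the second
  case the transitive action of \<open>L\<close> would live on a single point, although
  \<open>\<Gamma>\<close> is infinite.\<close>

lemma inj_on_induced_L: "inj_on induced L"
proof -
  interpret L: group "P\<lparr>carrier := L\<rparr>" by (rule subgroup_imp_group[OF L_subgroup])
  have hom: "group_hom (P\<lparr>carrier := L\<rparr>) (perm_grp \<Gamma> H) induced"
    unfolding group_hom_def group_hom_axioms_def
    using L.is_group Hp.is_group induced_mult induced_H L_normalizing by (auto simp: hom_def)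
  let ?K = "kernel (P\<lparr>carrier := L\<rparr>) (perm_grp \<Gamma> H) induced"
  have "?K \<noteq> L"
  proof
    assume K: "?K = L"
    have "\<gamma> = \<alpha>" if \<gamma>: "\<gamma> \<in> \<Gamma>" for \<gamma>
    proof -
      obtain l where l: "l \<in> L" "l \<alpha> = \<gamma>" using L_transitive_\<Gamma>[OF base_\<Gamma> \<gamma>] by blast
      then have "l \<in> ?K" using K by simp
      then have "induced l = induced \<one>" using induced_one by (simp add: kernel_def)
      then have "l \<alpha> = \<one> \<alpha>"
        using induced_L[OF l(1) base_\<Gamma>] induced_L[OF L_closed(1) base_\<Gamma>] by simp
      then show ?thesis using l by simp
    qed
    then have "\<Gamma> \<subseteq> {\<alpha>}" by blast
    then show False using \<Gamma>_infinite finite_subset by blast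
  qed
  then have "?K = {\<one>\<^bsub>P\<lparr>carrier := L\<rparr>\<^esub>}"
    using group_hom.normal_kernel[OF hom] L_simple unfolding simple_grp_def by fastforce
  then show ?thesis using group_hom.inj_iff_trivial_ker[OF hom] by simp
qed

text \<open>\<open>L\<close> is normal in \<open>normalizing\<close>, and \<open>induced\<close>
  maps that group homomorphically onto \<open>H\<close>.\<close>

lemma N_normal: "N \<lhd> perm_grp \<Gamma> H"
  unfolding Hp.normal_iff_conjugate
proof (intro conjI ballI)
  interpret hom: group_hom "P\<lparr>carrier := normalizing\<rparr>" "perm_grp \<Gamma> H" induced by (rule induced_hom)
  have "subgroup L (P\<lparr>carrier := normalizing\<rparr>)"
    using L_subgroup normalizing_subgroup L_normalizing by (intro subgroup_incl) auto
  then show "subgroup N (perm_grp \<Gamma> H)"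
    unfolding N_def by (rule hom.subgroup_img_is_subgroup)
  fix h x assume "h \<in> carrier (perm_grp \<Gamma> H)" "x \<in> N"
  then obtain n l where nl: "n \<in> normalizing" "h = induced n" "l \<in> L" "x = induced l"
    by (auto simp: H_def N_def)
  have inv: "inv n \<in> normalizing"
    using nl(1) normalizing_subgroup by (simp add: subgroup.m_inv_closed)
  have "induced n \<otimes>\<^bsub>perm_grp \<Gamma> H\<^esub> induced (inv n) = \<one>\<^bsub>perm_grp \<Gamma> H\<^esub>"
    using induced_mult[OF nl(1) inv] induced_one nl(1) normalizing_G by simp
  then have "induced (inv n) = inv\<^bsub>perm_grp \<Gamma> H\<^esub> h"
    using Hp.inv_equality[of "induced (inv n)" h] Hp.inv_unique' induced_H nl inv
    by (metis Hp.carrier_P Hp.inv_inv Hp.inv_equality Hp.inv_closed)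
  moreover have "conjugate n l = (n \<otimes> l) \<otimes> inv n" by (simp add: conjugate_def)
  ultimately have "induced (conjugate n l) = Hp.conjugate h x"
    using nl inv L_normalizing subgroup.m_closed[OF normalizing_subgroup]
    by (simp add: Hp.conjugate_def induced_mult)
  moreover have "conjugate n l \<in> L" using nl by (auto simp: normalizing_def)
  ultimately show "Hp.conjugate h x \<in> N" unfolding N_def by (metis imageI)
qed

lemma N_iso: "perm_grp \<Omega> L \<cong> perm_grp \<Gamma> N"
proof -
  have "induced \<in> iso (P\<lparr>carrier := L\<rparr>) (perm_grp \<Gamma> N)"
    using inj_on_induced_L induced_mult L_normalizing
    by (auto simp: iso_def hom_def bij_betw_def N_def)
  then show ?thesis unfolding is_iso_def P_restrict by blast
qed

lemma N_simple: "simple_grp (perm_grp \<Gamma> N)"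
proof (rule simple_grp_iso[OF _ _ N_iso])
  show "simple_grp (perm_grp \<Omega> L)" using L_simple by (simp add: P_restrict)
  show "group (perm_grp \<Gamma> N)"
    using Hp.subgroup_imp_group[OF normal_imp_subgroup[OF N_normal]] by simp
qed

end

section \<open>The product action\<close>

lemma group_wreath_Sym:
  assumes "group H"
  shows "group (wreath_Sym H \<Delta>)"
proof -
  interpret H: group H by fact
  interpret S: group "BijGroup \<Delta>" by (rule group_BijGroup)
  have pc: "\<sigma> i \<in> \<Delta>" if "\<sigma> \<in> carrier (BijGroup \<Delta>)" "i \<in> \<Delta>" for \<sigma> i
    using that by (auto simp: BijGroup_def Bij_def bij_betw_def)
  have pm: "(\<sigma> \<otimes>\<^bsub>BijGroup \<Delta>\<^esub> \<tau>) i = \<sigma> (\<tau> i)"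
    if "\<sigma> \<in> carrier (BijGroup \<Delta>)" "\<tau> \<in> carrier (BijGroup \<Delta>)" "i \<in> \<Delta>" for \<sigma> \<tau> i
    using that by (simp add: BijGroup_def compose_def)
  have p1: "\<one>\<^bsub>BijGroup \<Delta>\<^esub> i = i" if "i \<in> \<Delta>" for i
    using that by (simp add: BijGroup_def)
  have pinv: "\<sigma> ((inv\<^bsub>BijGroup \<Delta>\<^esub> \<sigma>) i) = i" if "\<sigma> \<in> carrier (BijGroup \<Delta>)" "i \<in> \<Delta>" for \<sigma> i
    using pm[of \<sigma> "inv\<^bsub>BijGroup \<Delta>\<^esub> \<sigma>" i] that p1 by simp
  have mult: "(h, \<sigma>) \<otimes>\<^bsub>wreath_Sym H \<Delta>\<^esub> (k, \<tau>) =
      (\<lambda>i\<in>\<Delta>. h i \<otimes>\<^bsub>H\<^esub> k ((inv\<^bsub>BijGroup \<Delta>\<^esub> \<sigma>) i), \<sigma> \<otimes>\<^bsub>BijGroup \<Delta>\<^esub> \<tau>)" for h \<sigma> k \<tau>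
    by (auto simp: wreath_Sym_def cong: restrict_cong)
  have one: "\<one>\<^bsub>wreath_Sym H \<Delta>\<^esub> = (\<lambda>i\<in>\<Delta>. \<one>\<^bsub>H\<^esub>, \<one>\<^bsub>BijGroup \<Delta>\<^esub>)"
    by (simp add: wreath_Sym_def)
  have carrier: "carrier (wreath_Sym H \<Delta>) = (\<Delta> \<rightarrow>\<^sub>E carrier H) \<times> carrier (BijGroup \<Delta>)"
    by (simp add: wreath_Sym_def)
  show ?thesis
  proof (rule groupI)
    fix x y assume "x \<in> carrier (wreath_Sym H \<Delta>)" "y \<in> carrier (wreath_Sym H \<Delta>)"
    then show "x \<otimes>\<^bsub>wreath_Sym H \<Delta>\<^esub> y \<in> carrier (wreath_Sym H \<Delta>)"
      by (auto simp: carrier mult PiE_iff pc)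
  next
    show "\<one>\<^bsub>wreath_Sym H \<Delta>\<^esub> \<in> carrier (wreath_Sym H \<Delta>)"
      by (simp add: carrier one)
  next
    fix x y z assume xyz: "x \<in> carrier (wreath_Sym H \<Delta>)" "y \<in> carrier (wreath_Sym H \<Delta>)"
      "z \<in> carrier (wreath_Sym H \<Delta>)"
    obtain h \<sigma> k \<tau> l \<rho> where eq: "x = (h, \<sigma>)" "y = (k, \<tau>)" "z = (l, \<rho>)" by (metis surj_pair)
    have c: "h \<in> \<Delta> \<rightarrow>\<^sub>E carrier H" "k \<in> \<Delta> \<rightarrow>\<^sub>E carrier H" "l \<in> \<Delta> \<rightarrow>\<^sub>E carrier H"
      "\<sigma> \<in> carrier (BijGroup \<Delta>)" "\<tau> \<in> carrier (BijGroup \<Delta>)" "\<rho> \<in> carrier (BijGroup \<Delta>)"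
      using xyz by (auto simp: eq carrier)
    then show "x \<otimes>\<^bsub>wreath_Sym H \<Delta>\<^esub> y \<otimes>\<^bsub>wreath_Sym H \<Delta>\<^esub> z =
        x \<otimes>\<^bsub>wreath_Sym H \<Delta>\<^esub> (y \<otimes>\<^bsub>wreath_Sym H \<Delta>\<^esub> z)"
      by (auto simp: eq mult S.m_assoc S.inv_mult_group pm pc PiE_iff H.m_assoc intro!: restrict_ext)
  next
    fix x assume x: "x \<in> carrier (wreath_Sym H \<Delta>)"
    obtain h \<sigma> where eq: "x = (h, \<sigma>)" by (metis surj_pair)
    have c: "h \<in> \<Delta> \<rightarrow>\<^sub>E carrier H" "\<sigma> \<in> carrier (BijGroup \<Delta>)"
      using x by (auto simp: eq carrier)
    have "(\<lambda>i\<in>\<Delta>. (\<lambda>i\<in>\<Delta>. \<one>\<^bsub>H\<^esub>) i \<otimes>\<^bsub>H\<^esub> h ((inv\<^bsub>BijGroup \<Delta>\<^esub> \<one>\<^bsub>BijGroup \<Delta>\<^esub>) i)) = h"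
      using c by (intro extensionalityI[of _ \<Delta>]) (auto simp: PiE_iff p1)
    then show "\<one>\<^bsub>wreath_Sym H \<Delta>\<^esub> \<otimes>\<^bsub>wreath_Sym H \<Delta>\<^esub> x = x"
      using c by (simp add: one eq mult)
    \<comment> \<open>The permutation part of \<open>?y\<close> is the inverse of
      \<open>\<sigma>\<close>, so in the product its \<open>i\<close>-th coordinate meets
      \<open>h (\<sigma> i)\<close> and has to be the inverse of that element.\<close>
    let ?y = "(\<lambda>i\<in>\<Delta>. inv\<^bsub>H\<^esub> h (\<sigma> i), inv\<^bsub>BijGroup \<Delta>\<^esub> \<sigma>)"
    have "?y \<in> carrier (wreath_Sym H \<Delta>)"
      using c by (auto simp: carrier PiE_iff pc)
    moreover have "?y \<otimes>\<^bsub>wreath_Sym H \<Delta>\<^esub> x = \<one>\<^bsub>wreath_Sym H \<Delta>\<^esub>"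
      using c by (auto simp: one eq mult PiE_iff pc intro!: restrict_ext)
    ultimately show "\<exists>y\<in>carrier (wreath_Sym H \<Delta>). y \<otimes>\<^bsub>wreath_Sym H \<Delta>\<^esub> x = \<one>\<^bsub>wreath_Sym H \<Delta>\<^esub>"
      by blast
  qed
qed

text \<open>Since \<open>\<theta>\<close> is bijective, the equation determines
  \<open>\<psi> g\<close> as the transport of \<open>g\<close> along \<open>\<theta>\<close>. So
  \<open>\<psi>\<close> is automatically an injective homomorphism.\<close>

lemma (in permutation_group) permutation_isomorphic_if_equivariant:
  assumes bij: "bij_betw \<theta> \<Omega> \<Omega>'"
    and ext: "\<And>g. g \<in> G \<Longrightarrow> \<psi> g \<in> extensional \<Omega>'"
    and eq: "\<And>g \<omega>. \<lbrakk>g \<in> G; \<omega> \<in> \<Omega>\<rbrakk> \<Longrightarrow> \<psi> g (\<theta> \<omega>) = \<theta> (g \<omega>)"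
  shows "permutation_isomorphic \<Omega> G \<Omega>' (\<psi> ` G)"
proof -
  have img: "\<theta> ` \<Omega> = \<Omega>'" and inj: "inj_on \<theta> \<Omega>" using bij by (auto simp: bij_betw_def)
  have \<psi>eq: "\<psi> g x = \<theta> (g (inv_into \<Omega> \<theta> x))" if "g \<in> G" "x \<in> \<Omega>'" for g x
    using that eq[of g "inv_into \<Omega> \<theta> x"] img by (simp add: inv_into_into f_inv_into_f)
  have act: "group_action P \<Omega>' \<psi>"
  proof (rule group_actionI)
    show "group P" by (rule is_group)
    show "\<psi> g x \<in> \<Omega>'" if "g \<in> carrier P" "x \<in> \<Omega>'" for g x
      using that img inv_into_into[of x \<theta> \<Omega>] by (auto simp: \<psi>eq)
    show "\<psi> g \<in> extensional \<Omega>'" if "g \<in> carrier P" for g using that ext by simp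
    show "\<psi> \<one> x = x" if "x \<in> \<Omega>'" for x
      using that img by (simp add: \<psi>eq inv_into_into f_inv_into_f)
    show "\<psi> (g \<otimes> h) x = \<psi> g (\<psi> h x)" if "g \<in> carrier P" "h \<in> carrier P" "x \<in> \<Omega>'" for g h x
      using that img inj inv_into_into[of x \<theta> \<Omega>]
      by (simp add: \<psi>eq[of _ x] eq act_mult)
  qed
  have "inj_on \<psi> G"
  proof (rule inj_onI)
    fix g h assume gh: "g \<in> G" "h \<in> G" "\<psi> g = \<psi> h"
    show "g = h"
    proof (rule act_ext[OF gh(1,2)])
      fix \<omega> assume \<omega>: "\<omega> \<in> \<Omega>"
      then have "\<theta> (g \<omega>) = \<theta> (h \<omega>)" using eq[of g \<omega>] eq[of h \<omega>] gh by simp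
      then show "g \<omega> = h \<omega>" using inj_onD[OF inj] \<omega> gh by simp
    qed
  qed
  moreover have "\<psi> (g \<otimes>\<^bsub>perm_grp \<Omega> G\<^esub> h) = \<psi> g \<otimes>\<^bsub>perm_grp \<Omega>' (\<psi> ` G)\<^esub> \<psi> h" if "g \<in> G" "h \<in> G" for g h
    using group_hom.hom_mult[OF group_action.group_hom[OF act], of g h] that P_eq by simp
  ultimately have "\<psi> \<in> iso (perm_grp \<Omega> G) (perm_grp \<Omega>' (\<psi> ` G))"
    by (auto simp: iso_def hom_def bij_betw_def)
  moreover have "\<forall>\<omega>\<in>\<Omega>. \<forall>g\<in>G. \<theta> (g \<omega>) = \<psi> g (\<theta> \<omega>)" using eq by simp
  ultimately show ?thesis unfolding permutation_isomorphic_def using bij by blast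
qed

section \<open>Coordinates indexed by the components\<close>

locale indexed_components =
  primitive_component \<Omega> G P \<alpha> M L
  for \<Omega> :: "'a set" and G and P (structure) and \<alpha> M L +
  fixes \<Delta> :: "'i set" and C :: "'i \<Rightarrow> ('a \<Rightarrow> 'a) set" and t :: "'i \<Rightarrow> 'a \<Rightarrow> 'a"
  assumes C_bij: "bij_betw C \<Delta> comps"
    and t_A: "i \<in> \<Delta> \<Longrightarrow> t i \<in> point_stabilizer \<Omega> G \<alpha>"
    and t_C: "i \<in> \<Delta> \<Longrightarrow> conjugate (t i) ` L = C i"
begin

definition "index_perm g = (\<lambda>i\<in>\<Delta>. inv_into \<Delta> C (conjugate g ` C i))"

text \<open>With \<open>j\<close> the index that \<open>g\<close> sends to \<open>i\<close>, this
  element takes \<open>L\<close> to \<open>C j\<close> by \<open>t j\<close>, on to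
  \<open>C i\<close> by \<open>g\<close>, and back to \<open>L\<close>. It is the cocycle of the
  usual embedding of an induced action in a wreath product.\<close>

definition "twist g i = inv (t i) \<otimes> g \<otimes> t (index_perm (inv g) i)"

definition "to_wreath g = (\<lambda>i\<in>\<Delta>. induced (twist g i), index_perm g)"

text \<open>The inverse of \<open>t i\<close> takes \<open>C i\<close> to \<open>L\<close>, and so
  the orbits of \<open>others (C i)\<close> to the \<open>Z\<close>-orbits. The \<open>i\<close>-th
  coordinate thus names the orbit of \<open>\<omega>\<close> under
  \<open>others (C i)\<close>.\<close>

definition "coords \<omega> = (\<lambda>i\<in>\<Delta>. proj ((inv (t i)) \<omega>))"

lemma \<Delta>_finite: "finite \<Delta>"
  using bij_betw_finite[OF C_bij] comps_finite by simp

lemma C_comps: "i \<in> \<Delta> \<Longrightarrow> C i \<in> comps"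
  using C_bij by (auto simp: bij_betw_def)

lemma t_G: "i \<in> \<Delta> \<Longrightarrow> t i \<in> G"
  using t_A by simp

lemma \<Delta>_nonempty: "\<Delta> \<noteq> {}"
  using C_bij L_comps by (auto simp: bij_betw_def)

lemma index_perm:
  assumes "g \<in> G" "i \<in> \<Delta>"
  shows "index_perm g i \<in> \<Delta>" "C (index_perm g i) = conjugate g ` C i"
proof -
  have "conjugate g ` C i \<in> C ` \<Delta>"
    using C_bij comps_conjugate[OF _ C_comps[OF assms(2)], of g] assms(1) by (simp add: bij_betw_def)
  then show "index_perm g i \<in> \<Delta>" "C (index_perm g i) = conjugate g ` C i"
    using assms(2) by (simp_all add: index_perm_def inv_into_into f_inv_into_f)
qed

lemma C_inj: "\<lbrakk>i \<in> \<Delta>; j \<in> \<Delta>; C i = C j\<rbrakk> \<Longrightarrow> i = j"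
  using C_bij by (auto simp: bij_betw_def inj_on_def)

lemma index_perm_action: "group_action P \<Delta> index_perm"
proof (rule group_actionI)
  show "group P" by (rule is_group)
  show "index_perm g i \<in> \<Delta>" if "g \<in> carrier P" "i \<in> \<Delta>" for g i
    using that by (simp add: index_perm)
  show "index_perm g \<in> extensional \<Delta>" for g by (simp add: index_perm_def)
  show "index_perm \<one> i = i" if "i \<in> \<Delta>" for i
    using that comps_carrier[OF C_comps[OF that]]
    by (intro C_inj) (simp_all add: index_perm one_conjugate_image)
  show "index_perm (g \<otimes> h) i = index_perm g (index_perm h i)"
    if "g \<in> carrier P" "h \<in> carrier P" "i \<in> \<Delta>" for g h i
    using that comps_carrier[OF C_comps[OF that(3)]]
    by (intro C_inj) (simp_all add: index_perm conjugate_image_image)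
qed

lemma index_perm_mult:
  "\<lbrakk>g \<in> G; h \<in> G; i \<in> \<Delta>\<rbrakk> \<Longrightarrow> index_perm (g \<otimes> h) i = index_perm g (index_perm h i)"
  using group_action.composition_rule[OF index_perm_action] by simp

lemma index_perm_inv: "g \<in> G \<Longrightarrow> inv\<^bsub>BijGroup \<Delta>\<^esub> (index_perm g) = index_perm (inv g)"
  using group_hom.hom_inv[OF group_action.group_hom[OF index_perm_action], of g] by simp

lemma twist_normalizing:
  assumes "g \<in> G" "i \<in> \<Delta>"
  shows "twist g i \<in> normalizing"
proof -
  let ?j = "index_perm (inv g) i"
  have j: "?j \<in> \<Delta>" "C ?j = conjugate (inv g) ` C i" using index_perm[of "inv g" i] assms by simp_all
  have Cc: "C i \<subseteq> carrier P" using comps_carrier C_comps assms by blast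
  have "conjugate (twist g i) ` L = conjugate (inv (t i)) ` conjugate g ` conjugate (t ?j) ` L"
    using assms j t_G L_carrier by (simp add: twist_def conjugate_image_image m_assoc)
  also have "\<dots> = conjugate (inv (t i)) ` conjugate g ` conjugate (inv g) ` C i"
    using t_C[OF j(1)] j(2) by simp
  also have "\<dots> = conjugate (inv (t i)) ` C i"
    using conjugate_image_cancel(2)[of g "C i"] assms(1) Cc by simp
  also have "\<dots> = L"
    using t_C[OF assms(2)] conjugate_image_cancel(1)[of "t i" L] t_G[OF assms(2)] L_carrier by simp
  finally show ?thesis
    using assms j t_G by (simp add: normalizing_def twist_def)
qed

text \<open>The cocycle identity: the factor from \<open>t\<close> that ends the first twist cancels
  against the inverse that begins the second.\<close>

lemma twist_mult:
  assumes "g \<in> G" "h \<in> G" "i \<in> \<Delta>"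
  shows "twist (g \<otimes> h) i = twist g i \<otimes> twist h (index_perm (inv g) i)"
proof -
  have j: "index_perm (inv g) i \<in> \<Delta>" using index_perm[of "inv g" i] assms by simp
  have "index_perm (inv (g \<otimes> h)) i = index_perm (inv h) (index_perm (inv g) i)"
    using assms by (simp add: inv_mult_group index_perm_mult)
  moreover have "t (index_perm (inv h) (index_perm (inv g) i)) \<in> G"
    using index_perm(1)[of "inv h" "index_perm (inv g) i"] j assms t_G by simp
  ultimately show ?thesis
    using assms j t_G unfolding twist_def by (simp add: word_simps)
qed

lemma coords_equivariant:
  assumes "g \<in> G" "\<omega> \<in> \<Omega>" "i \<in> \<Delta>"
  shows "coords (g \<omega>) i = induced (twist g i) (coords \<omega> (index_perm (inv g) i))"
proof -
  let ?j = "index_perm (inv g) i"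
  have j: "?j \<in> \<Delta>" using index_perm[of "inv g" i] assms by simp
  have "(twist g i) ((inv (t ?j)) \<omega>) = (inv (t i)) (g \<omega>)"
    using assms j t_G by (simp add: twist_def act_mult)
  moreover have "induced (twist g i) (proj ((inv (t ?j)) \<omega>)) = proj ((twist g i) ((inv (t ?j)) \<omega>))"
    using assms j t_G twist_normalizing by (intro induced_proj) simp_all
  ultimately show ?thesis using assms j by (simp add: coords_def)
qed

lemma coords_PiE: "\<omega> \<in> \<Omega> \<Longrightarrow> coords \<omega> \<in> \<Delta> \<rightarrow>\<^sub>E \<Gamma>"
  using t_G by (auto simp: coords_def intro!: proj_\<Gamma>)

text \<open>Coordinates are corrected one index at a time. By transitivity of \<open>L\<close> on
  \<open>\<Gamma>\<close>, an element of \<open>C j\<close> can give the \<open>j\<close>-th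
  coordinate any value; it keeps the other coordinates because it lies in
  \<open>others (C i)\<close> for \<open>i \<noteq> j\<close>.\<close>

lemma coords_surj:
  assumes \<delta>: "\<delta> \<in> \<Delta> \<rightarrow>\<^sub>E \<Gamma>"
  shows "\<exists>\<omega>\<in>\<Omega>. coords \<omega> = \<delta>"
proof -
  have "\<exists>\<omega>\<in>\<Omega>. \<forall>i\<in>J. proj ((inv (t i)) \<omega>) = \<delta> i" if "finite J" "J \<subseteq> \<Delta>" for J
    using that
  proof (induction J)
    case empty
    then show ?case using base by blast
  next
    case (insert j J)
    then obtain \<omega> where \<omega>: "\<omega> \<in> \<Omega>" "\<forall>i\<in>J. proj ((inv (t i)) \<omega>) = \<delta> i" by blast
    have j: "j \<in> \<Delta>" "t j \<in> G" using insert.prems t_G by auto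
    have "proj ((inv (t j)) \<omega>) \<in> \<Gamma>" "\<delta> j \<in> \<Gamma>"
      using \<omega> j \<delta> by (auto intro: proj_\<Gamma>)
    then obtain l where l: "l \<in> L" "l (proj ((inv (t j)) \<omega>)) = \<delta> j"
      using L_transitive_\<Gamma> by blast
    have lG: "l \<in> G" using l L_G by blast
    define x where "x = conjugate (t j) l"
    have xG: "x \<in> G" unfolding x_def using conjugate_closed[of "t j" l] j lG by simp
    have xC: "x \<in> C j" using l(1) t_C[OF j(1)] unfolding x_def by blast
    have "proj ((inv (t i)) (x \<omega>)) = \<delta> i" if i: "i \<in> insert j J" for i
    proof (cases "i = j")
      case True
      have "(inv (t j)) (x \<omega>) = l ((inv (t j)) \<omega>)"
        using \<omega>(1) j lG by (simp add: x_def conjugate_def act_mult)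
      then show ?thesis using True l \<omega>(1) j proj_L by simp
    next
      case False
      then have iJ: "i \<in> J" "i \<in> \<Delta>" "t i \<in> G" using i insert.prems t_G by auto
      have "C j \<noteq> C i" using C_inj False iJ j by blast
      then have "x \<in> others (C i)"
        using comps_others[OF C_comps[OF j(1)]] xC by blast
      then have "conjugate (inv (t i)) x \<in> others (conjugate (inv (t i)) ` C i)"
        using iJ C_comps by (intro others_conjugate) simp_all
      moreover have "conjugate (inv (t i)) ` C i = L"
        using t_C[OF iJ(2)] conjugate_image_cancel(1)[of "t i" L] iJ(3) L_carrier by simp
      ultimately have z: "conjugate (inv (t i)) x \<in> Z" by simp
      have "(inv (t i)) (x \<omega>) = (conjugate (inv (t i)) x) ((inv (t i)) \<omega>)"
        using \<omega>(1) iJ xG by (simp add: conjugate_def act_mult)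
      then show ?thesis using proj_Z[OF _ z] \<omega> iJ by simp
    qed
    moreover have "x \<omega> \<in> \<Omega>" using xG \<omega>(1) by simp
    ultimately show ?case by blast
  qed
  from this[OF \<Delta>_finite subset_refl] obtain \<omega> where \<omega>: "\<omega> \<in> \<Omega>" "\<forall>i\<in>\<Delta>. proj ((inv (t i)) \<omega>) = \<delta> i"
    by blast
  then have "coords \<omega> = \<delta>"
    using \<delta> by (intro extensionalityI[of _ \<Delta>]) (auto simp: coords_def PiE_iff)
  with \<omega> show ?thesis by blast
qed

text \<open>\<open>G\<close> permutes the coordinates and acts on them through \<open>H\<close>, so
  requiring \<open>R\<close> in all coordinates is \<open>G\<close>-invariant and primitivity of
  \<open>G\<close> applies. Equality as \<open>R\<close> will give injectivity of
  \<open>coords\<close>, an arbitrary \<open>R\<close> primitivity of \<open>H\<close>.\<close>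

lemma coords_relation_cases:
  assumes refl: "\<And>x. x \<in> \<Gamma> \<Longrightarrow> R x x"
    and sym: "\<And>x y. \<lbrakk>x \<in> \<Gamma>; y \<in> \<Gamma>; R x y\<rbrakk> \<Longrightarrow> R y x"
    and trans: "\<And>x y z. \<lbrakk>x \<in> \<Gamma>; y \<in> \<Gamma>; z \<in> \<Gamma>; R x y; R y z\<rbrakk> \<Longrightarrow> R x z"
    and inv: "\<And>h x y. \<lbrakk>h \<in> H; x \<in> \<Gamma>; y \<in> \<Gamma>; R x y\<rbrakk> \<Longrightarrow> R (h x) (h y)"
  defines "R' \<equiv> \<lambda>x y. \<forall>i\<in>\<Delta>. R (coords x i) (coords y i)"
  shows "(\<forall>x\<in>\<Omega>. \<forall>y\<in>\<Omega>. R' x y \<longrightarrow> x = y) \<or> (\<forall>x\<in>\<Omega>. \<forall>y\<in>\<Omega>. R' x y)"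
proof (rule primitive_onD[OF primitive])
  have \<Gamma>: "coords x i \<in> \<Gamma>" if "x \<in> \<Omega>" "i \<in> \<Delta>" for x i
    using coords_PiE[OF that(1)] that(2) by blast
  show "invariant_equivalence R'"
    unfolding invariant_equivalence_def R'_def
  proof (intro conjI ballI impI)
    show "R (coords x i) (coords x i)" if "x \<in> \<Omega>" "i \<in> \<Delta>" for x i
      using that \<Gamma> refl by blast
    show "R (coords y i) (coords x i)"
      if "x \<in> \<Omega>" "y \<in> \<Omega>" "\<forall>i\<in>\<Delta>. R (coords x i) (coords y i)" "i \<in> \<Delta>" for x y i
      using that \<Gamma> sym by blast
    show "R (coords x i) (coords z i)"
      if "x \<in> \<Omega>" "y \<in> \<Omega>" "z \<in> \<Omega>" "\<forall>i\<in>\<Delta>. R (coords x i) (coords y i)"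
        "\<forall>i\<in>\<Delta>. R (coords y i) (coords z i)" "i \<in> \<Delta>" for x y z i
      using that \<Gamma> trans[of "coords x i" "coords y i" "coords z i"] by blast
    show "R (coords (g x) i) (coords (g y) i)"
      if "g \<in> G" "x \<in> \<Omega>" "y \<in> \<Omega>" "\<forall>i\<in>\<Delta>. R (coords x i) (coords y i)" "i \<in> \<Delta>" for g x y i
    proof -
      have "index_perm (inv g) i \<in> \<Delta>" using index_perm[of "inv g" i] that by simp
      then show ?thesis
        using that \<Gamma> inv[OF induced_H[OF twist_normalizing]] by (simp add: coords_equivariant)
    qed
  qed
qed

text \<open>Points of \<open>\<Gamma>\<close> are compared through points of \<open>\<Omega>\<close>
  with constant coordinates, which exist because \<open>coords\<close> is onto. Each alternative for
  the pulled-back relation then gives the same alternative for \<open>R\<close>.\<close>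

lemma H_primitive: "primitive_on \<Gamma> H"
proof (rule Hp.primitive_onI[OF H_transitive])
  show "\<Gamma> \<noteq> {}" using base_\<Gamma> by blast
  fix R assume R: "Hp.invariant_equivalence R"
  have const: "\<exists>\<omega>\<in>\<Omega>. \<forall>i\<in>\<Delta>. coords \<omega> i = \<gamma>" if \<gamma>: "\<gamma> \<in> \<Gamma>" for \<gamma>
  proof -
    obtain \<omega> where "\<omega> \<in> \<Omega>" "coords \<omega> = (\<lambda>i\<in>\<Delta>. \<gamma>)"
      using coords_surj[of "\<lambda>i\<in>\<Delta>. \<gamma>"] \<gamma> by auto
    then show ?thesis by (intro bexI[of _ \<omega>]) simp_all
  qed
  obtain i where i: "i \<in> \<Delta>" using \<Delta>_nonempty by blast
  from R consider
    "\<forall>x\<in>\<Omega>. \<forall>y\<in>\<Omega>. (\<forall>i\<in>\<Delta>. R (coords x i) (coords y i)) \<longrightarrow> x = y" |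
    "\<forall>x\<in>\<Omega>. \<forall>y\<in>\<Omega>. \<forall>i\<in>\<Delta>. R (coords x i) (coords y i)"
    using coords_relation_cases[of R] unfolding Hp.invariant_equivalence_def by blast
  then show "(\<forall>x\<in>\<Gamma>. \<forall>y\<in>\<Gamma>. R x y \<longrightarrow> x = y) \<or> (\<forall>x\<in>\<Gamma>. \<forall>y\<in>\<Gamma>. R x y)"
  proof cases
    case 1
    have "x = y" if xy: "x \<in> \<Gamma>" "y \<in> \<Gamma>" "R x y" for x y
    proof -
      obtain u where u: "u \<in> \<Omega>" "\<forall>i\<in>\<Delta>. coords u i = x" using const[OF xy(1)] by blast
      obtain v where v: "v \<in> \<Omega>" "\<forall>i\<in>\<Delta>. coords v i = y" using const[OF xy(2)] by blast
      have "u = v" using 1 u v xy(3) by simp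
      then show ?thesis using u v i by force
    qed
    then show ?thesis by blast
  next
    case 2
    have "R x y" if xy: "x \<in> \<Gamma>" "y \<in> \<Gamma>" for x y
    proof -
      obtain u where u: "u \<in> \<Omega>" "\<forall>i\<in>\<Delta>. coords u i = x" using const[OF xy(1)] by blast
      obtain v where v: "v \<in> \<Omega>" "\<forall>i\<in>\<Delta>. coords v i = y" using const[OF xy(2)] by blast
      show ?thesis using 2 u v i by force
    qed
    then show ?thesis by blast
  qed
qed

text \<open>For equality the two alternatives are injectivity and equal coordinates for all points.
  The second fails because \<open>coords\<close> is onto and \<open>\<Gamma>\<close> is
  infinite.\<close>

lemma coords_bij: "bij_betw coords \<Omega> (\<Delta> \<rightarrow>\<^sub>E \<Gamma>)"
proof -
  have "\<not> (\<forall>x\<in>\<Omega>. \<forall>y\<in>\<Omega>. \<forall>i\<in>\<Delta>. coords x i = coords y i)"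
  proof
    assume *: "\<forall>x\<in>\<Omega>. \<forall>y\<in>\<Omega>. \<forall>i\<in>\<Delta>. coords x i = coords y i"
    obtain i where i: "i \<in> \<Delta>" using \<Delta>_nonempty by blast
    have "\<gamma> = coords \<alpha> i" if \<gamma>: "\<gamma> \<in> \<Gamma>" for \<gamma>
    proof -
      obtain \<omega> where \<omega>: "\<omega> \<in> \<Omega>" "coords \<omega> = (\<lambda>i\<in>\<Delta>. \<gamma>)"
        using coords_surj[of "\<lambda>i\<in>\<Delta>. \<gamma>"] \<gamma> by auto
      then have "coords \<omega> i = \<gamma>" using i by simp
      then show ?thesis using * \<omega>(1) i base by blast
    qed
    then have "\<Gamma> \<subseteq> {coords \<alpha> i}" by blast
    then show False using \<Gamma>_infinite finite_subset by blast
  qed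
  then have *: "\<forall>x\<in>\<Omega>. \<forall>y\<in>\<Omega>. (\<forall>i\<in>\<Delta>. coords x i = coords y i) \<longrightarrow> x = y"
    using coords_relation_cases[of "(=)"] by auto
  then have "inj_on coords \<Omega>" by (auto simp: inj_on_def)
  moreover have "coords ` \<Omega> = \<Delta> \<rightarrow>\<^sub>E \<Gamma>"
    using coords_PiE coords_surj by (auto simp: image_iff) blast
  ultimately show ?thesis by (simp add: bij_betw_def)
qed

section \<open>Embedding in the wreath product\<close>

lemma to_wreath_hom: "group_hom P (wreath_Sym (perm_grp \<Gamma> H) \<Delta>) to_wreath"
proof -
  have "to_wreath g \<in> carrier (wreath_Sym (perm_grp \<Gamma> H) \<Delta>)" if g: "g \<in> G" for g
  proof -
    have "index_perm g \<in> carrier (BijGroup \<Delta>)"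
      using group_hom.hom_closed[OF group_action.group_hom[OF index_perm_action], of g] g by simp
    then show ?thesis
      using induced_H[OF twist_normalizing[OF g]] by (simp add: to_wreath_def wreath_Sym_def)
  qed
  moreover have "to_wreath (g \<otimes> h) = to_wreath g \<otimes>\<^bsub>wreath_Sym (perm_grp \<Gamma> H) \<Delta>\<^esub> to_wreath h"
    if g: "g \<in> G" and h: "h \<in> G" for g h
  proof -
    have "index_perm (g \<otimes> h) = index_perm g \<otimes>\<^bsub>BijGroup \<Delta>\<^esub> index_perm h"
      using group_hom.hom_mult[OF group_action.group_hom[OF index_perm_action], of g h] g h by simp
    moreover have "induced (twist (g \<otimes> h) i) =
        induced (twist g i) \<otimes>\<^bsub>perm_grp \<Gamma> H\<^esub> induced (twist h (index_perm (inv g) i))"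
      and "index_perm (inv g) i \<in> \<Delta>" if i: "i \<in> \<Delta>" for i
    proof -
      show j: "index_perm (inv g) i \<in> \<Delta>" using index_perm[of "inv g" i] g i by simp
      show "induced (twist (g \<otimes> h) i) =
        induced (twist g i) \<otimes>\<^bsub>perm_grp \<Gamma> H\<^esub> induced (twist h (index_perm (inv g) i))"
        unfolding twist_mult[OF g h i]
        by (rule induced_mult[OF twist_normalizing[OF g i] twist_normalizing[OF h j]])
    qed
    ultimately show ?thesis
      using g by (auto simp: to_wreath_def wreath_Sym_def index_perm_inv intro!: restrict_ext)
  qed
  ultimately show ?thesis
    unfolding group_hom_def group_hom_axioms_def
    by (auto simp: hom_def is_group intro: group_wreath_Sym Hp.is_group)
qed

lemma to_wreath_image_subgroup: "subgroup (to_wreath ` G) (wreath_Sym (perm_grp \<Gamma> H) \<Delta>)"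
  using group_hom.img_is_subgroup[OF to_wreath_hom] by simp

lemma permutation_isomorphic_to_wreath:
  "permutation_isomorphic \<Omega> G (\<Delta> \<rightarrow>\<^sub>E \<Gamma>) (product_action \<Gamma> \<Delta> ` to_wreath ` G)"
  unfolding image_image
proof (rule permutation_isomorphic_if_equivariant[OF coords_bij])
  show "product_action \<Gamma> \<Delta> (to_wreath g) \<in> extensional (\<Delta> \<rightarrow>\<^sub>E \<Gamma>)" for g
    by (simp add: product_action_def to_wreath_def)
  fix g \<omega> assume g: "g \<in> G" and \<omega>: "\<omega> \<in> \<Omega>"
  have "product_action \<Gamma> \<Delta> (to_wreath g) (coords \<omega>) =
      (\<lambda>i\<in>\<Delta>. induced (twist g i) (coords \<omega> (index_perm (inv g) i)))"
    using coords_PiE[OF \<omega>] g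
    by (auto simp: product_action_def to_wreath_def index_perm_inv intro!: restrict_ext)
  also have "\<dots> = (\<lambda>i\<in>\<Delta>. coords (g \<omega>) i)"
    using coords_equivariant[OF g \<omega>] by (intro restrict_ext) simp
  also have "\<dots> = coords (g \<omega>)"
    by (intro extensionalityI[of _ \<Delta>]) (auto simp: coords_def)
  finally show "product_action \<Gamma> \<Delta> (to_wreath g) (coords \<omega>) = coords (g \<omega>)" .
qed

section \<open>The minimal normal subgroup of \<open>H\<close> and its regularity\<close>

lemma H_primitive_finite_stabilizer: "primitive_finite_stabilizer \<Gamma> H (perm_grp \<Gamma> H) \<alpha>"
  unfolding primitive_finite_stabilizer_def primitive_finite_stabilizer_axioms_def
  using H_permutation_group H_infinite H_primitive base_\<Gamma> H_finite_stabilizer by blast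

text \<open>The smallest non-trivial normal subgroup \<open>K\<close> of \<open>H\<close> is
  contained in \<open>N\<close> and normal in it, so simplicity of \<open>N\<close> leaves only
  \<open>K = N\<close>.\<close>

lemma N_unique_minimal_normal: "unique_minimal_normal N (perm_grp \<Gamma> H)"
proof -
  interpret Hpf: primitive_finite_stabilizer \<Gamma> H "perm_grp \<Gamma> H" \<alpha>
    by (rule H_primitive_finite_stabilizer)
  obtain K where K: "unique_minimal_normal K (perm_grp \<Gamma> H)"
    using Hpf.ex_unique_minimal_normal by blast
  interpret Hm: unique_minimal_normal_subgroup "perm_grp \<Gamma> H" "point_stabilizer \<Gamma> H \<alpha>" K
    by unfold_locales (rule K)
  have "N \<noteq> {\<one>\<^bsub>perm_grp \<Gamma> H\<^esub>}" using N_simple by (simp add: simple_grp_def)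
  then have "K \<subseteq> N" by (rule Hm.M_least[OF N_normal])
  then have "K \<lhd> (perm_grp \<Gamma> H)\<lparr>carrier := N\<rparr>"
    using Hp.normal_restrict_supergroup[OF normal_imp_subgroup[OF N_normal] Hm.M_normal] by blast
  then have "K = N"
    using N_simple Hm.M_nontrivial unfolding simple_grp_def by force
  then show ?thesis using K by simp
qed

lemma H_primitive_minimal_normal: "primitive_minimal_normal \<Gamma> H (perm_grp \<Gamma> H) \<alpha> N"
proof -
  interpret Hpf: primitive_finite_stabilizer \<Gamma> H "perm_grp \<Gamma> H" \<alpha>
    by (rule H_primitive_finite_stabilizer)
  show ?thesis
    by unfold_locales (rule N_unique_minimal_normal)
qed

text \<open>The two conditions say that \<open>\<alpha>\<close> has trivial stabilizer in
  \<open>L\<close> and in \<open>M\<close>. The \<open>L\<close>-coordinate of an element of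
  \<open>M\<close> fixing \<open>\<alpha>\<close> again fixes \<open>\<alpha>\<close>, and
  conjugation by the stabilizer in \<open>G\<close> carries this to the other components. So
  triviality in \<open>L\<close> makes all coordinates trivial.\<close>

lemma regular_N_iff: "regular_on \<Gamma> N \<longleftrightarrow> regular_on \<Omega> M"
proof -
  interpret Hm: primitive_minimal_normal \<Gamma> H "perm_grp \<Gamma> H" \<alpha> N
    by (rule H_primitive_minimal_normal)
  have stabN: "point_stabilizer \<Gamma> N \<alpha> = induced ` {l \<in> L. l \<alpha> = \<alpha>}"
    using induced_L base_\<Gamma> by (auto simp: stabilizer_def N_def)
  have "regular_on \<Gamma> N \<longleftrightarrow> induced ` {l \<in> L. l \<alpha> = \<alpha>} = induced ` {\<one>}"
    unfolding Hm.M_regular_iff stabN using induced_one by simp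
  also have "\<dots> \<longleftrightarrow> {l \<in> L. l \<alpha> = \<alpha>} = {\<one>}"
    using L_closed(1) by (intro inj_on_image_eq_iff[OF inj_on_induced_L]) auto
  also have "\<dots> \<longleftrightarrow> point_stabilizer \<Omega> M \<alpha> = {\<one>}"
  proof
    assume "point_stabilizer \<Omega> M \<alpha> = {\<one>}"
    then show "{l \<in> L. l \<alpha> = \<alpha>} = {\<one>}"
      using L_M L_closed(1) by (auto simp: stabilizer_def)
  next
    assume triv: "{l \<in> L. l \<alpha> = \<alpha>} = {\<one>}"
    have "k = \<one>" if k: "k \<in> M" "k \<alpha> = \<alpha>" for k
    proof (rule Inter_others)
      show "k \<in> carrier P" using k M.subset by blast
      fix D assume "D \<in> comps"
      then obtain a where a: "a \<in> point_stabilizer \<Omega> G \<alpha>" "D = conjugate a ` L" by (rule compsE)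
      have aG: "a \<in> G" and kG: "k \<in> G" using a k M_G by auto
      have "conjugate (inv a) k \<in> M" using k aG by (intro M_conjugate) simp_all
      then obtain l z where lz: "l \<in> L" "z \<in> Z" "conjugate (inv a) k = l \<otimes> z"
        using comps_times_others[OF L_comps] by blast
      have "conjugate (inv a) k \<in> point_stabilizer \<Omega> G \<alpha>"
        using a(1) k(2) kG unfolding conjugate_def by (intro mult_A inv_A) simp_all
      then have "l \<in> point_stabilizer \<Omega> G \<alpha>"
        using component_part_in_A[OF lz(1,2)] lz(3) by simp
      then have "l \<in> {l \<in> L. l \<alpha> = \<alpha>}" using lz(1) by simp
      then have "l = \<one>" using triv by simp
      then have "conjugate (inv a) k = z" using lz Z_G by simp
      then have "k = conjugate a z" using conjugate_inv_cancel(2)[of a k] aG kG by simp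
      then show "k \<in> others D"
        using others_conjugate[OF _ L_comps lz(2), of a] a(2) aG by simp
    qed
    moreover have "\<one> \<in> M" by simp
    ultimately show "point_stabilizer \<Omega> M \<alpha> = {\<one>}" by (auto simp: stabilizer_def)
  qed
  finally show ?thesis by (simp add: M_regular_iff)
qed

end

section \<open>Decomposition of \<open>M\<close> and the three types\<close>

theorem theorem1p1:
  fixes \<Omega> :: "'a set" and G :: "('a \<Rightarrow> 'a) set" and \<alpha> :: 'a
  assumes "subgroup G (BijGroup \<Omega>)"
    and "infinite G"
    and "primitive_on \<Omega> G"
    and "\<alpha> \<in> \<Omega>"
    and "finite (point_stabilizer \<Omega> G \<alpha>)"
  shows "generated_by_finitely_many_torsion (perm_grp \<Omega> G) \<and>
    (\<exists>M. unique_minimal_normal M (perm_grp \<Omega> G) \<and>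
      (\<exists>(K :: ('a \<Rightarrow> 'a) monoid) (m :: nat) (C :: nat \<Rightarrow> ('a \<Rightarrow> 'a) set).
        infinite (carrier K) \<and> \<not> comm_group K \<and> finitely_generated K \<and> simple_grp K \<and>
        m \<ge> 1 \<and> internal_direct_product (perm_grp \<Omega> M) {1..m} C \<and>
        (\<forall>i\<in>{1..m}. perm_grp \<Omega> (C i) \<cong> K) \<and>
        transitive_action (perm_grp \<Omega> (point_stabilizer \<Omega> G \<alpha>)) (C ` {1..m})
          (conj_on_sets (perm_grp \<Omega> G) (C ` {1..m})) \<and>
        ((type_1 \<Omega> G M \<and> \<not> type_2 \<Omega> G M \<and> \<not> type_3 \<Omega> G M K m) \<or>
         (\<not> type_1 \<Omega> G M \<and> type_2 \<Omega> G M \<and> \<not> type_3 \<Omega> G M K m) \<or>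
         (\<not> type_1 \<Omega> G M \<and> \<not> type_2 \<Omega> G M \<and> type_3 \<Omega> G M K m))))"
proof -
  define P where "P = perm_grp \<Omega> G"
  interpret primitive_finite_stabilizer \<Omega> G P \<alpha>
    by (intro primitive_finite_stabilizer.intro permutation_group.intro
        primitive_finite_stabilizer_axioms.intro P_def assms)
  obtain M where M: "unique_minimal_normal M P"
    using ex_unique_minimal_normal by blast
  interpret primitive_minimal_normal \<Omega> G P \<alpha> M
    by unfold_locales (rule M)
  obtain L where L: "minimal_normal L (P\<lparr>carrier := M\<rparr>)"
    by (rule ex_minimal_normal_in_M)
  interpret primitive_component \<Omega> G P \<alpha> M L
    by unfold_locales (rule L)
  define m where "m = card comps"
  obtain C where C: "bij_betw C {1..m} comps"
    using ex_bij_betw_nat_finite_1[OF comps_finite] unfolding m_def by blast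
  have C_img: "C ` {1..m} = comps" using C by (simp add: bij_betw_def)
  have "\<exists>a. a \<in> point_stabilizer \<Omega> G \<alpha> \<and> conjugate a ` L = C i" if "i \<in> {1..m}" for i
    using C_img that by (metis compsE imageI)
  then obtain t where t: "\<And>i. i \<in> {1..m} \<Longrightarrow> t i \<in> point_stabilizer \<Omega> G \<alpha> \<and> conjugate (t i) ` L = C i"
    by metis
  interpret indexed_components \<Omega> G P \<alpha> M L "{1..m}" C t
    using C t by (intro indexed_components.intro primitive_component_axioms indexed_components_axioms.intro) auto
  let ?K = "perm_grp \<Omega> L"
  have "m \<ge> 1"
    using L_comps comps_finite unfolding m_def by (metis One_nat_def Suc_leI card_gt_0_iff empty_iff)
  \<comment> \<open>\<open>N\<close> is a simple minimal normal subgroup of the primitive group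
    \<open>H\<close>, so the type of \<open>H\<close> is decided by regularity of \<open>N\<close>,
    which agrees with that of \<open>M\<close>.\<close>
  have type3: "type_3 \<Omega> G M ?K m" if "\<not> simple_grp (perm_grp \<Omega> M)"
  proof -
    interpret Hm: primitive_minimal_normal \<Gamma> H "perm_grp \<Gamma> H" \<alpha> N
      by (rule H_primitive_minimal_normal)
    have "m > 1"
      using not_simple_imp_card_comps that unfolding m_def P_restrict by blast
    moreover have "perm_grp \<Gamma> N \<cong> ?K"
      using group.iso_sym[OF _ N_iso] subgroup_imp_group[OF L_subgroup] by (simp add: P_restrict)
    moreover have "regular_on \<Omega> M \<longrightarrow> type_1 \<Gamma> H N" "\<not> regular_on \<Omega> M \<longrightarrow> type_2 \<Gamma> H N"
      using Hm.type_1_if_regular Hm.type_2_if_not_regular N_simple regular_N_iff by blast+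
    ultimately show ?thesis
      unfolding type_3_def
      using that \<Gamma>_infinite Hp.G_subgroup H_infinite H_primitive base_\<Gamma> H_finite_stabilizer
        to_wreath_image_subgroup permutation_isomorphic_to_wreath N_unique_minimal_normal by blast
  qed
  have types: "(type_1 \<Omega> G M \<and> \<not> type_2 \<Omega> G M \<and> \<not> type_3 \<Omega> G M ?K m) \<or>
         (\<not> type_1 \<Omega> G M \<and> type_2 \<Omega> G M \<and> \<not> type_3 \<Omega> G M ?K m) \<or>
         (\<not> type_1 \<Omega> G M \<and> \<not> type_2 \<Omega> G M \<and> type_3 \<Omega> G M ?K m)"
  \<comment> \<open>Types 1 and 2 require \<open>M\<close> to be simple and are separated by
    regularity; type 3 requires \<open>M\<close> not to be simple. Hence no two of them hold
    together.\<close>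
  proof (cases "simple_grp (perm_grp \<Omega> M)")
    case True
    then show ?thesis
      using type_1_if_regular type_2_if_not_regular
      by (cases "regular_on \<Omega> M") (auto simp: type_1_def type_2_def type_3_def)
  next
    case False
    then show ?thesis using type3 by (auto simp: type_1_def type_2_def)
  qed
  show ?thesis
  proof (intro conjI exI)
    show "generated_by_finitely_many_torsion (perm_grp \<Omega> G)"
      using finitely_generated_by_torsion A_nontrivial unfolding P_def by blast
    show "unique_minimal_normal M (perm_grp \<Omega> G)" using M unfolding P_def .
    show "infinite (carrier ?K)" using L_infinite by simp
    show "\<not> comm_group ?K" "finitely_generated ?K" "simple_grp ?K"
      using L_not_abelian L_finitely_generated L_simple by (simp_all add: P_restrict)
    show "m \<ge> 1" by fact
    show "internal_direct_product (perm_grp \<Omega> M) {1..m} C"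
      using comps_direct_product[OF C] by (simp add: P_restrict)
    show "\<forall>i\<in>{1..m}. perm_grp \<Omega> (C i) \<cong> ?K"
      using comps_iso[OF C_comps] by (simp add: P_restrict)
    show "transitive_action (perm_grp \<Omega> (point_stabilizer \<Omega> G \<alpha>)) (C ` {1..m})
        (conj_on_sets (perm_grp \<Omega> G) (C ` {1..m}))"
      using A_transitive_on_comps unfolding C_img P_restrict unfolding P_def .
  qed (rule types)
qed

end
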